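(* Let $\Gamma$ be a quantum Lie algebra given by tensors $\sigma^{mk}_{ij}$, $C^k_{ij}$ ($i,j,k,m\in\{1,\dots,N\}$), let $\Gamma^\wedge[\Omega]$ be the associated algebra with generators $\chi_i,\gamma_i,\Omega^i$, let $A_{1\rightarrow n}$ be the antisymmetrizers built from $\sigma$, and let $h$ be the height of $\sigma$ (all defined in the context). Then the BRST operator for $\Gamma$, i.e. an element $Q\in\Gamma^\wedge[\Omega]$ with $$Q^2=0,$$ has the form $$Q=\Omega^i\,\chi_i+\sum_{r=1}^{h-1}Q_{(r)},$$ where, for $1\le r\le h-1$, $$Q_{(r)}=\Omega^{i_{r+1}}\,\Omega^{i_r}\cdots\Omega^{i_1}\;X^{j_1\dots j_r}_{i_1\dots i_{r+1}}\;\gamma_{j_1}\cdots\gamma_{j_r}$$ (products of $\Omega$'s and of $\gamma$'s being the wedge products in $\Gamma^\wedge[\Omega]$, summation over repeated indices), and where the $X^{\langle 1\dots r|}_{|1\dots r+1\rangle}=(X^{j_1\dots j_r}_{i_1\dots i_{r+1}})$ are numerical tensors satisfying the initial condition (case $r=1$) $$A_{12}\,X^{\langle 0|}_{|12\rangle}=-\,C^{\langle 0|}_{|12\rangle}$$ and, for $2\le r\le h-1$, the recurrent relations $$A_{1\rightarrow r+1}\,X^{\langle 1\dots r|}_{|1\dots r+1\rangle}\,A_{1\rightarrow r}=A_{1\rightarrow r+1}\left((-1)^r\,\sigma_{r+1\leftarrow 1}-\mathbf 1\right)X^{\langle 2\dots r|}_{|2\dots r+1\rangle}\,A_{2\rightarrow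 r}.$$ That is, there are tensors $X$ satisfying this initial condition and these recurrent relations, and the element $$Q=\Omega^i\,\chi_i+\sum_{r=1}^{h-1}\Omega^{i_{r+1}}\,\Omega^{i_r}\cdots\Omega^{i_1}\;X^{j_1\dots j_r}_{i_1\dots i_{r+1}}\;\gamma_{j_1}\cdots\gamma_{j_r}$$ which they define satisfies $Q^2=0$.
   Context: **Quantum Lie algebra.** Indices run over $\{1,\dots,N\}$ and repeated indices are summed. The data are an invertible matrix $\sigma=(\sigma^{mk}_{ij})$ and structure constants $C^k_{ij}$. The matrix $\sigma$ has eigenvalue $1$; let $P_{(1)}$ be the (spectral) projector on the eigenspace of $\sigma$ with eigenvalue $1$. It is required that $(P_{(1)})^{mk}_{ij}C^n_{mk}=0$ and that the following identities hold: $$C^p_{ni}C^l_{pj}=\sigma^{mk}_{ij}C^p_{nm}C^l_{pk}+C^p_{ij}C^l_{np},$$ $$C^k_{ni}\sigma^{pm}_{kq}=\sigma^{sj}_{iq}\sigma^{pk}_{ns}C^m_{kj},$$ $$(\sigma^{pj}_{im}C^n_{qp}+\delta^n_qC^j_{im})\,\sigma^{ks}_{nj}=\sigma^{jn}_{qi}\,(\sigma^{ps}_{nm}C^k_{jp}+\delta^k_jC^s_{nm}),$$ $$\sigma^{j_1j_2}_{i_1i_2}\sigma^{n_2k_3}_{j_2i_3}\sigma^{k_1k_2}_{j_1n_2}=\sigma^{j_2j_3}_{i_2i_3}\sigma^{k_1n_2}_{i_1j_2}\sigma^{k_2k_3}_{n_2j_3}\quad\text{(Yang–Baxter equation)}.$$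 The quantum Lie algebra $\Gamma$ is the associative algebra generated by $\chi_1,\dots,\chi_N$ with relations $\chi_i\chi_j-\sigma^{mk}_{ij}\chi_m\chi_k=C^k_{ij}\chi_k$. **Matrix notation.** Labels $1,2,3,\dots$ number copies of an $N$-dimensional space. For matrices, lower indices are "incoming" (row) indices and upper indices are "outgoing" (column) indices, and products contract the upper indices of the left factor with the lower indices of the right factor in the same space; e.g. $(fg)^k_i=f^j_ig^k_j$. A symbol $T^{\langle a_1\dots a_s|}_{|b_1\dots b_t\rangle}$ is a tensor with lower indices in spaces $b_1,\dots,b_t$ and upper indices in spaces $a_1,\dots,a_s$; it acts as the identity on the other spaces. $X^{\langle 2\dots r|}_{|2\dots r+1\rangle}$ is the tensor $X^{\langle 1\dots r-1|}_{|1\dots r\rangle}$ with all space labels shifted by one. The label $0$ in $X^{\langle 0|}_{|12\rangle}$, $C^{\langle 0|}_{|12\rangle}$ just labels the space of the single upper index, so the initial condition reads $(A_{12})^{mk}_{ij}X^n_{mk}=-C^n_{ij}$. $\sigma_{k\,k+1}$ is $\sigma$ acting in spaces $k,k+1$, and $\mathbf 1$ is the identity. For $n>k$, $$\sigma_{k\rightarrow n}=\sigma_{k\,k+1}\sigma_{k+1\,k+2}\cdots\sigma_{n-1\,n},\qquad \sigma_{n\leftarrow k}=\sigma_{n-1\,n}\cdots\sigma_{k+1\,k+2}\,\sigma_{k\,k+1}.$$ **Antisymmetrizers and height.** $A_{1\rightarrow 1}=\mathbf 1$ and, inductively, $$A_{1\rightarrow n}=\Big(\mathbf 1+\sum_{k=1}^{n-1}(-1)^{n-k}\sigma_{k\rightarrow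 n}\Big)A_{1\rightarrow n-1};$$ in particular $A_{12}=A_{1\rightarrow 2}=\mathbf 1-\sigma_{12}$. $A_{2\rightarrow n}$ is $A_{1\rightarrow n-1}$ with all space labels shifted by one. The height $h$ of $\sigma$ (assumed to exist) is the number with $A_{1\rightarrow h}\ne0$ and $A_{1\rightarrow n}=0$ for all $n>h$. **The algebra $\Gamma^\wedge[\Omega]$.** It is the unital associative algebra generated by $\chi_i$, $\gamma_i$, $\Omega^i$ ($i=1,\dots,N$), with the relations of $\Gamma$ for the $\chi_i$ and the following relations. * The $\gamma_i$ form a generalized wedge algebra: $\gamma_{|1\rangle}\wedge\dots\wedge\gamma_{|n\rangle}=A_{1\rightarrow n}\,\gamma_{|1\rangle}\otimes\dots\otimes\gamma_{|n\rangle}$. That is, $c^{i_1\dots i_n}\gamma_{i_1}\cdots\gamma_{i_n}=0$ for numerical $c$ whenever $c^{i_1\dots i_n}(A_{1\rightarrow n})^{j_1\dots j_n}_{i_1\dots i_n}=0$ for all $j_1,\dots,j_n$. * The $\Omega^i$ form a wedge algebra: $\Omega^{\langle r|}\wedge\dots\wedge\Omega^{\langle1|}=\Omega^{\langle r|}\otimes\dots\otimes\Omega^{\langle1|}A_{1\rightarrow r}$. That is, $\Omega^{j_r}\cdots\Omega^{j_1}d_{j_1\dots j_r}=0$ whenever $(A_{1\rightarrow r})^{j_1\dots j_r}_{i_1\dots i_r}d_{j_1\dots j_r}=0$ for all $i_1,\dots,i_r$. * Cross relations: $$\gamma_i\chi_j=\sigma^{mk}_{ij}\chi_m\gamma_k+C^k_{ij}\gamma_k,$$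 $$\gamma_j\Omega^i=-\Omega^p(\sigma^{-1})^{si}_{pj}\gamma_s+\delta^i_j,$$ $$\chi_j\Omega^i=\Omega^p\left(\sigma^{si}_{pj}\chi_s+C^i_{pj}\right).$$ *)

theory Defs
  imports "HOL-Analysis.Analysis" "HOL-Algebra.QuotRing" "HOL-Library.Poly_Mapping"
begin

section \<open>Tensors\<close>

text \<open>
  The index set \<open>{1,\<dots>,N}\<close> is a finite type \<^typ>\<open>'n\<close>. A numerical tensor takes the word of its
  lower indices and the word of its upper indices; only its values on words of the appropriate
  lengths ever matter.
\<close>

type_synonym 'n tensor = "'n list \<Rightarrow> 'n list \<Rightarrow> complex"

definition words :: "nat \<Rightarrow> 'n list set" where
  "words n = {I. length I = n}"

definition idt :: "'n tensor" where
  "idt I J = (if I = J then 1 else 0)"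

text \<open>
  \<open>S \<odot>\<^bsub>n\<^esub> T\<close> contracts the \<open>n\<close> upper indices of \<open>S\<close> with the \<open>n\<close> lower indices of \<open>T\<close>.
\<close>

definition tmul :: "'n tensor \<Rightarrow> nat \<Rightarrow> 'n tensor \<Rightarrow> 'n tensor"
    ("(_ \<odot>\<^bsub>_\<^esub>/ _)" [70, 0, 71] 70) where
  "(S \<odot>\<^bsub>n\<^esub> T) I K = (\<Sum>J\<in>words n. S I J * T J K)"

text \<open>
  \<open>emb a s t T\<close> lets a tensor \<open>T\<close> with \<open>s\<close> lower and \<open>t\<close> upper indices act after the first \<open>a\<close>
  spaces, as the identity on those \<open>a\<close> spaces and on all spaces to the right of \<open>T\<close>.
\<close>

definition emb :: "nat \<Rightarrow> nat \<Rightarrow> nat \<Rightarrow> 'n tensor \<Rightarrow> 'n tensor" where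
  "emb a s t T I J =
     (if take a I = take a J \<and> drop (a + s) I = drop (a + t) J
      then T (take s (drop a I)) (take t (drop a J)) else 0)"


section \<open>Quantum Lie algebra data\<close>

text \<open>
  Matrices have the lower indices as row and the upper indices as column indices:
  \<open>\<sigma> $ (i,j) $ (m,k)\<close> is \<open>\<sigma>\<^sup>m\<^sup>k\<^sub>i\<^sub>j\<close> and \<open>C $ (i,j) $ k\<close> is \<open>C\<^sup>k\<^sub>i\<^sub>j\<close>.
\<close>

type_synonym 'n braiding = "complex ^ ('n \<times> 'n) ^ ('n \<times> 'n)"
type_synonym 'n struct_consts = "complex ^ 'n ^ ('n \<times> 'n)"

text \<open>
  The spectral projector of \<open>M\<close> for \<open>c\<close>: the projector onto the (generalized) eigenspace that
  commutes with \<open>M\<close>, which determines it uniquely. If the eigenvalue \<open>c\<close> is semisimple, its range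
  is the eigenspace itself.
\<close>

definition spectral_projector :: "complex ^ 'm ^ 'm \<Rightarrow> complex \<Rightarrow> complex ^ 'm ^ 'm \<Rightarrow> bool" where
  "spectral_projector M c P \<longleftrightarrow>
     P ** P = P \<and> P ** M = M ** P \<and>
     range (\<lambda>v. P *v v) = {v. \<exists>k. ((\<lambda>w. M *v w - c *s w) ^^ k) v = 0}"

definition delta :: "'n \<Rightarrow> 'n \<Rightarrow> complex" where
  "delta i j = (if i = j then 1 else 0)"

locale quantum_lie =
  fixes \<sigma> :: "'n::finite braiding" and C :: "'n struct_consts"
  assumes invertible: "invertible \<sigma>"
    and eigenvalue_1: "\<exists>v. v \<noteq> 0 \<and> \<sigma> *v v = v"
    and projector: "\<exists>P. spectral_projector \<sigma> 1 P \<and> P ** C = 0"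
    and jacobi:
      "\<And>n i j l. (\<Sum>p\<in>UNIV. C $ (n,i) $ p * C $ (p,j) $ l) =
         (\<Sum>m\<in>UNIV. \<Sum>k\<in>UNIV. \<Sum>p\<in>UNIV. \<sigma> $ (i,j) $ (m,k) * C $ (n,m) $ p * C $ (p,k) $ l)
         + (\<Sum>p\<in>UNIV. C $ (i,j) $ p * C $ (n,p) $ l)"
    and C_braid:
      "\<And>n i q p m. (\<Sum>k\<in>UNIV. C $ (n,i) $ k * \<sigma> $ (k,q) $ (p,m)) =
         (\<Sum>s\<in>UNIV. \<Sum>j\<in>UNIV. \<Sum>k\<in>UNIV. \<sigma> $ (i,q) $ (s,j) * \<sigma> $ (n,s) $ (p,k) * C $ (k,j) $ m)"
    and braid_C:
      "\<And>q i m k s.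
         (\<Sum>n\<in>UNIV. \<Sum>j\<in>UNIV.
            ((\<Sum>p\<in>UNIV. \<sigma> $ (i,m) $ (p,j) * C $ (q,p) $ n) + delta n q * C $ (i,m) $ j)
            * \<sigma> $ (n,j) $ (k,s)) =
         (\<Sum>j\<in>UNIV. \<Sum>n\<in>UNIV.
            \<sigma> $ (q,i) $ (j,n) *
            ((\<Sum>p\<in>UNIV. \<sigma> $ (n,m) $ (p,s) * C $ (j,p) $ k) + delta k j * C $ (n,m) $ s))"
    and yang_baxter:
      "\<And>i1 i2 i3 k1 k2 k3.
         (\<Sum>j1\<in>UNIV. \<Sum>j2\<in>UNIV. \<Sum>n2\<in>UNIV.
            \<sigma> $ (i1,i2) $ (j1,j2) * \<sigma> $ (j2,i3) $ (n2,k3) * \<sigma> $ (j1,n2) $ (k1,k2)) =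
         (\<Sum>j2\<in>UNIV. \<Sum>j3\<in>UNIV. \<Sum>n2\<in>UNIV.
            \<sigma> $ (i2,i3) $ (j2,j3) * \<sigma> $ (i1,j2) $ (k1,n2) * \<sigma> $ (n2,j3) $ (k2,k3))"


section \<open>Antisymmetrizers and height\<close>

text \<open>
  \<open>sigma_at \<sigma> k\<close> is \<open>\<sigma>\<close> acting in spaces \<open>k, k+1\<close>, numbered from \<open>1\<close>. In \<open>sigma_right \<sigma> d k n\<close>
  (for \<open>\<sigma>\<^bsub>k\<rightarrow>n\<^esub>\<close>) and \<open>sigma_left \<sigma> d n k\<close> (for \<open>\<sigma>\<^bsub>n\<leftarrow>k\<^esub>\<close>), \<open>d\<close> is the total number of spaces.
\<close>

definition sigma_at :: "'n::finite braiding \<Rightarrow> nat \<Rightarrow> 'n tensor" where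
  "sigma_at \<sigma> k = emb (k - 1) 2 2 (\<lambda>I J. \<sigma> $ (I ! 0, I ! 1) $ (J ! 0, J ! 1))"

definition sigma_right :: "'n::finite braiding \<Rightarrow> nat \<Rightarrow> nat \<Rightarrow> nat \<Rightarrow> 'n tensor" where
  "sigma_right \<sigma> d k n = foldr (\<lambda>l M. sigma_at \<sigma> l \<odot>\<^bsub>d\<^esub> M) [k..<n] idt"

definition sigma_left :: "'n::finite braiding \<Rightarrow> nat \<Rightarrow> nat \<Rightarrow> nat \<Rightarrow> 'n tensor" where
  "sigma_left \<sigma> d n k = foldr (\<lambda>l M. sigma_at \<sigma> l \<odot>\<^bsub>d\<^esub> M) (rev [k..<n]) idt"

text \<open>
  \<open>antisymmetrizer \<sigma> n\<close> is \<open>A\<^bsub>1\<rightarrow>n\<^esub>\<close>; the value at \<open>0\<close> is a convention.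
\<close>

primrec antisymmetrizer :: "'n::finite braiding \<Rightarrow> nat \<Rightarrow> 'n tensor" where
  "antisymmetrizer \<sigma> 0 = idt"
| "antisymmetrizer \<sigma> (Suc n) =
     (if n = 0 then idt
      else (\<lambda>I J. idt I J + (\<Sum>k = 1..n. (-1) ^ (Suc n - k) * sigma_right \<sigma> (Suc n) k (Suc n) I J))
             \<odot>\<^bsub>Suc n\<^esub> emb 0 n n (antisymmetrizer \<sigma> n))"

definition is_height :: "'n::finite braiding \<Rightarrow> nat \<Rightarrow> bool" where
  "is_height \<sigma> h \<longleftrightarrow>
     (\<exists>I\<in>words h. \<exists>J\<in>words h. antisymmetrizer \<sigma> h I J \<noteq> 0) \<and>
     (\<forall>n>h. \<forall>I\<in>words n. \<forall>J\<in>words n. antisymmetrizer \<sigma> n I J = 0)"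


section \<open>Free associative algebras\<close>

text \<open>
  Words over an alphabet form the free monoid, so \<^typ>\<open>'g list \<Rightarrow>\<^sub>0 complex\<close> with the convolution
  product is the free unital associative algebra generated by \<^typ>\<open>'g\<close>.
\<close>

instantiation list :: (type) monoid_add
begin

definition plus_list :: "'a list \<Rightarrow> 'a list \<Rightarrow> 'a list" where
  "plus_list xs ys = xs @ ys"

definition zero_list :: "'a list" where
  "zero_list = []"

instance
  by standard (simp_all add: plus_list_def zero_list_def)

end

type_synonym 'g free_alg = "'g list \<Rightarrow>\<^sub>0 complex"

definition gen :: "'g \<Rightarrow> 'g free_alg" where
  "gen g = Poly_Mapping.single [g] 1"

definition scalar :: "complex \<Rightarrow> 'g free_alg" where
  "scalar c = Poly_Mapping.single [] c"

definition free_ring :: "'g free_alg ring" where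
  "free_ring = \<lparr>carrier = UNIV, mult = (*), one = 1, zero = 0, add = (+)\<rparr>"


section \<open>The algebra generated by \<open>\<chi>\<close>, \<open>\<gamma>\<close>, \<open>\<Omega>\<close>\<close>

datatype 'n generator = Chi 'n | Gam 'n | Omg 'n

abbreviation chi :: "'n \<Rightarrow> 'n generator free_alg" where "chi i \<equiv> gen (Chi i)"
abbreviation gam :: "'n \<Rightarrow> 'n generator free_alg" where "gam i \<equiv> gen (Gam i)"
abbreviation omg :: "'n \<Rightarrow> 'n generator free_alg" where "omg i \<equiv> gen (Omg i)"

text \<open>
  \<open>gam_word [i\<^sub>1,\<dots>,i\<^sub>n]\<close> is \<open>\<gamma>\<^bsub>i\<^sub>1\<^esub> \<cdots> \<gamma>\<^bsub>i\<^sub>n\<^esub>\<close>, whereas \<open>omg_word [j\<^sub>1,\<dots>,j\<^sub>n]\<close> is the product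
  \<open>\<Omega>\<^bsup>j\<^sub>n\<^esup> \<cdots> \<Omega>\<^bsup>j\<^sub>1\<^esup>\<close> in reverse order.
\<close>

definition gam_word :: "'n list \<Rightarrow> 'n generator free_alg" where
  "gam_word I = prod_list (map gam I)"

definition omg_word :: "'n list \<Rightarrow> 'n generator free_alg" where
  "omg_word J = prod_list (map omg (rev J))"

text \<open>Each of the following sets consists of the elements that are set equal to zero.\<close>

definition chi_rels :: "'n::finite braiding \<Rightarrow> 'n struct_consts \<Rightarrow> 'n generator free_alg set" where
  "chi_rels \<sigma> C =
     {chi i * chi j - (\<Sum>m\<in>UNIV. \<Sum>k\<in>UNIV. scalar (\<sigma> $ (i,j) $ (m,k)) * chi m * chi k)
        - (\<Sum>k\<in>UNIV. scalar (C $ (i,j) $ k) * chi k) | i j. True}"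

definition gam_rels :: "'n::finite braiding \<Rightarrow> 'n generator free_alg set" where
  "gam_rels \<sigma> =
     {(\<Sum>I\<in>words n. scalar (c I) * gam_word I) | n c.
        n \<ge> 1 \<and> (\<forall>J\<in>words n. (\<Sum>I\<in>words n. c I * antisymmetrizer \<sigma> n I J) = 0)}"

definition omg_rels :: "'n::finite braiding \<Rightarrow> 'n generator free_alg set" where
  "omg_rels \<sigma> =
     {(\<Sum>J\<in>words n. omg_word J * scalar (d J)) | n d.
        n \<ge> 1 \<and> (\<forall>I\<in>words n. (\<Sum>J\<in>words n. antisymmetrizer \<sigma> n I J * d J) = 0)}"

definition gam_chi_rels :: "'n::finite braiding \<Rightarrow> 'n struct_consts \<Rightarrow> 'n generator free_alg set" where
  "gam_chi_rels \<sigma> C =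
     {gam i * chi j
        - ((\<Sum>m\<in>UNIV. \<Sum>k\<in>UNIV. scalar (\<sigma> $ (i,j) $ (m,k)) * chi m * gam k)
           + (\<Sum>k\<in>UNIV. scalar (C $ (i,j) $ k) * gam k)) | i j. True}"

definition gam_omg_rels :: "'n::finite braiding \<Rightarrow> 'n generator free_alg set" where
  "gam_omg_rels \<sigma> =
     {gam j * omg i
        - (- (\<Sum>p\<in>UNIV. \<Sum>s\<in>UNIV. omg p * scalar (matrix_inv \<sigma> $ (p,j) $ (s,i)) * gam s)
           + scalar (delta i j)) | i j. True}"

definition chi_omg_rels :: "'n::finite braiding \<Rightarrow> 'n struct_consts \<Rightarrow> 'n generator free_alg set" where
  "chi_omg_rels \<sigma> C =
     {chi j * omg i
        - (\<Sum>p\<in>UNIV. omg p *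
             ((\<Sum>s\<in>UNIV. scalar (\<sigma> $ (p,j) $ (s,i)) * chi s) + scalar (C $ (p,j) $ i))) | i j. True}"

definition Gamma_ideal :: "'n::finite braiding \<Rightarrow> 'n struct_consts \<Rightarrow> 'n generator free_alg set" where
  "Gamma_ideal \<sigma> C =
     Idl\<^bsub>free_ring\<^esub> (chi_rels \<sigma> C \<union> gam_rels \<sigma> \<union> omg_rels \<sigma> \<union>
       gam_chi_rels \<sigma> C \<union> gam_omg_rels \<sigma> \<union> chi_omg_rels \<sigma> C)"

definition Gamma_wedge_Omega ::
    "'n::finite braiding \<Rightarrow> 'n struct_consts \<Rightarrow> 'n generator free_alg set ring" where
  "Gamma_wedge_Omega \<sigma> C = free_ring Quot Gamma_ideal \<sigma> C"


section \<open>The BRST operator\<close>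

text \<open>
  \<open>X r\<close> has \<open>r + 1\<close> lower and \<open>r\<close> upper indices. The tensors \<open>emb 1 \<dots>\<close> in \<open>recurrence\<close> are the
  ones with all space labels shifted by one.
\<close>

definition initial_condition ::
    "'n::finite braiding \<Rightarrow> 'n struct_consts \<Rightarrow> (nat \<Rightarrow> 'n tensor) \<Rightarrow> bool" where
  "initial_condition \<sigma> C X \<longleftrightarrow>
     (\<forall>i j n. (antisymmetrizer \<sigma> 2 \<odot>\<^bsub>2\<^esub> X 1) [i, j] [n] = - C $ (i,j) $ n)"

definition recurrence :: "'n::finite braiding \<Rightarrow> (nat \<Rightarrow> 'n tensor) \<Rightarrow> nat \<Rightarrow> bool" where
  "recurrence \<sigma> X r \<longleftrightarrow>
     (\<forall>I\<in>words (r + 1). \<forall>J\<in>words r.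
        (antisymmetrizer \<sigma> (r + 1) \<odot>\<^bsub>r + 1\<^esub> X r \<odot>\<^bsub>r\<^esub> antisymmetrizer \<sigma> r) I J =
        (antisymmetrizer \<sigma> (r + 1)
           \<odot>\<^bsub>r + 1\<^esub> (\<lambda>K L. (-1) ^ r * sigma_left \<sigma> (r + 1) (r + 1) 1 K L - idt K L)
           \<odot>\<^bsub>r + 1\<^esub> emb 1 r (r - 1) (X (r - 1))
           \<odot>\<^bsub>r\<^esub> emb 1 (r - 1) (r - 1) (antisymmetrizer \<sigma> (r - 1))) I J)"

definition brst_tensors ::
    "'n::finite braiding \<Rightarrow> 'n struct_consts \<Rightarrow> nat \<Rightarrow> (nat \<Rightarrow> 'n tensor) \<Rightarrow> bool" where
  "brst_tensors \<sigma> C h X \<longleftrightarrow>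
     initial_condition \<sigma> C X \<and> (\<forall>r. 2 \<le> r \<and> r \<le> h - 1 \<longrightarrow> recurrence \<sigma> X r)"

definition brst_rep :: "nat \<Rightarrow> (nat \<Rightarrow> 'n::finite tensor) \<Rightarrow> 'n generator free_alg" where
  "brst_rep h X =
     (\<Sum>i\<in>UNIV. omg i * chi i) +
     (\<Sum>r = 1..h - 1. \<Sum>I\<in>words (r + 1). \<Sum>J\<in>words r.
        omg_word I * scalar (X r I J) * gam_word J)"

definition brst ::
    "'n::finite braiding \<Rightarrow> 'n struct_consts \<Rightarrow> nat \<Rightarrow> (nat \<Rightarrow> 'n tensor) \<Rightarrow> 'n generator free_alg set"
  where
  "brst \<sigma> C h X = Gamma_ideal \<sigma> C +>\<^bsub>free_ring\<^esub> brst_rep h X"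

end

theory Submission
  imports Defs "HOL-Library.Stream"
begin

text \<open>
  Let \<open>Q'\<close> be the sum of the \<open>Q\<^sub>(\<^sub>r\<^sub>)\<close>. Modulo the wedge relations \<open>Q\<^sub>(\<^sub>r\<^sub>)\<close> depends only on
  \<open>W\<^sub>r = A X\<^sub>r A\<close>, where \<open>A\<close> denotes the antisymmetrizers on \<open>r + 1\<close> and on \<open>r\<close> strands, and the
  recurrence determines \<open>W\<^sub>r\<close> from \<open>W\<^sub>r\<^sub>-\<^sub>1\<close>. It can be solved for \<open>X\<^sub>r\<close> if the tensor \<open>W\<^sub>r\<close> so
  determined is divisible by the antisymmetrizers on both sides. On the left this follows from
  divisibility of \<open>C\<close> by \<open>1 - \<sigma>\<close>, i.e. from the condition on the spectral projector. On the right,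
  \<open>W\<^sub>r\<close> is, up to sign, the off-diagonal block of an antisymmetrizer of Coxeter type B, in which
  the additional generator encodes \<open>C\<close>, and that one is divisible by the antisymmetrizer of its
  parabolic subgroup of type A.

  The recurrence says exactly that \<open>Q' \<Omega>\<^sup>k + \<Omega>\<^sup>k Q'\<close> is the quadratic expression in \<open>\<Omega>\<close> with
  coefficients \<open>X\<^sub>1\<close>, and the braid relations for \<open>\<sigma>\<close> and \<open>C\<close> give \<open>\<chi>\<^sub>j Q' = Q' \<chi>\<^sub>j\<close>. Hence
  \<open>Q\<^sup>2 = Q'\<^sup>2\<close>, and by the Jacobi identity \<open>Q'\<^sup>2\<close> commutes with every \<open>\<Omega>\<^sup>k\<close>. In the Fock
  representation on words in \<open>\<Omega>\<close> the vacuum is annihilated by every \<open>\<gamma>\<^sub>j\<close>, hence by \<open>Q'\<close>, so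
  \<open>Q'\<^sup>2\<close> acts as zero. Finally, a normally ordered element in \<open>\<Omega>\<close> and \<open>\<gamma>\<close> that acts as zero
  vanishes modulo the wedge relations.
\<close>

section \<open>Antisymmetrizers in the braid group algebra\<close>

text \<open>Expanding \<open>Q'^2\<close> directly would need identities between the tensors of all
  degrees, and there is no basis of the algebra against which coefficients could be compared.
  Commuting with \<Omega> avoids the first difficulty, since only a cubic term in \<Omega> built
  from \<open>X 1\<close> is left to check. The Fock quotient avoids the second, since a vector
  vanishes there exactly when the antisymmetrizers kill it. The price is that \<open>Q'^2\<close>
  has to be handled both in the algebra and in the annihilator of the Fock quotient, where \<chi>
  acts as zero. That part therefore uses only the wedge relations and those between \<gamma> and
  \<Omega>, modulo an arbitrary ideal containing them. The obstacle to the existence of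
  \<open>X\<close> lies on the right: the recurrence visibly ends in the antisymmetrizer of the last
  r - 1 strands, while \<open>A X A\<close> ends in that of all r strands. Type B supplies the
  missing symmetry because the factor in the recurrence is a block of a signed sum of coset
  representatives in type B.\<close>

text \<open>
  For \<open>s i = \<sigma>\<^sub>i\<^sub>,\<^sub>i\<^sub>+\<^sub>1\<close>, \<open>dn s a n\<close> and \<open>up s a n\<close> are the paper's \<open>\<sigma>\<close> with subscript \<open>a + n \<leftarrow> a\<close>
  and \<open>a \<rightarrow> a + n\<close>, and \<open>alt s a n\<close> is the antisymmetrizer on the \<open>n\<close> strands from \<open>a\<close> on. The
  signed sums \<open>z1\<close>, \<open>z2\<close>, \<open>z1r\<close>, \<open>z2r\<close> of coset representatives split off its last and its first
  strand, from the left and from the right.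
\<close>

primrec dn :: "(nat \<Rightarrow> 'a::ring_1) \<Rightarrow> nat \<Rightarrow> nat \<Rightarrow> 'a" where
  "dn s a 0 = 1"
| "dn s a (Suc n) = s (a + n) * dn s a n"

primrec up :: "(nat \<Rightarrow> 'a::ring_1) \<Rightarrow> nat \<Rightarrow> nat \<Rightarrow> 'a" where
  "up s a 0 = 1"
| "up s a (Suc n) = up s a n * s (a + n)"

primrec z1 :: "(nat \<Rightarrow> 'a::ring_1) \<Rightarrow> nat \<Rightarrow> nat \<Rightarrow> 'a" where
  "z1 s a 0 = 0"
| "z1 s a (Suc n) = 1 - z1 s a n * s (a + n - 1)"

primrec z2 :: "(nat \<Rightarrow> 'a::ring_1) \<Rightarrow> nat \<Rightarrow> nat \<Rightarrow> 'a" where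
  "z2 s a 0 = 0"
| "z2 s a (Suc n) = z2 s a n + (-1) ^ n * dn s a n"

primrec z1r :: "(nat \<Rightarrow> 'a::ring_1) \<Rightarrow> nat \<Rightarrow> nat \<Rightarrow> 'a" where
  "z1r s a 0 = 0"
| "z1r s a (Suc n) = 1 - s (a + n - 1) * z1r s a n"

primrec z2r :: "(nat \<Rightarrow> 'a::ring_1) \<Rightarrow> nat \<Rightarrow> nat \<Rightarrow> 'a" where
  "z2r s a 0 = 0"
| "z2r s a (Suc n) = z2r s a n + (-1) ^ n * up s a n"

primrec alt :: "(nat \<Rightarrow> 'a::ring_1) \<Rightarrow> nat \<Rightarrow> nat \<Rightarrow> 'a" where
  "alt s a 0 = 1"
| "alt s a (Suc n) = z1 s a (Suc n) * alt s a n"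

lemma dn_Suc': "dn s a (Suc n) = dn s (Suc a) n * s a"
  by (induction n) (simp_all add: mult.assoc)

lemma up_Suc': "up s a (Suc n) = s a * up s (Suc a) n"
  by (induction n) (simp_all add: mult.assoc)

lemma conj_mult:
  fixes x :: "'a::semigroup_mult"
  assumes "x * y = y' * x" "x * z = z' * x"
  shows "x * (y * z) = y' * z' * x"
  by (metis assms mult.assoc)

lemma conj_mult2:
  fixes x :: "'a::semigroup_mult"
  assumes "x * y = y' * u" "u * z = z' * v"
  shows "x * (y * z) = y' * z' * v"
  by (metis assms mult.assoc)

lemma minus_one_power_commute: "(-1) ^ n * x = x * (-1) ^ n" for x :: "'a::ring_1"
  by (induction n) (simp_all add: mult.assoc)

lemma minus_one_power_cancel: "(-1) ^ n * ((-1) ^ n * x) = x" for x :: "'a::ring_1"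
  by (induction n arbitrary: x) simp_all

lemma minus_one_power_left_commute: "x * ((-1) ^ n * y) = (-1) ^ n * (x * y)" for x :: "'a::ring_1"
  by (metis minus_one_power_commute mult.assoc)

text \<open>On n + 1 strands \<open>z1\<close> is the alternating sum of the products
  \<open>s (a + n - k) ... s (a + n - 1)\<close> for k from 0 to n. The definition factors out the
  last generator; isolating the longest product is what inductions at the first strand need.\<close>

lemma z1_Suc': "z1 s a (Suc n) = z1 s (Suc a) n + (-1) ^ n * up s a n"
proof (induction n)
  case (Suc n)
  have "z1 s a (Suc (Suc n)) = 1 - (z1 s (Suc a) n + (-1) ^ n * up s a n) * s (a + n)"
    using Suc by simp
  also have "\<dots> = z1 s (Suc a) (Suc n) + (-1) ^ Suc n * up s a (Suc n)"
    by (cases n) (simp_all add: algebra_simps)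
  finally show ?case .
qed simp

lemma z2_Suc': "z2 s a (Suc n) = 1 - z2 s (Suc a) n * s a"
  by (induction n arbitrary: a) (simp_all add: dn_Suc' algebra_simps del: dn.simps(2))

lemma z1r_Suc': "z1r s a (Suc n) = z1r s (Suc a) n + (-1) ^ n * dn s a n"
proof (induction n)
  case (Suc n)
  have "z1r s a (Suc (Suc n)) = 1 - s (a + n) * (z1r s (Suc a) n + (-1) ^ n * dn s a n)"
    using Suc by simp
  also have "\<dots> = z1r s (Suc a) (Suc n) + (-1) ^ Suc n * dn s a (Suc n)"
    using minus_one_power_commute[of n "s (a + n)"]
    by (cases n) (simp_all add: algebra_simps flip: mult.assoc)
  finally show ?case .
qed simp

lemma z2r_Suc': "z2r s a (Suc n) = 1 - s a * z2r s (Suc a) n"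
proof (induction n arbitrary: a)
  case (Suc n)
  have "z2r s a (Suc (Suc n)) = 1 - s a * z2r s (Suc a) n + (-1) ^ Suc n * (s a * up s (Suc a) n)"
    using Suc[of a] by (simp add: up_Suc' del: up.simps(2))
  also have "\<dots> = 1 - s a * z2r s (Suc a) (Suc n)"
    using minus_one_power_commute[of n "s a"]
    by (simp add: algebra_simps flip: mult.assoc)
  finally show ?case .
qed simp

text \<open>Whatever intertwines generators intertwines all elements built from them:
  \<open>b = a\<close> yields commutation, and shifts by one arise from the cycles below. The bounds
  count generators: \<open>dn\<close> and \<open>up\<close> of length k involve k of them, the sums
  on k strands only k - 1.\<close>

lemma commute_families:
  fixes s :: "nat \<Rightarrow> 'a::ring_1"
  assumes st: "\<And>j. j + 1 < n \<Longrightarrow> x * s (a + j) = s (b + j) * x"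
  shows dn_conj: "k + 1 \<le> n \<or> k = 0 \<Longrightarrow> x * dn s a k = dn s b k * x"
    and up_conj: "k + 1 \<le> n \<or> k = 0 \<Longrightarrow> x * up s a k = up s b k * x"
    and z1_conj: "k \<le> n \<Longrightarrow> x * z1 s a k = z1 s b k * x"
    and z2_conj: "k \<le> n \<Longrightarrow> x * z2 s a k = z2 s b k * x"
    and alt_conj: "k \<le> n \<Longrightarrow> x * alt s a k = alt s b k * x"
proof -
  show dn: "x * dn s a k = dn s b k * x" if "k + 1 \<le> n \<or> k = 0" for k
    using that
  proof (induction k)
    case (Suc k)
    have "x * dn s a (Suc k) = (x * s (a + k)) * dn s a k" by (simp add: mult.assoc)
    also have "\<dots> = s (b + k) * (x * dn s a k)" using Suc st[of k] by (simp add: mult.assoc)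
    finally show ?case using Suc by (simp add: mult.assoc)
  qed simp
  show "x * up s a k = up s b k * x" if "k + 1 \<le> n \<or> k = 0" for k
    using that
  proof (induction k)
    case (Suc k)
    have "x * up s a (Suc k) = (x * up s a k) * s (a + k)" by (simp add: mult.assoc)
    also have "\<dots> = up s b k * (x * s (a + k))" using Suc by (simp add: mult.assoc)
    finally show ?case using Suc st[of k] by (simp add: mult.assoc)
  qed simp
  show z1: "x * z1 s a k = z1 s b k * x" if "k \<le> n" for k
    using that
  proof (induction k)
    case (Suc k)
    show ?case
    proof (cases k)
      case (Suc m)
      have "x * z1 s a (Suc k) = x - (x * z1 s a k) * s (a + m)"
        by (simp add: Suc algebra_simps)
      also have "\<dots> = x - z1 s b k * (x * s (a + m))"
        using Suc.IH Suc.prems by (simp add: mult.assoc)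
      also have "\<dots> = x - z1 s b k * (s (b + m) * x)"
        using st[of m] Suc Suc.prems by simp
      finally show ?thesis by (simp add: Suc algebra_simps)
    qed simp
  qed simp
  show "x * z2 s a k = z2 s b k * x" if "k \<le> n" for k
    using that
  proof (induction k)
    case (Suc k)
    have "x * ((-1) ^ k * dn s a k) = (-1) ^ k * (x * dn s a k)"
      by (metis minus_one_power_commute mult.assoc)
    also have "\<dots> = (-1) ^ k * dn s b k * x" using dn[of k] Suc.prems by (simp add: mult.assoc)
    finally show ?case using Suc by (simp add: algebra_simps)
  qed simp
  show "x * alt s a k = alt s b k * x" if "k \<le> n" for k
    using that
  proof (induction k)
    case (Suc k)
    have "x * alt s a (Suc k) = (x * z1 s a (Suc k)) * alt s a k" by (simp add: mult.assoc)
    also have "\<dots> = z1 s b (Suc k) * (x * alt s a k)"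
      using z1[of "Suc k"] Suc.prems by (simp add: mult.assoc del: z1.simps)
    finally show ?case using Suc by (simp add: mult.assoc del: z1.simps)
  qed simp
qed

section \<open>Cycles, coset sums and the factorizations of the antisymmetrizer\<close>

locale braid_family =
  fixes s :: "nat \<Rightarrow> 'a::ring_1"
  assumes far: "i + 2 \<le> j \<Longrightarrow> s i * s j = s j * s i"
    and braid: "s i * s (Suc i) * s i = s (Suc i) * s i * s (Suc i)"
begin

lemma far_dn: "i + 2 \<le> a \<or> a + n + 1 \<le> i \<Longrightarrow> s i * dn s a n = dn s a n * s i"
proof (induction n)
  case (Suc n)
  then have "s i * s (a + n) = s (a + n) * s i" using far[of i "a+n"] far[of "a+n" i] by auto
  moreover have "s i * dn s a n = dn s a n * s i" using Suc by auto
  ultimately show ?case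
    using conj_mult[of "s i" "s (a + n)" "s (a + n)" "dn s a n" "dn s a n"] by simp
qed simp

lemma far_up: "i + 2 \<le> a \<or> a + n + 1 \<le> i \<Longrightarrow> s i * up s a n = up s a n * s i"
proof (induction n)
  case (Suc n)
  then have "s i * s (a + n) = s (a + n) * s i" using far[of i "a+n"] far[of "a+n" i] by auto
  moreover have "s i * up s a n = up s a n * s i" using Suc by auto
  ultimately show ?case
    using conj_mult[of "s i" "up s a n" "up s a n" "s (a + n)" "s (a + n)"] by simp
qed simp

text \<open>\<open>s i\<close> commutes with the factors to its left until it meets
  \<open>s i * s (Suc i)\<close>; there the braid relation turns it into \<open>s (Suc i)\<close>,
  which commutes with the rest.\<close>

lemma up_shift: "a \<le> i \<Longrightarrow> i + 1 < a + n \<Longrightarrow> up s a n * s i = s (Suc i) * up s a n"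
proof (induction n)
  case (Suc n)
  show ?case
  proof (cases "i + 1 < a + n")
    case True
    have "up s a (Suc n) * s i = up s a n * (s (a + n) * s i)" by (simp add: mult.assoc)
    also have "s (a + n) * s i = s i * s (a + n)" using far[of i "a+n"] True by simp
    also have "up s a n * (s i * s (a + n)) = s (Suc i) * up s a n * s (a + n)"
      using Suc True by (simp flip: mult.assoc)
    finally show ?thesis by (simp add: mult.assoc)
  next
    case False
    then obtain m where m: "n = Suc m" "i = a + m" using Suc.prems
      by (intro that[of "n - 1"]) auto
    have "up s a (Suc n) * s i = up s a m * (s i * s (Suc i) * s i)"
      by (simp add: m mult.assoc)
    also have "\<dots> = up s a m * s (Suc i) * s i * s (Suc i)" using braid[of i] by (simp add: mult.assoc)
    also have "up s a m * s (Suc i) = s (Suc i) * up s a m" using far_up[of "Suc i" a m] m by simp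
    finally show ?thesis by (simp add: m mult.assoc)
  qed
qed simp

lemma dn_shift: "a \<le> i \<Longrightarrow> i + 1 < a + n \<Longrightarrow> dn s a n * s (Suc i) = s i * dn s a n"
proof (induction n)
  case (Suc n)
  show ?case
  proof (cases "i + 1 < a + n")
    case True
    have "dn s a (Suc n) * s (Suc i) = s (a + n) * (dn s a n * s (Suc i))" by (simp add: mult.assoc)
    also have "\<dots> = s (a + n) * s i * dn s a n" using Suc True by (simp add: mult.assoc)
    also have "s (a + n) * s i = s i * s (a + n)" using far[of i "a+n"] True by simp
    finally show ?thesis by (simp add: mult.assoc)
  next
    case False
    then obtain m where m: "n = Suc m" "i = a + m" using Suc.prems
      by (intro that[of "n - 1"]) auto
    have "dn s a (Suc n) * s (Suc i) = s (Suc i) * s i * (dn s a m * s (Suc i))"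
      by (simp add: m mult.assoc)
    also have "dn s a m * s (Suc i) = s (Suc i) * dn s a m" using far_dn[of "Suc i" a m] m by simp
    also have "s (Suc i) * s i * (s (Suc i) * dn s a m) = (s i * s (Suc i) * s i) * dn s a m"
      by (metis braid mult.assoc)
    finally show ?thesis by (simp add: m mult.assoc)
  qed
qed simp

lemma up_conj_shift:
  "k < n \<Longrightarrow> up s a n * dn s a k = dn s (Suc a) k * up s a n"
  "k \<le> n \<Longrightarrow> up s a n * z1 s a k = z1 s (Suc a) k * up s a n"
  "k \<le> n \<Longrightarrow> up s a n * z2 s a k = z2 s (Suc a) k * up s a n"
  "k \<le> n \<Longrightarrow> up s a n * alt s a k = alt s (Suc a) k * up s a n"
  using commute_families[where x = "up s a n" and a = a and b = "Suc a" and n = n and k = k and s = s] up_shift[of a "a + j" n for j]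
  by auto

lemma dn_conj_shift:
  "k < n \<Longrightarrow> dn s a n * dn s (Suc a) k = dn s a k * dn s a n"
  "k \<le> n \<Longrightarrow> dn s a n * z1 s (Suc a) k = z1 s a k * dn s a n"
  "k \<le> n \<Longrightarrow> dn s a n * z2 s (Suc a) k = z2 s a k * dn s a n"
  "k \<le> n \<Longrightarrow> dn s a n * alt s (Suc a) k = alt s a k * dn s a n"
  using commute_families[where x = "dn s a n" and a = "Suc a" and b = a and n = n and k = k and s = s] dn_shift[of a "a + j" n for j]
  by auto

text \<open>Splitting off the last strand and then the first has to agree with the opposite order.
  This identity is what makes the one-sided recursion of \<open>alt\<close> symmetric.\<close>

lemma z1_z2_exchange: "z1 s a (Suc (Suc n)) * z2 s a (Suc n) = z2 s a (Suc (Suc n)) * z1 s (Suc a) (Suc n)"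
proof (induction n arbitrary: a)
  case 0
  show ?case by (simp add: algebra_simps)
next
  case (Suc n)
  define u S P Z Z' R v where defs: "u = up s a (Suc (Suc n))" "S = s a" "P = z1 s (Suc a) (Suc (Suc n))"
    "Z = z2 s (Suc a) (Suc n)" "Z' = z2 s (Suc a) (Suc (Suc n))" "R = z1 s (Suc (Suc a)) (Suc n)"
    "v = up s (Suc a) (Suc n)"
  define e where "e = (-1 :: 'a) ^ n"
  have e: "e * x = x * e" for x unfolding e_def by (rule minus_one_power_commute)
  have com: "S * R = R * S"
    unfolding defs using commute_families(3)[where x = "s a" and a = "Suc (Suc a)" and b = "Suc (Suc a)" and n = "Suc n" and k = "Suc n" and s = s] far[of a]
    by (simp del: z1.simps)
  have u: "u = S * v" unfolding defs by (rule up_Suc')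
  have z2a: "z2 s a (Suc (Suc n)) = 1 - Z * S" unfolding defs by (rule z2_Suc')
  \<comment> \<open>\<open>1 - Z * S\<close> is \<open>z2\<close> on the unshifted strands, so the
    cycle \<open>u\<close> carries it to \<open>Z'\<close>.\<close>
  have uz: "u * (1 - Z * S) = Z' * u"
    unfolding defs using up_conj_shift(3)[of "Suc (Suc n)" "Suc (Suc n)" a] by (simp only: z2_Suc'[symmetric] le_refl)
  have z1a: "z1 s a (Suc (Suc (Suc n))) = P + e * u"
    unfolding defs e_def by (subst z1_Suc') simp
  have z2a': "z2 s a (Suc (Suc (Suc n))) = 1 - Z' * S" unfolding defs by (rule z2_Suc')
  have P: "P = R - e * v" unfolding defs e_def by (subst z1_Suc') simp
  have IH: "P * Z = Z' * R" unfolding defs by (rule Suc)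
  have "(P + e * u) * (1 - Z * S) = P - P * Z * S + e * (u * (1 - Z * S))"
    by (simp add: algebra_simps)
  also have "\<dots> = P - Z' * (S * R) + e * (Z' * (S * v))"
    unfolding IH uz com unfolding u by (simp add: mult.assoc)
  also have "e * (Z' * (S * v)) = Z' * S * (e * v)" by (metis e mult.assoc)
  also have "P - Z' * (S * R) + Z' * S * (e * v) = P - Z' * S * P" by (subst (2) P) (simp add: algebra_simps)
  also have "\<dots> = (1 - Z' * S) * P" by (simp add: algebra_simps)
  finally show ?case unfolding z1a z2a z2a' defs .
qed

lemma alt_Suc_z2: "alt s a (Suc n) = z2 s a (Suc n) * alt s (Suc a) n"
proof (induction n arbitrary: a)
  case (Suc n)
  have "alt s a (Suc (Suc n)) = (z1 s a (Suc (Suc n)) * z2 s a (Suc n)) * alt s (Suc a) n"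
    using Suc[of a] by (simp add: mult.assoc del: z1.simps z2.simps)
  also have "\<dots> = z2 s a (Suc (Suc n)) * (z1 s (Suc a) (Suc n) * alt s (Suc a) n)"
    by (simp only: z1_z2_exchange mult.assoc)
  finally show ?case by (simp only: alt.simps)
qed simp

text \<open>The longest term of \<open>z2\<close> is a cycle, which moves the antisymmetrizer of the
  shifted strands back to the first ones; the remaining terms fall under the induction
  hypothesis.\<close>

lemma alt_Suc_z1r: "alt s a (Suc n) = alt s a n * z1r s a (Suc n)"
proof (induction n arbitrary: a)
  case (Suc n)
  let ?d = "(-1) ^ Suc n * dn s a (Suc n)"
  have "alt s a (Suc (Suc n)) = (z2 s a (Suc n) + ?d) * alt s (Suc a) (Suc n)"
    by (simp only: alt_Suc_z2[of a "Suc n"] z2.simps(2)[of s a "Suc n"])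
  also have "\<dots> = z2 s a (Suc n) * (alt s (Suc a) n * z1r s (Suc a) (Suc n)) + ?d * alt s (Suc a) (Suc n)"
    by (simp only: Suc[of "Suc a"] distrib_right)
  also have "z2 s a (Suc n) * (alt s (Suc a) n * z1r s (Suc a) (Suc n)) = alt s a (Suc n) * z1r s (Suc a) (Suc n)"
    by (simp only: alt_Suc_z2[of a n] mult.assoc)
  also have "?d * alt s (Suc a) (Suc n) = alt s a (Suc n) * ?d"
    using dn_conj_shift(4)[of "Suc n" "Suc n" a] by (simp only: minus_one_power_left_commute mult.assoc order_refl)
  finally show ?case by (simp only: z1r_Suc'[of s a "Suc n"] distrib_left)
qed simp

lemma alt_Suc_z2r: "alt s a (Suc n) = alt s (Suc a) n * z2r s a (Suc n)"
proof (induction n arbitrary: a)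
  case (Suc n)
  let ?d = "(-1) ^ Suc n * up s a (Suc n)"
  have "alt s a (Suc (Suc n)) = (z1 s (Suc a) (Suc n) + ?d) * alt s a (Suc n)"
    by (simp only: alt.simps(2)[of s a "Suc n"] z1_Suc'[of s a "Suc n"])
  also have "\<dots> = z1 s (Suc a) (Suc n) * (alt s (Suc a) n * z2r s a (Suc n)) + ?d * alt s a (Suc n)"
    by (simp only: Suc distrib_right)
  also have "z1 s (Suc a) (Suc n) * (alt s (Suc a) n * z2r s a (Suc n)) = alt s (Suc a) (Suc n) * z2r s a (Suc n)"
    by (simp only: alt.simps(2)[of s "Suc a" n] mult.assoc)
  also have "?d * alt s a (Suc n) = alt s (Suc a) (Suc n) * ?d"
    using up_conj_shift(4)[of "Suc n" "Suc n" a] by (simp only: minus_one_power_left_commute mult.assoc order_refl)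
  finally show ?case by (simp only: z2r.simps(2)[of s a "Suc n"] distrib_left)
qed simp

end

subsection \<open>Inverse braids\<close>

locale braid_inverse = braid_family s for s :: "nat \<Rightarrow> 'a::ring_1" +
  fixes si :: "nat \<Rightarrow> 'a"
  assumes s_si [simp]: "s i * si i = 1" and si_s [simp]: "si i * s i = 1"
begin

lemma dn_up_inverse: "dn s a n * up si a n = 1"
proof (induction n)
  case (Suc n)
  have "dn s a (Suc n) * up si a (Suc n) = s (a + n) * (dn s a n * up si a n) * si (a + n)"
    by (simp only: up.simps dn.simps mult.assoc)
  then show ?case using Suc by simp
qed simp

lemma up_dn_inverse': "up si a n * dn s a n = 1"
proof (induction n)
  case (Suc n)
  have "up si a (Suc n) * dn s a (Suc n) = up si a n * (si (a + n) * s (a + n)) * dn s a n"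
    by (simp only: up.simps dn.simps mult.assoc)
  then show ?case using Suc by simp
qed simp

lemma dn_up_inverse': "dn si a n * up s a n = 1"
proof (induction n)
  case (Suc n)
  have "dn si a (Suc n) * up s a (Suc n) = si (a + n) * (dn si a n * up s a n) * s (a + n)"
    by (simp only: up.simps dn.simps mult.assoc)
  then show ?case using Suc by simp
qed simp

text \<open>Each product in \<open>z1 si\<close> is the inverse of an initial piece of the cycle
  \<open>dn s a t\<close>. Multiplying by the cycle leaves the complementary piece, and a product of
  length k becomes one of length t - k; this is the origin of the sign.\<close>

lemma z1_si_dn: "z1 si a (Suc t) * dn s a t = (-1) ^ t * z2 s a (Suc t)"
proof (induction t arbitrary: a)
  case (Suc t)
  have "z1 si a (Suc (Suc t)) * dn s a (Suc t) =
      z1 si (Suc a) (Suc t) * (dn s (Suc a) t * s a) + (-1) ^ Suc t * (up si a (Suc t) * dn s a (Suc t))"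
    by (simp only: z1_Suc'[of si a "Suc t"] distrib_right mult.assoc) (simp only: dn_Suc')
  also have "\<dots> = (-1) ^ t * z2 s (Suc a) (Suc t) * s a + (-1) ^ Suc t"
    by (simp only: mult.assoc[symmetric] Suc up_dn_inverse' mult_1_right)
  also have "\<dots> = (-1) ^ Suc t * (1 - z2 s (Suc a) (Suc t) * s a)"
    by (simp add: right_diff_distrib mult.assoc del: z2.simps)
  finally show ?case by (simp only: z2_Suc'[symmetric])
qed simp

lemma up_z1r_si: "up s a n * z1r si a (Suc n) = (-1) ^ n * z2r s a (Suc n)"
proof (induction n)
  case (Suc n)
  have "up s a (Suc n) * z1r si a (Suc (Suc n)) =
      up s a (Suc n) - up s a n * (s (a + n) * si (a + n)) * z1r si a (Suc n)"
    by (subst z1r.simps(2)) (simp add: right_diff_distrib mult.assoc del: z1r.simps s_si)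
  also have "\<dots> = up s a (Suc n) - (-1) ^ n * z2r s a (Suc n)"
    by (simp only: s_si mult_1_right Suc)
  also have "\<dots> = (-1) ^ Suc n * z2r s a (Suc (Suc n))"
    by (subst (2) z2r.simps(2)) (simp add: right_diff_distrib distrib_left minus_one_power_cancel del: z2r.simps up.simps)
  finally show ?case .
qed simp

lemma up_si_alt: "up si a t * alt s a t = alt s (Suc a) t * up si a t"
proof -
  have "up si a t * alt s a t = up si a t * (alt s a t * dn s a t) * up si a t"
    by (simp add: mult.assoc dn_up_inverse)
  also have "\<dots> = (up si a t * dn s a t) * alt s (Suc a) t * up si a t"
    by (simp add: mult.assoc dn_conj_shift(4))
  finally show ?thesis by (simp add: up_dn_inverse')
qed

text \<open>The relation between \<gamma> and \<Omega> contains the inverse braiding, the wedge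
  relations the braiding itself. This identity reconciles them: contracting with one \<Omega> turns
  an antisymmetrizer into the next larger one, up to an inverse cycle.\<close>

lemma z1_si_alt: "z1 si a (Suc t) * alt s a t = (-1) ^ t * alt s a (Suc t) * up si a t"
proof -
  have "z1 si a (Suc t) * alt s a t = (z1 si a (Suc t) * dn s a t) * (up si a t * alt s a t)"
    by (simp only: mult.assoc) (simp add: dn_up_inverse flip: mult.assoc del: z1.simps)
  also have "\<dots> = (-1) ^ t * (z2 s a (Suc t) * alt s (Suc a) t) * up si a t"
    by (simp only: z1_si_dn up_si_alt mult.assoc)
  finally show ?thesis by (simp only: alt_Suc_z2)
qed

lemma alt_z1r_si: "alt s a n * z1r si a (Suc n) = (-1) ^ n * dn si a n * alt s a (Suc n)"
proof -
  have "alt s a n * z1r si a (Suc n) = dn si a n * (up s a n * alt s a n) * z1r si a (Suc n)"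
    by (simp add: dn_up_inverse' flip: mult.assoc del: z1r.simps)
  also have "\<dots> = dn si a n * alt s (Suc a) n * (up s a n * z1r si a (Suc n))"
    by (simp only: up_conj_shift(4) le_refl mult.assoc)
  also have "\<dots> = (-1) ^ n * dn si a n * (alt s (Suc a) n * z2r s a (Suc n))"
    by (simp only: up_z1r_si minus_one_power_left_commute mult.assoc)
  finally show ?thesis by (simp only: alt_Suc_z2r)
qed

end

subsection \<open>Structure constants\<close>

text \<open>
  \<open>wt s c a r\<close> is the tensor \<open>A X\<^sub>r A\<close> prescribed by the recurrence, and \<open>tz s c a n\<close> is the
  coefficient of the terms without \<open>\<chi>\<close> that arise when \<open>\<chi>\<^sub>j\<close> moves past \<open>n\<close> factors \<open>\<Omega>\<close>.
\<close>

fun wt :: "(nat \<Rightarrow> 'a::ring_1) \<Rightarrow> (nat \<Rightarrow> 'a) \<Rightarrow> nat \<Rightarrow> nat \<Rightarrow> 'a" where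
  "wt s c a 0 = 0"
| "wt s c a (Suc 0) = - c a"
| "wt s c a (Suc (Suc r)) =
     ((-1) ^ Suc (Suc r) * z1 s a (Suc (Suc (Suc r))) * dn s a (Suc (Suc r)) - z2 s a (Suc (Suc (Suc r))))
     * wt s c (Suc a) (Suc r)"

fun tz :: "(nat \<Rightarrow> 'a::ring_1) \<Rightarrow> (nat \<Rightarrow> 'a) \<Rightarrow> nat \<Rightarrow> nat \<Rightarrow> 'a" where
  "tz s c a 0 = 0"
| "tz s c a (Suc n) = tz s c (Suc a) n + dn s (Suc a) n * c a"

text \<open>\<open>c i\<close> fuses strands i and i + 1 into one, which renumbers everything to its
  right; this explains the shifts in \<open>s_c_right\<close> and \<open>c_c_right\<close>. The
  relations \<open>c_s\<close>, \<open>s_c_s\<close> and \<open>c_c\<close> are the two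
  compatibility axioms and the Jacobi identity.\<close>

locale braid_struct = braid_inverse s si for s si :: "nat \<Rightarrow> 'a::ring_1" +
  fixes c :: "nat \<Rightarrow> 'a"
  assumes c_s: "c i * s i = s (Suc i) * s i * c (Suc i)"
    and s_c_s: "s (Suc i) * c i * s i + c (Suc i) * s i = s i * c (Suc i) + s i * s (Suc i) * c i"
    and c_c: "c i * c i = s (Suc i) * c i * c i + c (Suc i) * c i"
    and s_c_right: "i + 1 \<le> j \<Longrightarrow> c i * s j = s (Suc j) * c i"
    and s_c_left: "j + 2 \<le> i \<Longrightarrow> s j * c i = c i * s j"
    and c_c_right: "i + 1 \<le> j \<Longrightarrow> c i * c j = c (Suc j) * c i"
begin

abbreviation "w \<equiv> wt s c"
abbreviation "t0 \<equiv> tz s c"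

lemma conj_w:
  assumes "\<And>i. i \<ge> a \<Longrightarrow> x * s i = s (i + d) * x" "\<And>i. i \<ge> a \<Longrightarrow> x * c i = c (i + d) * x" and "a \<le> b"
  shows "x * w b r = w (b + d) r * x"
  using assms(3)
proof (induction r arbitrary: b rule: induct_nat_012)
  case (ge2 r)
  let ?D = "\<lambda>a. (-1) ^ Suc (Suc r) * z1 s a (Suc (Suc (Suc r))) * dn s a (Suc (Suc r)) - z2 s a (Suc (Suc (Suc r)))"
  have *: "x * s (b + j) = s (b + d + j) * x" for j
    using assms(1)[of "b + j"] ge2.prems by (simp add: ac_simps)
  note cf = commute_families[where x = x and a = b and b = "b + d" and n = "Suc (Suc (Suc r))" and s = s, OF *]
  have "x * ((-1) ^ Suc (Suc r) * (z1 s b (Suc (Suc (Suc r))) * dn s b (Suc (Suc r)))) =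
      (-1) ^ Suc (Suc r) * (z1 s (b + d) (Suc (Suc (Suc r))) * dn s (b + d) (Suc (Suc r))) * x"
    by (intro conj_mult minus_one_power_commute[symmetric] cf) auto
  then have D: "x * ?D b = ?D (b + d) * x"
    using cf(4)[of "Suc (Suc (Suc r))"]
    by (simp only: right_diff_distrib left_diff_distrib mult.assoc le_refl)
  show ?case
    using conj_mult[OF D ge2.IH(2)[of "Suc b"]] ge2.prems by simp
qed (use assms in auto)

lemma c_w: "a + 1 \<le> b \<Longrightarrow> c a * w b r = w (Suc b) r * c a"
  using conj_w[where x = "c a" and a = "a + 1" and d = 1] s_c_right c_c_right by simp

lemma s_w: "a + 2 \<le> b \<Longrightarrow> s a * w b r = w b r * s a"
  using conj_w[where x = "s a" and a = "a + 2" and d = 0] s_c_left far by simp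

text \<open>Naturality of the braiding: a strand can be pulled past the tensor \<open>w\<close>. The
  base case is \<open>c_s\<close>, and the recurrence preserves the property because the cycle
  shifts its coefficients.\<close>

lemma dn_w: "dn s a (Suc (Suc r)) * w (Suc a) (Suc r) = w a (Suc r) * dn s a (Suc r)"
proof (induction r arbitrary: a)
  case 0
  show ?case using c_s[of a] by simp
next
  case (Suc r)
  let ?D = "\<lambda>a. (-1) ^ Suc (Suc r) * z1 s a (Suc (Suc (Suc r))) * dn s a (Suc (Suc r)) - z2 s a (Suc (Suc (Suc r)))"
  let ?d = "dn s a (Suc (Suc (Suc r)))"
  have "?d * ((-1) ^ Suc (Suc r) * (z1 s (Suc a) (Suc (Suc (Suc r))) * dn s (Suc a) (Suc (Suc r)))) =
      (-1) ^ Suc (Suc r) * (z1 s a (Suc (Suc (Suc r))) * dn s a (Suc (Suc r))) * ?d"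
    by (intro conj_mult minus_one_power_commute[symmetric] dn_conj_shift) auto
  then have D: "?d * ?D (Suc a) = ?D a * ?d"
    using dn_conj_shift(3)[of "Suc (Suc (Suc r))" "Suc (Suc (Suc r))" a]
    by (simp only: right_diff_distrib left_diff_distrib mult.assoc le_refl)
  have "?d * w (Suc a) (Suc (Suc r)) = ?D a * (?d * w (Suc (Suc a)) (Suc r))"
    by (simp only: wt.simps mult.assoc[symmetric] D)
  also have "?d * w (Suc (Suc a)) (Suc r) = dn s (Suc a) (Suc (Suc r)) * (w (Suc (Suc a)) (Suc r) * s a)"
    by (subst dn_Suc') (simp add: mult.assoc s_w del: dn.simps)
  also have "\<dots> = w (Suc a) (Suc r) * (dn s (Suc a) (Suc r) * s a)"
    by (simp only: mult.assoc[symmetric] Suc)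
  finally show ?case by (simp only: wt.simps dn_Suc'[symmetric] mult.assoc)
qed

lemma far_t0: "i + 2 \<le> a \<Longrightarrow> s i * t0 a n = t0 a n * s i"
proof (induction n arbitrary: a)
  case (Suc n)
  then show ?case
    using conj_mult[OF far_dn[of i "Suc a" n] s_c_left[of i a]]
    by (simp add: distrib_left distrib_right)
qed simp

text \<open>\<open>t0 a n\<close> moves the last of n + 1 strands to the left until it stands next
  to one of the others, fuses it with that one, and sums over all choices. It is an adjoint action,
  hence invariant under the braiding of the n strands.\<close>

lemma s_t0: "a \<le> i \<Longrightarrow> i + 1 < a + n \<Longrightarrow> s i * t0 a n = t0 a n * s i"
proof (induction n arbitrary: a)
  case (Suc n)
  then obtain m where n: "n = Suc m" by (cases n) auto
  show ?case
  proof (cases "i = a")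
    case True
    let ?y = "c (Suc a) + s (Suc a) * c a"
    have eq: "t0 a (Suc n) = t0 (Suc (Suc a)) m + dn s (Suc (Suc a)) m * ?y"
      using n by (simp add: dn_Suc' distrib_left mult.assoc add.assoc del: dn.simps(2))
    \<comment> \<open>These are the two terms of \<open>t0\<close> that fuse into one of the strands
      a and a + 1; the claim is \<open>s_c_s\<close> regrouped.\<close>
    have "s a * ?y = ?y * s a"
      using s_c_s[of a] by (simp add: distrib_left distrib_right mult.assoc add.commute)
    then have "s a * (dn s (Suc (Suc a)) m * ?y) = dn s (Suc (Suc a)) m * ?y * s a"
      by (intro conj_mult far_dn) auto
    then show ?thesis unfolding eq True using far_t0[of a "Suc (Suc a)" m]
      by (simp add: distrib_left distrib_right)
  next
    case False
    then have "s i * dn s (Suc a) n = dn s (Suc a) n * s (Suc i)"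
      using dn_shift[of "Suc a" i n] Suc.prems by simp
    moreover have "s (Suc i) * c a = c a * s i" using s_c_right[of a i] False Suc.prems by simp
    ultimately have "s i * (dn s (Suc a) n * c a) = dn s (Suc a) n * c a * s i"
      by (rule conj_mult2)
    then show ?thesis using Suc False by (simp add: distrib_left distrib_right)
  qed
qed simp

lemma t0_families:
  "k \<le> n \<Longrightarrow> t0 a n * alt s a k = alt s a k * t0 a n"
  "k \<le> n \<Longrightarrow> t0 a n * z1 s a k = z1 s a k * t0 a n"
  "k \<le> n \<Longrightarrow> t0 a n * z2 s a k = z2 s a k * t0 a n"
  "k < n \<Longrightarrow> t0 a n * dn s a k = dn s a k * t0 a n"
  using commute_families[where x = "t0 a n" and a = a and b = a and n = n and s = s] s_t0[of a "a + j" n for j]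
  by auto

text \<open>Invariance of \<open>w\<close> under the adjoint action. In the lowest degree this is
  the Jacobi identity \<open>c_c\<close>, because \<open>t0 a 2\<close> is
  \<open>c (Suc a) + s (Suc a) * c a\<close>.\<close>

lemma t0_w: "t0 a (Suc (Suc r)) * w a (Suc r) = w a (Suc r) * t0 a (Suc r)"
proof (induction r arbitrary: a)
  case 0
  show ?case using c_c[of a] by (simp add: distrib_right)
next
  case (Suc r)
  let ?D = "(-1) ^ Suc (Suc r) * z1 s a (Suc (Suc (Suc r))) * dn s a (Suc (Suc r)) - z2 s a (Suc (Suc (Suc r)))"
  let ?t = "t0 a (Suc (Suc (Suc r)))"
  have "?t * ((-1) ^ Suc (Suc r) * (z1 s a (Suc (Suc (Suc r))) * dn s a (Suc (Suc r)))) =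
      (-1) ^ Suc (Suc r) * (z1 s a (Suc (Suc (Suc r))) * dn s a (Suc (Suc r))) * ?t"
    by (intro conj_mult minus_one_power_commute[symmetric] t0_families) auto
  then have D: "?t * ?D = ?D * ?t"
    using t0_families(3)[of "Suc (Suc (Suc r))" "Suc (Suc (Suc r))" a]
    by (simp only: right_diff_distrib left_diff_distrib mult.assoc le_refl)
  let ?v = "w (Suc a) (Suc r)"
  have "dn s (Suc a) (Suc (Suc r)) * c a * ?v = dn s (Suc a) (Suc (Suc r)) * w (Suc (Suc a)) (Suc r) * c a"
    using c_w[of a "Suc a" "Suc r"] by (simp del: wt.simps dn.simps add: mult.assoc)
  also have "\<dots> = ?v * dn s (Suc a) (Suc r) * c a" by (simp only: dn_w)
  finally have 1: "dn s (Suc a) (Suc (Suc r)) * c a * ?v = ?v * (dn s (Suc a) (Suc r) * c a)" by (simp only: mult.assoc)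
  have "?t * ?v = ?v * t0 a (Suc (Suc r))"
    by (subst (1 2) tz.simps(2)) (simp only: distrib_left distrib_right 1 Suc)
  from conj_mult2[OF D this] show ?case by (simp only: wt.simps)
qed

text \<open>Pulling the cycle through \<open>w\<close> rewrites the recurrence in terms of
  \<open>w\<close> on the last strands and \<open>w\<close> on the first strands, the two positions
  in which it occurs in the commutator with \<Omega>.\<close>

lemma w_Suc: "w a (Suc (Suc r)) = - (z2 s a (Suc (Suc (Suc r))) * w (Suc a) (Suc r))
    + (-1) ^ r * z1 s a (Suc (Suc (Suc r))) * w a (Suc r) * dn s a (Suc r)"
proof -
  have "w a (Suc (Suc r)) = (-1) ^ r * z1 s a (Suc (Suc (Suc r))) * (dn s a (Suc (Suc r)) * w (Suc a) (Suc r))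
      - z2 s a (Suc (Suc (Suc r))) * w (Suc a) (Suc r)"
    by (simp add: left_diff_distrib mult.assoc del: z1.simps z2.simps dn.simps)
  then show ?thesis by (simp only: dn_w) (simp only: mult.assoc diff_conv_add_uminus add.commute)
qed

text \<open>With q = r + 1, the three summands come from \<open>\<Omega>^k Q_(q)\<close>, from
  \<open>Q_(q) \<Omega>^k\<close> with \<Omega> moved past all \<gamma>, and from
  \<open>Q_(q+1) \<Omega>^k\<close> with \<Omega> contracted against one \<gamma>. Splitting the
  large antisymmetrizer at its last or first strand expresses the first two by \<open>w\<close>; by
  \<open>w_Suc\<close> the third is the negative of their sum.\<close>

lemma omega_commutator_coefficient:
  assumes x: "alt s a (Suc (Suc r)) * x * alt s a (Suc r) = w a (Suc r)"
    and x': "alt s (Suc a) (Suc (Suc r)) * x' * alt s (Suc a) (Suc r) = w (Suc a) (Suc r)"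
    and y: "alt s a (Suc (Suc (Suc r))) * y * alt s a (Suc (Suc r)) = w a (Suc (Suc r))"
  shows "alt s a (Suc (Suc (Suc r))) *
    (x + (-1) ^ Suc r * x' * up si a (Suc r) + y * z1 si a (Suc (Suc r))) * alt s a (Suc r) = 0"
proof -
  let ?e = "(-1) ^ r :: 'a" and ?A = "alt s a (Suc (Suc (Suc r)))" and ?u = "up si a (Suc r)"
  let ?Z1 = "z1 s a (Suc (Suc (Suc r)))" and ?Z2 = "z2 s a (Suc (Suc (Suc r)))"
  have e: "?e * v = v * ?e" for v by (rule minus_one_power_commute)
  have 1: "?A * x * alt s a (Suc r) = ?Z1 * w a (Suc r)"
    by (simp only: alt.simps(2)[of s a "Suc (Suc r)"] x[symmetric] mult.assoc)
  have "?A * x' * ?u * alt s a (Suc r) = ?Z2 * (alt s (Suc a) (Suc (Suc r)) * x' * alt s (Suc a) (Suc r)) * ?u"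
    by (simp only: alt_Suc_z2[of a "Suc (Suc r)"] mult.assoc up_si_alt)
  then have 2: "?A * x' * ?u * alt s a (Suc r) = ?Z2 * w (Suc a) (Suc r) * ?u" by (simp only: x')
  have "?A * y * z1 si a (Suc (Suc r)) * alt s a (Suc r) = ?A * y * (-1) ^ Suc r * alt s a (Suc (Suc r)) * ?u"
    by (simp only: mult.assoc z1_si_alt)
  also have "\<dots> = (-1) ^ Suc r * (?A * y * alt s a (Suc (Suc r))) * ?u"
    by (simp only: minus_one_power_left_commute mult.assoc)
  also have "\<dots> = - (?e * w a (Suc (Suc r)) * ?u)" by (simp only: y) simp
  also have "\<dots> = ?e * ?Z2 * w (Suc a) (Suc r) * ?u - ?e * ?e * ?Z1 * w a (Suc r) * (dn s a (Suc r) * ?u)"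
    by (simp only: w_Suc distrib_left distrib_right mult.assoc) (simp add: mult.assoc del: z1.simps z2.simps dn.simps up.simps)
  also have "\<dots> = ?e * ?Z2 * w (Suc a) (Suc r) * ?u - ?Z1 * w a (Suc r)"
    by (simp add: dn_up_inverse minus_one_power_cancel mult.assoc del: z1.simps z2.simps dn.simps up.simps)
  finally have 3: "?A * y * z1 si a (Suc (Suc r)) * alt s a (Suc r) =
    ?e * ?Z2 * w (Suc a) (Suc r) * ?u - ?Z1 * w a (Suc r)" .
  have 4: "?A * ((-1) ^ Suc r * x' * ?u) * alt s a (Suc r) = - (?e * (?A * x' * ?u * alt s a (Suc r)))"
    by (simp only: minus_one_power_left_commute mult.assoc power_Suc mult_minus1 minus_mult_left[symmetric] minus_mult_right[symmetric] mult_1_left)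
  show ?thesis
    unfolding distrib_left distrib_right 4
    by (simp add: 1 2 3 flip: mult.assoc del: alt.simps up.simps z1.simps z2.simps)
qed

text \<open>The two identities concern the terms in which a \<chi> survives and those in which it
  has been absorbed by a structure constant. They are \<open>dn_w\<close> and \<open>t0_w\<close>,
  once the antisymmetrizers are moved through the cycle and through \<open>t0\<close>.\<close>

lemma chi_commutator_coefficients:
  assumes x: "alt s a (Suc (Suc r)) * x * alt s a (Suc r) = w a (Suc r)"
    and x': "alt s (Suc a) (Suc (Suc r)) * x' * alt s (Suc a) (Suc r) = w (Suc a) (Suc r)"
  shows "alt s a (Suc (Suc r)) * (dn s a (Suc (Suc r)) * x' - x * dn s a (Suc r)) * alt s (Suc a) (Suc r) = 0"
    and "alt s a (Suc (Suc r)) * (t0 a (Suc (Suc r)) * x - x * t0 a (Suc r)) * alt s a (Suc r) = 0"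
proof -
  have "alt s a (Suc (Suc r)) * dn s a (Suc (Suc r)) * x' * alt s (Suc a) (Suc r) =
      dn s a (Suc (Suc r)) * (alt s (Suc a) (Suc (Suc r)) * x' * alt s (Suc a) (Suc r))"
    by (simp only: dn_conj_shift(4)[OF order_refl, symmetric] mult.assoc)
  moreover have "alt s a (Suc (Suc r)) * x * dn s a (Suc r) * alt s (Suc a) (Suc r) =
      (alt s a (Suc (Suc r)) * x * alt s a (Suc r)) * dn s a (Suc r)"
    by (simp only: dn_conj_shift(4)[OF order_refl] mult.assoc)
  ultimately show "alt s a (Suc (Suc r)) * (dn s a (Suc (Suc r)) * x' - x * dn s a (Suc r)) * alt s (Suc a) (Suc r) = 0"
    by (simp add: right_diff_distrib left_diff_distrib dn_w x x' flip: mult.assoc del: alt.simps dn.simps)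
  have "alt s a (Suc (Suc r)) * t0 a (Suc (Suc r)) * x * alt s a (Suc r) =
      t0 a (Suc (Suc r)) * (alt s a (Suc (Suc r)) * x * alt s a (Suc r))"
    by (simp only: t0_families(1)[OF order_refl, symmetric] mult.assoc)
  moreover have "alt s a (Suc (Suc r)) * x * t0 a (Suc r) * alt s a (Suc r) =
      (alt s a (Suc (Suc r)) * x * alt s a (Suc r)) * t0 a (Suc r)"
    by (simp only: t0_families(1)[OF order_refl] mult.assoc)
  ultimately show "alt s a (Suc (Suc r)) * (t0 a (Suc (Suc r)) * x - x * t0 a (Suc r)) * alt s a (Suc r) = 0"
    by (simp add: right_diff_distrib left_diff_distrib t0_w x flip: mult.assoc del: alt.simps tz.simps)
qed

text \<open>This is the statement that the differential of the \<Omega> squares to zero. Only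
  \<open>(1 - s a) * x\<close> is known, so the antisymmetrized expression has to be brought to a
  form in which \<open>x\<close> occurs in this combination alone.\<close>

lemma maurer_cartan_closed:
  assumes "alt s a 2 * x = - c a" "alt s (Suc a) 2 * x' = - c (Suc a)"
  shows "alt s a 3 * (x' - x) * x = 0"
proof -
  have x: "x = s a * x - c a" and x': "x' = s (Suc a) * x' - c (Suc a)"
    using assms by (auto simp: numeral_2_eq_2 algebra_simps)
  have "alt s a 3 * x' = z2 s a 3 * (alt s (Suc a) 2 * x')"
    by (simp only: alt_Suc_z2[of a "Suc (Suc 0)"] numeral_3_eq_3 numeral_2_eq_2 mult.assoc)
  then have 1: "alt s a 3 * x' = - (z2 s a 3 * c (Suc a))" by (simp add: assms)
  have "alt s a 3 * x = z1 s a 3 * (alt s a 2 * x)"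
    by (simp only: numeral_3_eq_3 numeral_2_eq_2 alt.simps(2) mult.assoc)
  then have 2: "alt s a 3 * x = - (z1 s a 3 * c a)" by (simp add: assms)
  \<comment> \<open>\<open>?y * c a = 0\<close> is the Jacobi identity.\<close>
  let ?y = "s (Suc a) * c a + c (Suc a) - c a"
  have "z1 s a 3 * c a - z2 s a 3 * c (Suc a) = - (?y * (1 - s a))"
    using s_c_s[of a] c_s[of a] by (simp add: numeral_3_eq_3 algebra_simps)
  moreover have "alt s a 3 * (x' - x) * x = (z1 s a 3 * c a - z2 s a 3 * c (Suc a)) * x"
    by (simp add: right_diff_distrib 1 2)
  ultimately have "alt s a 3 * (x' - x) * x = - (?y * ((1 - s a) * x))"
    by (simp only: minus_mult_left[symmetric] mult.assoc)
  also have "(1 - s a) * x = - c a" using x by (simp add: algebra_simps)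
  also have "- (?y * - c a) = 0" using c_c[of a] by (simp add: algebra_simps)
  finally show ?thesis .
qed

end

subsection \<open>Divisibility of the structure tensors by the antisymmetrizers\<close>

text \<open>The signed sum of minimal coset representatives of type B modulo type A, factored strand
  by strand: each strand either stays or is carried to the end and through \<open>y\<close>, a
  representative of length n + 1, whence the sign.\<close>

fun bfac :: "'a::ring_1 \<Rightarrow> (nat \<Rightarrow> 'a) \<Rightarrow> nat \<Rightarrow> nat \<Rightarrow> 'a" where
  "bfac y s a 0 = 1"
| "bfac y s a (Suc n) = bfac y s (Suc a) n * (1 + (-1) ^ Suc n * up s a n * y)"

definition bcos :: "'a::ring_1 \<Rightarrow> (nat \<Rightarrow> 'a) \<Rightarrow> nat \<Rightarrow> nat \<Rightarrow> 'a" where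
  "bcos y s a n = z2 s a (Suc n) + (-1) ^ Suc n * z1 s a (Suc n) * y * dn s a n"

fun balt :: "'a::ring_1 \<Rightarrow> (nat \<Rightarrow> 'a) \<Rightarrow> nat \<Rightarrow> nat \<Rightarrow> 'a" where
  "balt y s a 0 = 1"
| "balt y s a (Suc n) = bcos y s a n * balt y s (Suc a) n"

section \<open>Jucys-Murphy elements and the two factorizations in type B\<close>

locale affine_braid = braid_family s for s :: "nat \<Rightarrow> 'a::ring_1" +
  fixes y :: 'a and e :: nat
  assumes y_far: "Suc i < e \<Longrightarrow> s i * y = y * s i"
    and y_braid: "Suc i = e \<Longrightarrow> s i * y * s i * y = y * s i * y * s i"
begin

text \<open>A Jucys-Murphy element of type B: strand a travels to the last position, through
  \<open>y\<close>, and back.\<close>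

abbreviation "jm a n \<equiv> up s a n * y * dn s a n"

lemma jm_Suc: "jm a (Suc n) = s a * jm (Suc a) n * s a"
  by (simp only: up_Suc' dn_Suc' mult.assoc)

lemma far_jm: "Suc i < a \<Longrightarrow> Suc i < e \<Longrightarrow> s i * jm a n = jm a n * s i"
  by (intro conj_mult far_up far_dn y_far) auto

lemma y_jm: "a + Suc n = e \<Longrightarrow> y * jm a (Suc n) = jm a (Suc n) * y"
proof (induction n arbitrary: a)
  case 0
  then show ?case using y_braid[of a] by (simp add: mult.assoc)
next
  case (Suc n)
  have 1: "y * s a = s a * y" using y_far[of a] Suc.prems by simp
  have 2: "y * jm (Suc a) (Suc n) = jm (Suc a) (Suc n) * y" by (rule Suc.IH) (use Suc.prems in simp)
  show ?case unfolding jm_Suc[of a "Suc n"] by (rule conj_mult[OF conj_mult[OF 1 2] 1])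
qed

text \<open>Strand a crosses the strands i and i + 1 completely, once in each direction, so a
  crossing of these two can be slid along it. Where the generators are adjacent this takes the braid
  relation twice.\<close>

lemma s_jm: "a < i \<Longrightarrow> a + n = e \<Longrightarrow> i < e \<Longrightarrow> s i * jm a n = jm a n * s i"
proof (induction n arbitrary: a)
  case (Suc n)
  show ?case
  proof (cases "i = Suc a")
    case False
    then have 1: "s i * s a = s a * s i" using far[of a i] Suc.prems by simp
    have 2: "s i * jm (Suc a) n = jm (Suc a) n * s i" by (rule Suc.IH) (use Suc.prems False in auto)
    show ?thesis unfolding jm_Suc[of a n] by (rule conj_mult[OF conj_mult[OF 1 2] 1])
  next
    case True
    then obtain m where n: "n = Suc m" using Suc.prems by (cases n) auto
    let ?b = "s a" and ?c = "s (Suc a)" and ?j = "jm (Suc (Suc a)) m"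
    have j: "?b * ?j = ?j * ?b" using far_jm[of a "Suc (Suc a)" m] Suc.prems True by simp
    have eq: "jm a (Suc n) = ?b * (?c * ?j * ?c) * ?b" unfolding n by (simp only: jm_Suc)
    have "?c * (?b * (?c * ?j * ?c) * ?b) = (?c * ?b * ?c) * ?j * ?c * ?b" by (simp only: mult.assoc)
    also have "?c * ?b * ?c = ?b * ?c * ?b" by (rule braid[symmetric])
    also have "?b * ?c * ?b * ?j * ?c * ?b = ?b * ?c * (?b * ?j) * ?c * ?b" by (simp only: mult.assoc)
    also have "?b * ?j = ?j * ?b" by (rule j)
    also have "?b * ?c * (?j * ?b) * ?c * ?b = ?b * ?c * ?j * (?b * ?c * ?b)" by (simp only: mult.assoc)
    also have "?b * ?c * ?b = ?c * ?b * ?c" by (rule braid)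
    also have "?b * ?c * ?j * (?c * ?b * ?c) = ?b * (?c * ?j * ?c) * ?b * ?c" by (simp only: mult.assoc)
    finally show ?thesis unfolding eq True .
  qed
qed simp

lemma bfac_commute:
  assumes "\<And>i. a \<le> i \<Longrightarrow> i < e \<Longrightarrow> x * s i = s i * x" "x * y = y * x" "a + n = Suc e"
  shows "x * bfac y s a n = bfac y s a n * x"
  using assms(1,3)
proof (induction n arbitrary: a)
  case (Suc n)
  have "x * up s a n = up s a n * x"
    using commute_families(2)[where x = x and a = a and b = a and n = "Suc n" and k = n and s = s] Suc.prems by simp
  then have "x * ((-1) ^ Suc n * up s a n * y) = (-1) ^ Suc n * up s a n * y * x"
    by (intro conj_mult assms(2) minus_one_power_commute[symmetric])
  then have "x * (1 + (-1) ^ Suc n * up s a n * y) = (1 + (-1) ^ Suc n * up s a n * y) * x"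
    by (simp only: distrib_left distrib_right) simp
  then show ?case using Suc by (simp add: conj_mult del: power_Suc)
qed simp

text \<open>All representatives except the trivial and the longest one arise from those for the
  strands after a by a further \<open>s a\<close>; the longest is the Jucys-Murphy element.\<close>

lemma bcos_Suc: "bcos y s a (Suc n) = 1 - bcos y s (Suc a) n * s a - jm a (Suc n)"
proof -
  let ?e = "(-1) ^ Suc n :: 'a"
  have "bcos y s a (Suc n) = 1 - z2 s (Suc a) (Suc n) * s a
      - ?e * (z1 s (Suc a) (Suc n) + ?e * up s a (Suc n)) * y * dn s a (Suc n)"
    unfolding bcos_def by (subst z2_Suc', subst z1_Suc') simp
  also have "\<dots> = 1 - z2 s (Suc a) (Suc n) * s a
      - ?e * z1 s (Suc a) (Suc n) * y * dn s a (Suc n) - ?e * (?e * (up s a (Suc n) * y * dn s a (Suc n)))"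
    by (simp only: distrib_left distrib_right mult.assoc diff_diff_eq add.assoc)
  also have "?e * (?e * (up s a (Suc n) * y * dn s a (Suc n))) = jm a (Suc n)"
    by (rule minus_one_power_cancel)
  also have "?e * z1 s (Suc a) (Suc n) * y * dn s a (Suc n) = ?e * z1 s (Suc a) (Suc n) * y * dn s (Suc a) n * s a"
    by (simp only: dn_Suc' mult.assoc)
  finally show ?thesis unfolding bcos_def by (simp only: distrib_right diff_diff_eq)
qed

text \<open>
  \<open>balt\<close> is the antisymmetrizer of type B. The two factorizations come from the minimal coset
  representatives modulo the parabolic subgroups of type B (one strand less) and of type A.
\<close>

lemma balt_eq: "a + n = Suc e \<Longrightarrow> balt y s a n = bfac y s a n * alt s a n"
proof (induction n arbitrary: a rule: induct_nat_012)
  case 1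
  then show ?case by (simp add: bcos_def)
next
  case (ge2 n)
  let ?M = "bfac y s (Suc a) (Suc n)" and ?M' = "bfac y s (Suc (Suc a)) n"
  let ?A = "alt s (Suc a) (Suc n)" and ?A' = "alt s (Suc (Suc a)) n"
  let ?J = "jm a (Suc n)" and ?u = "up s a (Suc n)" and ?e = "(-1) ^ n :: 'a"
  let ?E = "bcos y s (Suc a) n"
  have e: "?e * v = v * ?e" for v by (rule minus_one_power_commute)
  have ae: "a + Suc n = e" using ge2.prems by simp
  have IH: "?E * ?M' * ?A' = ?M * ?A"
  proof -
    have "balt y s (Suc (Suc a)) n = ?M' * ?A'" by (rule ge2.IH(1)) (use ae in simp)
    moreover have "balt y s (Suc a) (Suc n) = ?M * ?A" by (rule ge2.IH(2)) (use ae in simp)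
    ultimately show ?thesis by (simp only: balt.simps mult.assoc)
  qed
  have J: "?J * ?M = ?M * ?J"
    using bfac_commute[of "Suc a" ?J "Suc n"] s_jm[of a _ "Suc n"] y_jm[OF ae] ae by simp
  have sM: "s a * ?M' = ?M' * s a"
  proof (cases n)
    case (Suc m)
    show ?thesis
      using bfac_commute[of "Suc (Suc a)" "s a" n] far[of a] y_far[of a] ae Suc by simp
  qed simp
  have sA: "s a * ?A' = ?A' * s a"
    using commute_families(5)[where x = "s a" and a = "Suc (Suc a)" and b = "Suc (Suc a)" and n = n and k = n and s = s] far[of a] by simp
  have yA: "alt s (Suc a) n * y = y * alt s (Suc a) n"
    using commute_families(5)[where x = y and a = "Suc a" and b = "Suc a" and n = n and k = n and s = s] y_far ae by simp
  have 1: "?E * s a * ?M' * ?A = ?M * ?A * s a * z2r s (Suc a) (Suc n)"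
  proof -
    have "?E * s a * ?M' * ?A = ?E * (s a * ?M') * (?A' * z2r s (Suc a) (Suc n))"
      by (simp only: alt_Suc_z2r mult.assoc)
    also have "\<dots> = ?E * ?M' * (s a * ?A') * z2r s (Suc a) (Suc n)" by (simp only: sM mult.assoc)
    also have "\<dots> = ?E * ?M' * ?A' * s a * z2r s (Suc a) (Suc n)" by (simp only: sA mult.assoc)
    finally show ?thesis by (simp only: IH)
  qed
  have uyA: "?u * y * alt s (Suc a) n = ?A' * ?u * y"
  proof -
    have "?u * y * alt s (Suc a) n = ?u * alt s (Suc a) n * y" by (simp only: yA mult.assoc)
    moreover have "?u * alt s (Suc a) n = ?A' * ?u"
      using commute_families(5)[where x = ?u and a = "Suc a" and b = "Suc (Suc a)" and n = n and k = n and s = s]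
        up_shift[of a "Suc a + j" "Suc n" for j] by simp
    ultimately show ?thesis by simp
  qed
  let ?z = "z1r s (Suc a) (Suc n)" and ?f = "(-1) ^ Suc n :: 'a"
  have f: "?f * v = v * ?f" for v by (rule minus_one_power_commute)
  have 2: "?E * ?M' * (?u * y) * ?A = ?M * (?u * y) * (alt s a (Suc n) * ?z)"
  proof -
    have "?E * ?M' * (?u * y) * ?A = ?E * ?M' * (?u * y * alt s (Suc a) n) * ?z"
      by (simp only: alt_Suc_z1r mult.assoc)
    also have "?u * y * alt s (Suc a) n = ?A' * ?u * y" by (rule uyA)
    also have "?E * ?M' * (?A' * ?u * y) * ?z = (?E * ?M' * ?A') * ?u * y * ?z" by (simp only: mult.assoc)
    also have "?E * ?M' * ?A' = ?M * ?A" by (rule IH)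
    also have "?M * ?A * ?u * y * ?z = ?M * (?A * ?u) * y * ?z" by (simp only: mult.assoc)
    also have "?A * ?u = ?u * alt s a (Suc n)" by (rule up_conj_shift(4)[symmetric]) simp
    also have "?M * (?u * alt s a (Suc n)) * y * ?z = ?M * ?u * (alt s a (Suc n) * y) * ?z"
      by (simp only: mult.assoc)
    also have "alt s a (Suc n) * y = y * alt s a (Suc n)"
      using commute_families(5)[where x = y and a = a and b = a and n = "Suc n" and k = "Suc n" and s = s] y_far ae by simp
    finally show ?thesis by (simp only: mult.assoc)
  qed
  \<comment> \<open>\<open>z1r\<close> on the strands from a on exceeds \<open>?z\<close> by its
    longest term only, which is the cycle appearing as correction.\<close>
  have 3: "alt s a (Suc n) * ?z = alt s a (Suc (Suc n)) - ?f * (dn s a (Suc n) * ?A)"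
  proof -
    have "alt s a (Suc n) * ?z = alt s a (Suc n) * z1r s a (Suc (Suc n)) - alt s a (Suc n) * (?f * dn s a (Suc n))"
      by (subst z1r_Suc') (simp only: distrib_left add_diff_cancel_right')
    also have "alt s a (Suc n) * (?f * dn s a (Suc n)) = ?f * (alt s a (Suc n) * dn s a (Suc n))"
      by (simp only: minus_one_power_left_commute mult.assoc)
    also have "alt s a (Suc n) * dn s a (Suc n) = dn s a (Suc n) * ?A" by (rule dn_conj_shift(4)[symmetric]) simp
    finally show ?thesis by (simp only: alt_Suc_z1r[symmetric])
  qed
  have M: "s a * ?M = ?M' * (s a + ?f * (?u * y))"
  proof -
    have "s a * ?M = (s a * ?M') * (1 + ?f * up s (Suc a) n * y)" by (simp only: bfac.simps mult.assoc)
    also have "\<dots> = ?M' * (s a + s a * (?f * up s (Suc a) n * y))"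
      by (simp only: sM mult.assoc distrib_left mult_1_right)
    also have "s a * (?f * up s (Suc a) n * y) = ?f * (?u * y)"
      unfolding up_Suc'[of s a n] by (simp only: minus_one_power_left_commute mult.assoc)
    finally show ?thesis .
  qed
  have "bcos y s a (Suc n) * balt y s (Suc a) (Suc n) = (1 - ?E * s a - ?J) * (?M * ?A)"
  proof -
    have "balt y s (Suc a) (Suc n) = ?M * ?A" by (rule ge2.IH(2)) (use ae in simp)
    then show ?thesis by (simp only: bcos_Suc)
  qed
  also have "\<dots> = ?M * ?A - ?E * (s a * ?M) * ?A - (?J * ?M) * ?A"
    by (simp only: left_diff_distrib mult_1_left mult.assoc)
  also have "?E * (s a * ?M) * ?A = ?E * s a * ?M' * ?A + ?f * (?E * ?M' * (?u * y) * ?A)"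
    unfolding M by (simp only: distrib_left distrib_right) (simp only: minus_one_power_left_commute mult.assoc sM)
  also have "?M * ?A - (?E * s a * ?M' * ?A + ?f * (?E * ?M' * (?u * y) * ?A)) - (?J * ?M) * ?A =
      ?M * (?A * (1 - s a * z2r s (Suc a) (Suc n))) - ?f * (?M * (?u * y) * (alt s a (Suc n) * ?z)) - ?M * ?J * ?A"
    unfolding 1 2 J by (simp only: right_diff_distrib diff_diff_eq mult_1_right mult.assoc)
  also have "?A * (1 - s a * z2r s (Suc a) (Suc n)) = alt s a (Suc (Suc n))"
    by (simp only: z2r_Suc'[symmetric] alt_Suc_z2r)
  \<comment> \<open>With the correction from \<open>3\<close> the two signs cancel and a
    Jucys-Murphy term appears; it removes the \<open>?J\<close> contributed by
    \<open>bcos_Suc\<close>.\<close>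
  also have "?f * (?M * (?u * y) * (alt s a (Suc n) * ?z)) =
      ?f * (?M * (?u * y) * alt s a (Suc (Suc n))) - ?M * ?J * ?A"
  proof -
    have "?f * (?M * (?u * y) * (?f * (dn s a (Suc n) * ?A))) = ?f * (?f * (?M * (?u * y) * (dn s a (Suc n) * ?A)))"
      by (simp only: minus_one_power_left_commute[of "?M * (?u * y)"])
    then show ?thesis
      unfolding 3 by (simp only: right_diff_distrib minus_one_power_cancel mult.assoc)
  qed
  also have "?M * alt s a (Suc (Suc n)) - (?f * (?M * (?u * y) * alt s a (Suc (Suc n))) - ?M * ?J * ?A) - ?M * ?J * ?A
      = ?M * alt s a (Suc (Suc n)) - ?M * (?f * (?u * y)) * alt s a (Suc (Suc n))"
    by (simp only: diff_diff_eq diff_diff_eq2) (simp only: minus_one_power_left_commute mult.assoc add_diff_cancel_right add.commute)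
  also have "\<dots> = ?M * (1 + (-1) ^ Suc (Suc n) * ?u * y) * alt s a (Suc (Suc n))"
    by (simp add: left_diff_distrib right_diff_distrib distrib_left distrib_right mult.assoc del: alt.simps up.simps dn.simps bfac.simps)
  finally show ?case by (simp only: balt.simps bfac.simps)
qed simp

end

text \<open>
  Upper triangular \<open>2 \<times> 2\<close> matrices. With an extra strand that is either in the given space or
  trivial, \<open>Tri (s\<^sub>e\<^sup>2) c\<^sub>e 1\<close> is the double braiding of strand \<open>e\<close> with it.
\<close>

datatype 'a tri = Tri (dia: 'a) (off: 'a) (low: 'a)

instantiation tri :: (ring_1) ring_1
begin

definition "0 = Tri 0 0 0"
definition "1 = Tri 1 0 1"
definition "x + y = Tri (dia x + dia y) (off x + off y) (low x + low y)"
definition "- x = Tri (- dia x) (- off x) (- low x)"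
definition "x - y = Tri (dia x - dia y) (off x - off y) (low x - low y)"
definition "x * y = Tri (dia x * dia y) (dia x * off y + off x * low y) (low x * low y)"

instance
  by standard
    (simp_all add: zero_tri_def one_tri_def plus_tri_def uminus_tri_def minus_tri_def times_tri_def
      algebra_simps)

end

lemmas tri_defs = zero_tri_def one_tri_def plus_tri_def uminus_tri_def minus_tri_def times_tri_def

definition diag :: "'a::ring_1 \<Rightarrow> 'a tri" where "diag x = Tri x 0 x"

lemma diag_simps:
  "diag 0 = 0" "diag 1 = 1" "diag (x + y) = diag x + diag y" "diag (x - y) = diag x - diag y"
  "diag (x * y) = diag x * diag y" "diag (- x) = - diag x"
  by (simp_all add: diag_def tri_defs)

lemma diag_minus_one_power: "(-1) ^ n = diag ((-1) ^ n)"
  by (induction n) (simp_all add: diag_simps)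

lemma diag_families:
  "dn (\<lambda>i. diag (s i)) a n = diag (dn s a n)" "up (\<lambda>i. diag (s i)) a n = diag (up s a n)"
  "z1 (\<lambda>i. diag (s i)) a n = diag (z1 s a n)" "z2 (\<lambda>i. diag (s i)) a n = diag (z2 s a n)"
  "alt (\<lambda>i. diag (s i)) a n = diag (alt s a n)"
proof -
  show 1: "dn (\<lambda>i. diag (s i)) a n = diag (dn s a n)" for n
    by (induction n) (simp_all add: diag_simps)
  show "up (\<lambda>i. diag (s i)) a n = diag (up s a n)"
    by (induction n) (simp_all add: diag_simps)
  show 2: "z1 (\<lambda>i. diag (s i)) a n = diag (z1 s a n)" for n
    by (induction n) (simp_all add: diag_simps)
  show "z2 (\<lambda>i. diag (s i)) a n = diag (z2 s a n)"
    by (induction n) (simp_all add: diag_simps 1 diag_minus_one_power)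
  show "alt (\<lambda>i. diag (s i)) a n = diag (alt s a n)"
    by (induction n) (simp_all add: diag_simps 2)
qed

section \<open>The tensors of the recurrence as off-diagonal blocks in type B\<close>

context braid_struct
begin

definition yt :: "nat \<Rightarrow> 'a tri" where "yt e = Tri (s e * s e) (c e) 1"

text \<open>Entrywise, the relation of type B is trivial for the trivial extra strand, follows from
  the braid relation alone for the double braiding (\<open>2\<close>), and in the off-diagonal entry
  combines \<open>s_c_s\<close> with two uses of \<open>c_s\<close> (\<open>1\<close>).\<close>

lemma affine_yt: "affine_braid (\<lambda>i. diag (s i)) (yt e) e"
proof
  show "diag (s i) * diag (s j) = diag (s j) * diag (s i)" if "i + 2 \<le> j" for i j
    using far[OF that] by (simp flip: diag_simps)
  show "diag (s i) * diag (s (Suc i)) * diag (s i) = diag (s (Suc i)) * diag (s i) * diag (s (Suc i))" for i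
    using braid[of i] by (simp flip: diag_simps)
  show "diag (s i) * yt e = yt e * diag (s i)" if "Suc i < e" for i
    using that far[of i e] s_c_left[of i e] conj_mult[of "s i" "s e" "s e" "s e" "s e"]
    by (simp add: yt_def diag_def tri_defs)
  show "diag (s i) * yt e * diag (s i) * yt e = yt e * diag (s i) * yt e * diag (s i)" if "Suc i = e" for i
  proof -
    let ?a = "s i" and ?b = "s (Suc i)" and ?c = "c (Suc i)" and ?c1 = "c i"
    have bac: "?b * ?a * ?c = ?c1 * ?a" by (rule c_s[symmetric])
    have 1: "?a * ?b * ?b * ?a * ?c + ?a * ?c * ?a = ?b * ?b * ?a * ?c * ?a + ?c * ?a * ?a"
    proof -
      have "?a * ?b * ?b * ?a * ?c + ?a * ?c * ?a = ?a * ?b * (?b * ?a * ?c) + ?a * ?c * ?a"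
        by (simp only: mult.assoc)
      also have "\<dots> = (?a * ?c + ?a * ?b * ?c1) * ?a" unfolding bac by (simp only: distrib_right mult.assoc add.commute)
      also have "\<dots> = (?b * ?c1 * ?a + ?c * ?a) * ?a" by (simp only: s_c_s)
      also have "\<dots> = ?b * (?c1 * ?a) * ?a + ?c * ?a * ?a" by (simp only: distrib_right mult.assoc)
      also have "\<dots> = ?b * (?b * ?a * ?c) * ?a + ?c * ?a * ?a" by (simp only: bac)
      finally show ?thesis by (simp only: mult.assoc)
    qed
    have 2: "?a * (?b * ?b) * ?a * (?b * ?b) = (?b * ?b) * ?a * (?b * ?b) * ?a"
    proof -
      have bab: "?b * ?a * ?b = ?a * ?b * ?a" by (rule braid[symmetric])
      have "?a * (?b * ?b) * ?a * (?b * ?b) = ?a * ?b * (?b * ?a * ?b) * ?b" by (simp only: mult.assoc)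
      also have "?b * ?a * ?b = ?a * ?b * ?a" by (rule bab)
      also have "?a * ?b * (?a * ?b * ?a) * ?b = ?a * ?b * ?a * (?b * ?a * ?b)" by (simp only: mult.assoc)
      also have "\<dots> = (?b * ?a * ?b) * (?a * ?b * ?a)" by (simp only: bab)
      also have "\<dots> = ?b * (?a * ?b * ?a) * ?b * ?a" by (simp only: mult.assoc)
      also have "?a * ?b * ?a = ?b * ?a * ?b" by (rule braid)
      also have "?b * (?b * ?a * ?b) * ?b * ?a = (?b * ?b) * ?a * (?b * ?b) * ?a" by (simp only: mult.assoc)
      finally show ?thesis .
    qed
    show ?thesis using 1 2 that by (simp add: yt_def diag_def tri_defs mult.assoc distrib_right)
  qed
qed

text \<open>The innermost factor of \<open>balt\<close> is \<open>1 - y\<close>, and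
  \<open>y\<close> acts as 1 when the extra strand is trivial.\<close>

lemma low_balt: "a + n = e \<Longrightarrow> low (balt (yt e) (\<lambda>i. diag (s i)) a (Suc n)) = 0"
proof (induction n arbitrary: a)
  case 0
  then show ?case by (simp add: bcos_def yt_def tri_defs)
next
  case (Suc n)
  then have "low (balt (yt e) (\<lambda>i. diag (s i)) (Suc a) (Suc n)) = 0" by simp
  then show ?case by (subst balt.simps(2)) (simp add: times_tri_def del: balt.simps)
qed

text \<open>Since the lower diagonal entry vanishes, the off-diagonal entry is simply multiplied by
  the upper diagonal entry of each coset sum. Up to sign, that entry is the factor of the
  recurrence.\<close>

lemma off_balt: "a + n = e \<Longrightarrow> off (balt (yt e) (\<lambda>i. diag (s i)) a (Suc n)) = (-1) ^ n * w a (Suc n)"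
proof (induction n arbitrary: a)
  case 0
  then show ?case by (simp add: bcos_def yt_def tri_defs)
next
  case (Suc n)
  let ?b = "balt (yt e) (\<lambda>i. diag (s i)) (Suc a) (Suc n)" and ?f = "(-1) ^ n :: 'a"
  have l: "low ?b = 0" and o: "off ?b = ?f * w (Suc a) (Suc n)"
    using low_balt[of "Suc a" n e] Suc by auto
  have e: "s e = s (a + Suc n)" using Suc.prems by simp
  have "dia (bcos (yt e) (\<lambda>i. diag (s i)) a (Suc n)) =
     z2 s a (Suc (Suc n)) + ?f * (z1 s a (Suc (Suc n)) * s (a + Suc n)) * dn s a (Suc (Suc n))"
    unfolding bcos_def diag_families diag_minus_one_power
    by (simp add: yt_def diag_def plus_tri_def times_tri_def e mult.assoc del: z1.simps z2.simps)
  \<comment> \<open>Of the two factors \<open>s e\<close> in the double braiding, one has lengthened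
    the cycle \<open>dn\<close>; the other lengthens the coset sum \<open>z1\<close>.\<close>
  also have "z1 s a (Suc (Suc n)) * s (a + Suc n) = 1 - z1 s a (Suc (Suc (Suc n)))"
    by (subst (2) z1.simps(2)) (simp del: z1.simps)
  also have "z2 s a (Suc (Suc n)) + ?f * (1 - z1 s a (Suc (Suc (Suc n)))) * dn s a (Suc (Suc n)) =
     z2 s a (Suc (Suc (Suc n))) - ?f * z1 s a (Suc (Suc (Suc n))) * dn s a (Suc (Suc n))"
    by (subst (2) z2.simps(2)) (simp add: right_diff_distrib left_diff_distrib del: z1.simps z2.simps dn.simps)
  finally have d: "dia (bcos (yt e) (\<lambda>i. diag (s i)) a (Suc n)) = \<dots>" .
  have "off (balt (yt e) (\<lambda>i. diag (s i)) a (Suc (Suc n))) = dia (bcos (yt e) (\<lambda>i. diag (s i)) a (Suc n)) * (?f * w (Suc a) (Suc n))"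
    by (subst balt.simps(2)) (simp add: times_tri_def l o del: balt.simps)
  also have "\<dots> = (-1) ^ Suc n * w a (Suc (Suc n))"
    unfolding d wt.simps(3) minus_one_power_left_commute
    by (simp add: left_diff_distrib right_diff_distrib mult.assoc del: z1.simps z2.simps dn.simps)
  finally show ?case .
qed

definition wdiv :: "nat \<Rightarrow> nat \<Rightarrow> 'a" where
  "wdiv a n = (-1) ^ n * off (bfac (yt (a + n)) (\<lambda>i. diag (s i)) a (Suc n))"

text \<open>The off-diagonal entries of the two factorizations of \<open>balt\<close> are compared;
  the factor of type A is diagonal and can be taken out on the right.\<close>

lemma w_right_divisible: "w a (Suc n) = wdiv a n * alt s a (Suc n)"
proof -
  interpret affine_braid "\<lambda>i. diag (s i)" "yt (a + n)" "a + n" by (rule affine_yt)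
  have "w a (Suc n) = (-1) ^ n * off (balt (yt (a + n)) (\<lambda>i. diag (s i)) a (Suc n))"
    by (simp only: off_balt minus_one_power_cancel)
  also have "balt (yt (a + n)) (\<lambda>i. diag (s i)) a (Suc n) =
      bfac (yt (a + n)) (\<lambda>i. diag (s i)) a (Suc n) * diag (alt s a (Suc n))"
    using balt_eq[of a "Suc n"] by (simp add: diag_families del: balt.simps bfac.simps alt.simps)
  finally show ?thesis by (simp add: wdiv_def times_tri_def diag_def mult.assoc del: balt.simps bfac.simps alt.simps)
qed

text \<open>The recurrence factor sends the antisymmetrizer of the shifted strands to a right
  multiple of the larger one, so divisibility propagates from degree one, where it is the
  solvability of the initial condition.\<close>

lemma w_left_divisible:
  assumes "\<And>a. alt s a 2 * x a = - c a"
  shows "\<exists>x. w a (Suc n) = alt s a (Suc (Suc n)) * x"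
proof (induction n arbitrary: a)
  case 0
  show ?case using assms[of a] by (auto simp: numeral_2_eq_2 intro!: exI[of _ "x a"])
next
  case (Suc n)
  obtain v where v: "w (Suc a) (Suc n) = alt s (Suc a) (Suc (Suc n)) * v" using Suc by blast
  let ?A = "alt s (Suc a) (Suc (Suc n))" and ?f = "(-1) ^ n :: 'a"
  have 1: "?f * z1 s a (Suc (Suc (Suc n))) * dn s a (Suc (Suc n)) * ?A =
      ?f * (z1 s a (Suc (Suc (Suc n))) * alt s a (Suc (Suc n))) * dn s a (Suc (Suc n))"
    by (simp only: mult.assoc dn_conj_shift(4)[OF order_refl])
  have "w a (Suc (Suc n)) = (?f * z1 s a (Suc (Suc (Suc n))) * dn s a (Suc (Suc n)) * ?A - z2 s a (Suc (Suc (Suc n))) * ?A) * v"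
    by (simp add: v left_diff_distrib mult.assoc del: z1.simps z2.simps dn.simps alt.simps)
  also have "\<dots> = alt s a (Suc (Suc (Suc n))) * ((?f * dn s a (Suc (Suc n)) - 1) * v)"
    unfolding 1 by (simp only: alt.simps(2)[of s a "Suc (Suc n)", symmetric] alt_Suc_z2[of a "Suc (Suc n)", symmetric]
      left_diff_distrib right_diff_distrib minus_one_power_left_commute mult.assoc mult_1_left mult_1_right)
  finally show ?case by blast
qed

end

section \<open>Tensors as operators on an infinite tensor power\<close>

subsection \<open>Words\<close>

lemma finite_words [simp]: "finite (words n :: 'n::finite list set)"
  using finite_lists_length_eq[of "UNIV :: 'n set" n] by (simp add: words_def)

lemma words_0 [simp]: "words 0 = {[]}"
  by (auto simp: words_def)

lemma in_words_iff [simp]: "I \<in> words n \<longleftrightarrow> length I = n"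
  by (simp add: words_def)

lemma sum_words_append: "(\<Sum>J\<in>words (m + n). f J) = (\<Sum>K\<in>words m. \<Sum>L\<in>words n. f (K @ L))"
  for f :: "'n::finite list \<Rightarrow> 'b::comm_monoid_add"
proof -
  have "(\<Sum>J\<in>words (m + n). f J) = (\<Sum>(K, L)\<in>words m \<times> words n. f (K @ L))"
    by (rule sum.reindex_bij_witness[of _ "\<lambda>(K, L). K @ L" "\<lambda>J. (take m J, drop m J)"]) auto
  then show ?thesis by (simp add: sum.cartesian_product)
qed

lemma sum_words_1: "(\<Sum>J\<in>words (Suc 0). f J) = (\<Sum>a\<in>UNIV. f [a])"
  for f :: "'n::finite list \<Rightarrow> 'b::comm_monoid_add"
  by (rule sum.reindex_bij_witness[of _ "\<lambda>a. [a]" hd]) (auto simp: length_Suc_conv)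

lemma sum_words_Suc: "(\<Sum>J\<in>words (Suc n). f J) = (\<Sum>a\<in>UNIV. \<Sum>K\<in>words n. f (a # K))"
  for f :: "'n::finite list \<Rightarrow> 'b::comm_monoid_add"
  using sum_words_append[of f 1 n] by (simp add: sum_words_1)

lemma sum_words_Suc': "(\<Sum>J\<in>words (Suc n). f J) = (\<Sum>K\<in>words n. \<Sum>a\<in>UNIV. f (K @ [a]))"
  for f :: "'n::finite list \<Rightarrow> 'b::comm_monoid_add"
  using sum_words_append[of f n 1] by (simp add: sum_words_1)

lemma sum_words_delta:
  fixes f :: "'n::finite list \<Rightarrow> 'b::comm_monoid_add"
  assumes "length J = n"
  shows "(\<Sum>K\<in>words n. if J = K then f K else 0) = f J"
    and "(\<Sum>K\<in>words n. if K = J then f K else 0) = f J"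
  using assms by (simp_all add: sum.delta sum.delta')

lemma sum_emb:
  fixes f :: "'n::finite list \<Rightarrow> complex"
  assumes "length L = a" "length X = s" "length R = b"
  shows "(\<Sum>J\<in>words (a + t + b). emb a s t T (L @ X @ R) J * f J) = (\<Sum>Y\<in>words t. T X Y * f (L @ Y @ R))"
proof -
  have *: "emb a s t T (L @ X @ R) (K @ Y @ S) = (if K = L \<and> S = R then T X Y else 0)"
    if "length K = a" "length Y = t" for K Y S
    using assms that by (auto simp: emb_def)
  have "(\<Sum>J\<in>words (a + t + b). emb a s t T (L @ X @ R) J * f J) =
      (\<Sum>K\<in>words a. \<Sum>Y\<in>words t. \<Sum>S\<in>words b. emb a s t T (L @ X @ R) (K @ Y @ S) * f (K @ Y @ S))"
    by (simp add: sum_words_append add.assoc)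
  also have "\<dots> = (\<Sum>K\<in>words a. \<Sum>Y\<in>words t. \<Sum>S\<in>words b. if K = L then if S = R then T X Y * f (L @ Y @ R) else 0 else 0)"
    by (intro sum.cong refl) (auto simp: *)
  also have "\<dots> = (\<Sum>K\<in>words a. if K = L then \<Sum>Y\<in>words t. T X Y * f (L @ Y @ R) else 0)"
    using assms by (intro sum.cong refl) (auto simp: sum_words_delta)
  finally show ?thesis using assms by (simp add: sum_words_delta)
qed

lemma emb_tmul:
  fixes T S :: "'n::finite tensor"
  assumes "length L = a" "length X = s" "length R = b" "d = a + t + b"
  shows "(emb a s t T \<odot>\<^bsub>d\<^esub> S) (L @ X @ R) K = (\<Sum>Y\<in>words t. T X Y * S (L @ Y @ R) K)"
  unfolding tmul_def assms(4) by (rule sum_emb) (use assms in auto)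

lemma tmul_emb_0:
  fixes T S :: "'n::finite tensor"
  assumes "length J = n + k" "m = length J - n + n'" "n' + k = m"
  shows "(T \<odot>\<^bsub>m\<^esub> emb 0 n' n S) I J = (\<Sum>K\<in>words n'. T I (K @ drop n J) * S K (take n J))"
proof -
  have k: "length (drop n J) = k" using assms by simp
  have *: "emb 0 n' n S (K @ L) J = (if L = drop n J then S K (take n J) else 0)" if "length K = n'" for K L
    using that by (auto simp: emb_def)
  have "(T \<odot>\<^bsub>m\<^esub> emb 0 n' n S) I J = (\<Sum>K\<in>words n'. \<Sum>L\<in>words k. T I (K @ L) * emb 0 n' n S (K @ L) J)"
    unfolding tmul_def assms(3)[symmetric] by (rule sum_words_append)
  also have "\<dots> = (\<Sum>K\<in>words n'. \<Sum>L\<in>words k. if L = drop n J then T I (K @ L) * S K (take n J) else 0)"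
    by (intro sum.cong refl) (auto simp: *)
  finally show ?thesis using k by (simp add: sum_words_delta)
qed

subsection \<open>The ring of additive operators\<close>

text \<open>
  Acting on functions of infinite words, tensors of all shapes live in a single ring, and the
  strands on which they act the identity need not be counted.
\<close>

typedef 'e lop = "{f :: ('e stream \<Rightarrow> complex) \<Rightarrow> 'e stream \<Rightarrow> complex.
    \<forall>u v. f (\<lambda>x. u x + v x) = (\<lambda>x. f u x + f v x)}"
  morphisms app Lop
  by (rule exI[of _ "\<lambda>v. v"]) simp

setup_lifting type_definition_lop

lemma app_add: "app x (\<lambda>\<xi>. u \<xi> + v \<xi>) = (\<lambda>\<xi>. app x u \<xi> + app x v \<xi>)"
  using app[of x] by simp

lemma app_zero: "app x (\<lambda>\<xi>. 0) = (\<lambda>\<xi>. 0)"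
  using app_add[of x "\<lambda>\<xi>. 0" "\<lambda>\<xi>. 0"] by (auto simp: fun_eq_iff)

instantiation lop :: (type) ring_1
begin

lift_definition zero_lop :: "'a lop" is "\<lambda>v \<xi>. 0" by simp
lift_definition one_lop :: "'a lop" is "\<lambda>v. v" by simp
lift_definition plus_lop :: "'a lop \<Rightarrow> 'a lop \<Rightarrow> 'a lop" is "\<lambda>f g v \<xi>. f v \<xi> + g v \<xi>"
  by (simp add: fun_eq_iff)
lift_definition uminus_lop :: "'a lop \<Rightarrow> 'a lop" is "\<lambda>f v \<xi>. - f v \<xi>"
  by (simp add: fun_eq_iff)
lift_definition minus_lop :: "'a lop \<Rightarrow> 'a lop \<Rightarrow> 'a lop" is "\<lambda>f g v \<xi>. f v \<xi> - g v \<xi>"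
  by (simp add: fun_eq_iff)
lift_definition times_lop :: "'a lop \<Rightarrow> 'a lop \<Rightarrow> 'a lop" is "\<lambda>f g v. f (g v)"
  by simp

instance
proof
  fix a b c :: "'a lop"
  show "a * b * c = a * (b * c)" by transfer simp
  show "1 * a = a" "a * 1 = a" by (transfer, simp)+
  show "a + b + c = a + (b + c)" by transfer (simp add: add.assoc)
  show "a + b = b + a" by transfer (simp add: add.commute)
  show "0 + a = a" by transfer simp
  show "- a + a = 0" by transfer simp
  show "a - b = a + - b" by transfer simp
  show "(a + b) * c = a * c + b * c" by transfer simp
  show "a * (b + c) = a * b + a * c" by transfer simp
  show "(0 :: 'a lop) \<noteq> 1" by transfer (auto simp: fun_eq_iff intro!: exI[of _ "\<lambda>_. 1"])
qed

end

lemma app_simps [simp]: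
  "app 0 v \<xi> = 0" "app 1 v = v" "app (x + y) v \<xi> = app x v \<xi> + app y v \<xi>"
  "app (- x) v \<xi> = - app x v \<xi>" "app (x - y) v \<xi> = app x v \<xi> - app y v \<xi>"
  "app (x * y) v = app x (app y v)"
proof -
  show "app 0 v \<xi> = 0" by transfer simp
  show "app 1 v = v" by transfer simp
  show "app (x + y) v \<xi> = app x v \<xi> + app y v \<xi>" by transfer simp
  show "app (- x) v \<xi> = - app x v \<xi>" by transfer simp
  show "app (x - y) v \<xi> = app x v \<xi> - app y v \<xi>" by transfer simp
  show "app (x * y) v = app x (app y v)" by transfer simp
qed

text \<open>Acting on functions of the lower indices makes composition of operators the contraction
  of tensors in the written order. An infinite tail absorbs the change in the number of strands when
  s and t differ.\<close>

lift_definition op :: "nat \<Rightarrow> nat \<Rightarrow> nat \<Rightarrow> 'n::finite tensor \<Rightarrow> 'n lop" is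
  "\<lambda>a s t T v \<xi>. \<Sum>Y\<in>words t. T (stake s (sdrop a \<xi>)) Y * v (stake a \<xi> @- Y @- sdrop (a + s) \<xi>)"
  by (simp add: distrib_left sum.distrib)

lemma op_app [simp]:
  "length L = a \<Longrightarrow> length X = s \<Longrightarrow>
    app (op a s t T) v (L @- X @- \<zeta>) = (\<Sum>Y\<in>words t. T X Y * v (L @- Y @- \<zeta>))"
  by transfer (simp add: stake_shift sdrop_shift)

lemma lop_eqI:
  assumes "\<And>v L \<zeta>. length L = n \<Longrightarrow> app x v (L @- \<zeta>) = app y v (L @- \<zeta>)"
  shows "x = y"
proof -
  have "app x v \<xi> = app y v \<xi>" for v \<xi>
    using assms[of "stake n \<xi>" v "sdrop n \<xi>"] by (simp add: stake_sdrop)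
  then show ?thesis by (metis app_inject ext)
qed

lemma split_word: "length L = a + s \<Longrightarrow> \<exists>K X. L = K @ X \<and> length K = a \<and> length X = s"
  by (rule exI[of _ "take a L"], rule exI[of _ "drop a L"]) simp

lemma op_eqI:
  assumes "\<And>v L X \<zeta>. length L = a \<Longrightarrow> length X = s \<Longrightarrow> app x v (L @- X @- \<zeta>) = app y v (L @- X @- \<zeta>)"
  shows "x = y"
proof (rule lop_eqI[of "a + s"])
  fix v and L :: "'a list" and \<zeta>
  assume "length L = a + s"
  then obtain K X where "L = K @ X" "length K = a" "length X = s" using split_word by blast
  then show "app x v (L @- \<zeta>) = app y v (L @- \<zeta>)" using assms by simp
qed

lemma op_cong:
  assumes "\<And>I J. length I = s \<Longrightarrow> length J = t \<Longrightarrow> T I J = S I J"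
  shows "op a s t T = op a s t S"
  by (rule op_eqI[of a s]) (simp add: assms)

lemma shift_eq_iff: "length Y = length J \<Longrightarrow> Y @- \<zeta> = J @- \<zeta> \<longleftrightarrow> Y = J"
  by (induction Y J rule: list_induct2) simp_all

text \<open>The indicator function of a single infinite word picks out one entry. This is the way
  back from identities in the operator ring to identities between tensors.\<close>

lemma op_inject:
  assumes "op a s t T = op a s t S" "length I = s" "length J = t"
  shows "T I J = S I J"
proof -
  let ?\<zeta> = "sconst undefined" and ?L = "replicate a undefined"
  let ?v = "\<lambda>\<xi>. if \<xi> = ?L @- J @- ?\<zeta> then 1 else 0 :: complex"
  have "app (op a s t T) ?v (?L @- I @- ?\<zeta>) = app (op a s t S) ?v (?L @- I @- ?\<zeta>)"
    by (simp add: assms(1))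
  then have "(\<Sum>Y\<in>words t. T I Y * (if Y = J then 1 else 0)) = (\<Sum>Y\<in>words t. S I Y * (if Y = J then 1 else 0))"
    using assms(2,3) by (simp add: shift_eq_iff cong: sum.cong_simp)
  then show ?thesis using assms(3) by (simp add: if_distrib sum_words_delta cong: if_cong)
qed

lemma op_mult: "op a s t T * op a t u S = op a s u (T \<odot>\<^bsub>t\<^esub> S)"
proof (rule op_eqI[of a s])
  fix v and L X :: "'a list" and \<zeta>
  assume "length L = a" "length X = s"
  then show "app (op a s t T * op a t u S) v (L @- X @- \<zeta>) = app (op a s u (T \<odot>\<^bsub>t\<^esub> S)) v (L @- X @- \<zeta>)"
    by (simp add: tmul_def sum_distrib_left sum_distrib_right mult.assoc sum.swap[of _ "words u"])
qed

lemma op_emb: "op c (a + s + b) (a + t + b) (emb a s t T) = op (c + a) s t T"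
proof (rule lop_eqI[of "c + a + s + b"])
  fix v and L :: "'a list" and \<zeta>
  assume "length L = c + a + s + b"
  then obtain M R where "L = M @ R" "length M = c + a + s" "length R = b" using split_word by blast
  moreover from this obtain N X where "M = N @ X" "length N = c + a" "length X = s" using split_word by blast
  moreover from this obtain K P where "N = K @ P" "length K = c" "length P = a" using split_word by blast
  ultimately have L: "L = K @ P @ X @ R" "length K = c" "length P = a" "length X = s" "length R = b" by auto
  have "app (op c (a + s + b) (a + t + b) (emb a s t T)) v (K @- (P @ X @ R) @- \<zeta>) =
      (\<Sum>Y\<in>words t. T X Y * v (K @- (P @ Y @ R) @- \<zeta>))"
    using L by (subst op_app) (auto simp: sum_emb)
  moreover have "app (op (c + a) s t T) v ((K @ P) @- X @- (R @- \<zeta>)) =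
      (\<Sum>Y\<in>words t. T X Y * v ((K @ P) @- Y @- (R @- \<zeta>)))"
    using L by (subst op_app) auto
  ultimately show "app (op c (a + s + b) (a + t + b) (emb a s t T)) v (L @- \<zeta>) = app (op (c + a) s t T) v (L @- \<zeta>)"
    using L by simp
qed

text \<open>The left tensor replaces s strands by t, so a tensor at position b of the result sits at
  \<open>b - t + s\<close> before the replacement.\<close>

lemma op_far: "a + t \<le> b \<Longrightarrow> op a s t T * op b s' t' S = op (b - t + s) s' t' S * op a s t T"
proof (rule lop_eqI[of "b - t + s + s'"])
  fix v and L :: "'a list" and \<zeta>
  assume ab: "a + t \<le> b" and "length L = b - t + s + s'"
  then obtain M Z where "L = M @ Z" "length M = b - t + s" "length Z = s'" using split_word by blast
  moreover from this obtain N R where "M = N @ R" "length N = a + s" "length R = b - t - a"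
    using split_word[of M "a + s" "b - t - a"] ab by (auto simp: algebra_simps)
  moreover from this obtain K X where "N = K @ X" "length K = a" "length X = s" using split_word by blast
  ultimately have L: "L = K @ X @ R @ Z" "length K = a" "length X = s" "length R = b - t - a" "length Z = s'" by auto
  have 1: "app (op b s' t' S) v (K @- Y @- R @- Z @- \<zeta>) = (\<Sum>W\<in>words t'. S Z W * v (K @- Y @- R @- W @- \<zeta>))"
    if "length Y = t" for Y
    using op_app[of "K @ Y @ R" b Z s' t' S v \<zeta>] L that ab by simp
  have 2: "app (op (b - t + s) s' t' S) u (K @- X @- R @- Z @- \<zeta>) = (\<Sum>W\<in>words t'. S Z W * u (K @- X @- R @- W @- \<zeta>))" for u
    using op_app[of "K @ X @ R" "b - t + s" Z s' t' S u \<zeta>] L ab by simp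
  show "app (op a s t T * op b s' t' S) v (L @- \<zeta>) = app (op (b - t + s) s' t' S * op a s t T) v (L @- \<zeta>)"
    using L(2-) unfolding L(1)
    by (simp add: 1 2 sum_distrib_left sum.swap[of _ "words t'"] mult.left_commute cong: sum.cong_simp)
qed

lemma op_linear:
  "op a s t (\<lambda>I J. T I J + S I J) = op a s t T + op a s t S"
  "op a s t (\<lambda>I J. T I J - S I J) = op a s t T - op a s t S"
  "op a s t (\<lambda>I J. - T I J) = - op a s t T"
  "op a s t (\<lambda>I J. 0) = 0"
  by (rule op_eqI[of a s]; simp add: algebra_simps sum.distrib sum_subtractf sum_negf)+

lemma op_sum: "op a s t (\<lambda>I J. \<Sum>k\<in>A. T k I J) = (\<Sum>k\<in>A. op a s t (T k))"
  by (induction A rule: infinite_finite_induct) (simp_all add: op_linear)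

lemma op_idt: "op a n n idt = 1"
  by (rule op_eqI[of a n]) (simp add: idt_def if_distrib[of "\<lambda>x. x * _"] sum_words_delta cong: if_cong)

lemma op_minus_one_power: "op a s t (\<lambda>I J. (-1) ^ k * T I J) = (-1) ^ k * op a s t T"
  by (induction k) (simp_all add: op_linear)

subsection \<open>Braid and structure constants as operators\<close>

definition mat_tensor :: "complex ^ ('n \<times> 'n) ^ ('n::finite \<times> 'n) \<Rightarrow> 'n tensor" where
  "mat_tensor B = (\<lambda>I J. B $ (I ! 0, I ! 1) $ (J ! 0, J ! 1))"

definition c_tensor :: "'n::finite struct_consts \<Rightarrow> 'n tensor" where
  "c_tensor C = (\<lambda>I J. C $ (I ! 0, I ! 1) $ (J ! 0))"

lemma mat_tensor_simps [simp]:
  "mat_tensor B [x, y] [m, k] = B $ (x, y) $ (m, k)" "c_tensor C [x, y] [m] = C $ (x, y) $ m"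
  by (simp_all add: mat_tensor_def c_tensor_def)

definition sop :: "'n::finite braiding \<Rightarrow> nat \<Rightarrow> 'n lop" where
  "sop \<sigma> a = op a 2 2 (mat_tensor \<sigma>)"

definition cop :: "'n::finite struct_consts \<Rightarrow> nat \<Rightarrow> 'n lop" where
  "cop C a = op a 2 (Suc 0) (c_tensor C)"

lemma sum_words_2: "(\<Sum>J\<in>words 2. f J) = (\<Sum>a\<in>UNIV. \<Sum>b\<in>UNIV. f [a, b])"
  for f :: "'n::finite list \<Rightarrow> 'b::comm_monoid_add"
  by (simp add: numeral_2_eq_2 sum_words_Suc sum_words_1)

lemma sum_pair_UNIV: "(\<Sum>p\<in>UNIV. f p) = (\<Sum>a\<in>UNIV. \<Sum>b\<in>UNIV. f (a, b))"
  for f :: "'a::finite \<times> 'b::finite \<Rightarrow> 'c::comm_monoid_add"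
  by (simp add: sum.cartesian_product flip: UNIV_Times_UNIV)

lemma length_3: "length I = 3 \<Longrightarrow> \<exists>x y z. I = [x, y, z]"
  by (auto simp: numeral_3_eq_3 length_Suc_conv)

lemma length_2: "length I = 2 \<Longrightarrow> \<exists>x y. I = [x, y]"
  by (auto simp: numeral_2_eq_2 length_Suc_conv)

lemma sop_mult: "sop A a * sop B a = sop (A ** B) a"
  unfolding sop_def op_mult
  by (rule op_cong) (auto simp: tmul_def sum_words_2 matrix_matrix_mult_def sum_pair_UNIV dest!: length_2)

lemma sop_one: "sop (mat 1) a = 1"
  unfolding sop_def op_idt[of a 2, symmetric]
  by (rule op_cong) (auto simp: mat_def idt_def dest!: length_2 split: if_splits)

lemma emb_tmul_2_2:
  fixes S :: "'n::finite tensor"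
  shows "(emb 0 2 2 (mat_tensor B) \<odot>\<^bsub>3\<^esub> S) [x, y, z] K = (\<Sum>m\<in>UNIV. \<Sum>k\<in>UNIV. B $ (x, y) $ (m, k) * S [m, k, z] K)"
    and "(emb (Suc 0) 2 2 (mat_tensor B) \<odot>\<^bsub>3\<^esub> S) [x, y, z] K = (\<Sum>m\<in>UNIV. \<Sum>k\<in>UNIV. B $ (y, z) $ (m, k) * S [x, m, k] K)"
    and "(mat_tensor B \<odot>\<^bsub>2\<^esub> S) [x, y] K = (\<Sum>m\<in>UNIV. \<Sum>k\<in>UNIV. B $ (x, y) $ (m, k) * S [m, k] K)"
    and "(emb 0 2 (Suc 0) (c_tensor C) \<odot>\<^bsub>2\<^esub> S) [x, y, z] K = (\<Sum>k\<in>UNIV. C $ (x, y) $ k * S [k, z] K)"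
    and "(emb (Suc 0) 2 (Suc 0) (c_tensor C) \<odot>\<^bsub>2\<^esub> S) [x, y, z] K = (\<Sum>k\<in>UNIV. C $ (y, z) $ k * S [x, k] K)"
  using emb_tmul[of "[]" 0 "[x, y]" 2 "[z]" 1 3 2 "mat_tensor B" S K]
    emb_tmul[of "[x]" 1 "[y, z]" 2 "[]" 0 3 2 "mat_tensor B" S K]
    emb_tmul[of "[]" 0 "[x, y]" 2 "[z]" 1 2 1 "c_tensor C" S K]
    emb_tmul[of "[x]" 1 "[y, z]" 2 "[]" 0 2 1 "c_tensor C" S K]
  by (simp_all add: sum_words_2 sum_words_1 tmul_def numeral_3_eq_3 numeral_2_eq_2 sum_words_Suc)

lemma sop_as_3:
  "sop B a = op a 3 3 (emb 0 2 2 (mat_tensor B))"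
  "sop B (Suc a) = op a 3 3 (emb (Suc 0) 2 2 (mat_tensor B))"
  "cop C a = op a 3 2 (emb 0 2 (Suc 0) (c_tensor C))"
  "cop C (Suc a) = op a 3 2 (emb (Suc 0) 2 (Suc 0) (c_tensor C))"
  using op_emb[of a 0 2 1 2 "mat_tensor B"] op_emb[of a 1 2 0 2 "mat_tensor B"]
    op_emb[of a 0 2 1 1 "c_tensor C"] op_emb[of a 1 2 0 1 "c_tensor C"]
  by (simp_all add: sop_def cop_def numeral_3_eq_3 numeral_2_eq_2)

lemma emb_3:
  "emb 0 2 2 T [x, y, z] [p, q, r] = (if z = r then T [x, y] [p, q] else 0)"
  "emb (Suc 0) 2 2 T [x, y, z] [p, q, r] = (if x = p then T [y, z] [q, r] else 0)"
  "emb 0 2 (Suc 0) T [x, y, z] [p, q] = (if z = q then T [x, y] [p] else 0)"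
  "emb (Suc 0) 2 (Suc 0) T [x, y, z] [p, q] = (if x = p then T [y, z] [q] else 0)"
  by (simp_all add: emb_def numeral_2_eq_2)

lemma sum_if_const: "(\<Sum>x\<in>A. if P then f x else 0) = (if P then sum f A else 0)"
  by simp

lemma sum_swap_3: "(\<Sum>a\<in>A. \<Sum>b\<in>B. \<Sum>c\<in>C. f a b c) = (\<Sum>c\<in>C. \<Sum>b\<in>B. \<Sum>a\<in>A. f a b c)"
proof -
  have "(\<Sum>a\<in>A. \<Sum>b\<in>B. \<Sum>c\<in>C. f a b c) = (\<Sum>a\<in>A. \<Sum>c\<in>C. \<Sum>b\<in>B. f a b c)"
    by (intro sum.cong refl sum.swap)
  also have "\<dots> = (\<Sum>c\<in>C. \<Sum>a\<in>A. \<Sum>b\<in>B. f a b c)" by (rule sum.swap)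
  also have "\<dots> = (\<Sum>c\<in>C. \<Sum>b\<in>B. \<Sum>a\<in>A. f a b c)" by (intro sum.cong refl sum.swap)
  finally show ?thesis .
qed

section \<open>The axioms of a quantum Lie algebra as operator identities\<close>

context quantum_lie
begin

abbreviation "s \<equiv> sop \<sigma>"
abbreviation "si \<equiv> sop (matrix_inv \<sigma>)"
abbreviation "c \<equiv> cop C"

lemma braid_rel: "s a * s (Suc a) * s a = s (Suc a) * s a * s (Suc a)"
proof -
  let ?A = "emb 0 2 2 (mat_tensor \<sigma>)" and ?B = "emb (Suc 0) 2 2 (mat_tensor \<sigma>)"
  have "op a 3 3 (?A \<odot>\<^bsub>3\<^esub> (?B \<odot>\<^bsub>3\<^esub> ?A)) = op a 3 3 (?B \<odot>\<^bsub>3\<^esub> (?A \<odot>\<^bsub>3\<^esub> ?B))"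
  proof (rule op_cong)
    fix I J :: "'n list"
    assume "length I = 3" "length J = 3"
    then obtain i1 i2 i3 k1 k2 k3 where [simp]: "I = [i1, i2, i3]" "J = [k1, k2, k3]"
      using length_3 by metis
    show "(?A \<odot>\<^bsub>3\<^esub> (?B \<odot>\<^bsub>3\<^esub> ?A)) I J = (?B \<odot>\<^bsub>3\<^esub> (?A \<odot>\<^bsub>3\<^esub> ?B)) I J"
      \<comment> \<open>The indices are instantiated in the order of their first occurrence in the
        identity, where the third outgoing one comes before the other two.\<close>
      using yang_baxter[of i1 i2 i3 k3 k1 k2]
      by (simp add: emb_tmul_2_2 emb_3 sum_distrib_left mult.assoc sum_if_const if_distrib[of "\<lambda>x. _ * x"] cong: if_cong)
  qed
  then show ?thesis
    by (simp only: op_mult[symmetric] sop_as_3[symmetric] mult.assoc)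
qed

lemma c_s_rel: "c a * s a = s (Suc a) * s a * c (Suc a)"
proof -
  let ?A = "emb 0 2 2 (mat_tensor \<sigma>)" and ?B = "emb (Suc 0) 2 2 (mat_tensor \<sigma>)"
  let ?C = "emb 0 2 (Suc 0) (c_tensor C)" and ?D = "emb (Suc 0) 2 (Suc 0) (c_tensor C)"
  have "op a 3 2 (?C \<odot>\<^bsub>2\<^esub> mat_tensor \<sigma>) = op a 3 2 (?B \<odot>\<^bsub>3\<^esub> (?A \<odot>\<^bsub>3\<^esub> ?D))"
  proof (rule op_cong)
    fix I J :: "'n list"
    assume "length I = 3" "length J = 2"
    then obtain n i q p m where [simp]: "I = [n, i, q]" "J = [p, m]"
      using length_3 length_2 by metis
    show "(?C \<odot>\<^bsub>2\<^esub> mat_tensor \<sigma>) I J = (?B \<odot>\<^bsub>3\<^esub> (?A \<odot>\<^bsub>3\<^esub> ?D)) I J"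
      using C_braid[of n i q p m]
      by (simp add: emb_tmul_2_2 emb_3 sum_distrib_left mult.assoc sum_if_const if_distrib[of "\<lambda>x. _ * x"] cong: if_cong)
  qed
  then show ?thesis
    by (simp only: op_mult[symmetric] sop_as_3[symmetric] sop_def[symmetric] mult.assoc)
qed

lemma s_c_s_rel: "s (Suc a) * c a * s a + c (Suc a) * s a = s a * c (Suc a) + s a * s (Suc a) * c a"
proof -
  let ?A = "emb 0 2 2 (mat_tensor \<sigma>)" and ?B = "emb (Suc 0) 2 2 (mat_tensor \<sigma>)"
  let ?C = "emb 0 2 (Suc 0) (c_tensor C)" and ?D = "emb (Suc 0) 2 (Suc 0) (c_tensor C)"
  have "op a 3 2 (\<lambda>I J. (?B \<odot>\<^bsub>3\<^esub> (?C \<odot>\<^bsub>2\<^esub> mat_tensor \<sigma>)) I J + (?D \<odot>\<^bsub>2\<^esub> mat_tensor \<sigma>) I J) =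
      op a 3 2 (\<lambda>I J. (?A \<odot>\<^bsub>3\<^esub> ?D) I J + (?A \<odot>\<^bsub>3\<^esub> (?B \<odot>\<^bsub>3\<^esub> ?C)) I J)"
  proof (rule op_cong)
    fix I J :: "'n list"
    assume "length I = 3" "length J = 2"
    then obtain q i m k s where [simp]: "I = [q, i, m]" "J = [k, s]"
      using length_3 length_2 by metis
    show "(?B \<odot>\<^bsub>3\<^esub> (?C \<odot>\<^bsub>2\<^esub> mat_tensor \<sigma>)) I J + (?D \<odot>\<^bsub>2\<^esub> mat_tensor \<sigma>) I J =
        (?A \<odot>\<^bsub>3\<^esub> ?D) I J + (?A \<odot>\<^bsub>3\<^esub> (?B \<odot>\<^bsub>3\<^esub> ?C)) I J"
      using braid_C[of i m q k s]
      by (simp add: emb_tmul_2_2 emb_3 sum_distrib_left sum_distrib_right sum.distrib distrib_left distrib_right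
          delta_def mult.assoc sum_if_const if_distrib[of "\<lambda>x. _ * x"] if_distrib[of "\<lambda>x. x * _"] cong: if_cong)
        (subst sum_swap_3, simp add: add.commute)
  qed
  then show ?thesis
    by (simp only: op_linear op_mult[symmetric] sop_as_3[symmetric] sop_def[symmetric] mult.assoc)
qed

lemma c_c_rel: "c a * c a = s (Suc a) * c a * c a + c (Suc a) * c a"
proof -
  let ?B = "emb (Suc 0) 2 2 (mat_tensor \<sigma>)"
  let ?C = "emb 0 2 (Suc 0) (c_tensor C)" and ?D = "emb (Suc 0) 2 (Suc 0) (c_tensor C)"
  have "op a 3 (Suc 0) (?C \<odot>\<^bsub>2\<^esub> c_tensor C) =
      op a 3 (Suc 0) (\<lambda>I J. (?B \<odot>\<^bsub>3\<^esub> (?C \<odot>\<^bsub>2\<^esub> c_tensor C)) I J + (?D \<odot>\<^bsub>2\<^esub> c_tensor C) I J)"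
  proof (rule op_cong)
    fix I J :: "'n list"
    assume "length I = 3" "length J = Suc 0"
    then obtain n i j l where [simp]: "I = [n, i, j]" "J = [l]"
      using length_3 by (metis length_0_conv length_Suc_conv)
    show "(?C \<odot>\<^bsub>2\<^esub> c_tensor C) I J = (?B \<odot>\<^bsub>3\<^esub> (?C \<odot>\<^bsub>2\<^esub> c_tensor C)) I J + (?D \<odot>\<^bsub>2\<^esub> c_tensor C) I J"
      using jacobi[of n i j l]
      by (simp add: emb_tmul_2_2 sum_distrib_left mult.assoc)
  qed
  moreover have "c a * c a = op a 3 (Suc 0) (?C \<odot>\<^bsub>2\<^esub> c_tensor C)" "c (Suc a) * c a = op a 3 (Suc 0) (?D \<odot>\<^bsub>2\<^esub> c_tensor C)"
    by (simp_all only: op_mult[symmetric] sop_as_3[symmetric] cop_def[symmetric])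
  moreover have "s (Suc a) * (c a * c a) = op a 3 (Suc 0) (?B \<odot>\<^bsub>3\<^esub> (?C \<odot>\<^bsub>2\<^esub> c_tensor C))"
    by (simp only: op_mult[symmetric] sop_as_3[symmetric] cop_def[symmetric])
  ultimately show ?thesis by (simp add: op_linear mult.assoc)
qed

sublocale braid_struct s si c
proof
  have \<sigma>: "\<sigma> ** matrix_inv \<sigma> = mat 1" "matrix_inv \<sigma> ** \<sigma> = mat 1"
    using invertible unfolding invertible_def matrix_inv_def by (metis (mono_tags, lifting) someI_ex)+
  show "s i * si i = 1" "si i * s i = 1" for i by (simp_all add: sop_mult \<sigma> sop_one)
  show "s i * s j = s j * s i" if "i + 2 \<le> j" for i j
    using op_far[of i 2 j 2 "mat_tensor \<sigma>" 2 2 "mat_tensor \<sigma>"] that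
    by (simp add: sop_def del: Suc_eq_plus1 add_2_eq_Suc add_2_eq_Suc')
  show "c i * s j = s (Suc j) * c i" if "i + 1 \<le> j" for i j
    using op_far[of i "Suc 0" j 2 "c_tensor C" 2 2 "mat_tensor \<sigma>"] that by (simp add: sop_def cop_def)
  show "s j * c i = c i * s j" if "j + 2 \<le> i" for i j
    using op_far[of j 2 i 2 "mat_tensor \<sigma>" 2 "Suc 0" "c_tensor C"] that
    by (simp add: sop_def cop_def del: Suc_eq_plus1 add_2_eq_Suc add_2_eq_Suc')
  show "c i * c j = c (Suc j) * c i" if "i + 1 \<le> j" for i j
    using op_far[of i "Suc 0" j 2 "c_tensor C" 2 "Suc 0" "c_tensor C"] that by (simp add: cop_def)
qed (rule braid_rel c_s_rel s_c_s_rel c_c_rel)+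

subsection \<open>The antisymmetrizers of the statement\<close>

text \<open>Spaces are numbered from 1 in \<open>sigma_at\<close>, whereas strands are numbered from
  0 in the operator ring, so space 1 is strand a.\<close>

lemma op_sigma_at: "1 \<le> l \<Longrightarrow> l + 1 \<le> d \<Longrightarrow> op a d d (sigma_at \<sigma> l) = s (a + l - 1)"
  using op_emb[of a "l - 1" 2 "d - (l + 1)" 2 "mat_tensor \<sigma>"] by (simp add: sigma_at_def sop_def mat_tensor_def)

lemma op_foldr:
  "(\<And>l. l \<in> set ls \<Longrightarrow> 1 \<le> l \<and> l + 1 \<le> d) \<Longrightarrow>
    op a d d (foldr (\<lambda>l M. sigma_at \<sigma> l \<odot>\<^bsub>d\<^esub> M) ls idt) = prod_list (map (\<lambda>l. s (a + l - 1)) ls)"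
  by (induction ls) (auto simp: op_idt op_sigma_at simp flip: op_mult)

lemma up_eq_prod_list: "up s a n = prod_list (map (\<lambda>l. s (a + l - k)) [k..<k + n])"
  by (induction n) (auto simp: algebra_simps)

lemma dn_eq_prod_list: "dn s a n = prod_list (map (\<lambda>l. s (a + l - k)) (rev [k..<k + n]))"
  by (induction n) (auto simp: algebra_simps)

lemma op_sigma_right:
  assumes "1 \<le> k" "k \<le> d"
  shows "op a d d (sigma_right \<sigma> d k d) = up s (a + k - 1) (d - k)"
proof -
  have "map (\<lambda>l. s (a + l - 1)) [k..<d] = map (\<lambda>l. s ((a + k - 1) + l - k)) [k..<k + (d - k)]"
    using assms by (auto intro!: arg_cong[of _ _ s])
  then show ?thesis
    unfolding sigma_right_def up_eq_prod_list[of "a + k - 1" "d - k" k]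
    using assms by (subst op_foldr) auto
qed

lemma op_sigma_left: "1 \<le> d \<Longrightarrow> op a d d (sigma_left \<sigma> d d 1) = dn s a (d - 1)"
  unfolding sigma_left_def dn_eq_prod_list[of a "d - 1" 1] by (subst op_foldr) auto

lemma z1_eq_sum: "z1 s a (Suc n) = 1 + (\<Sum>k = 1..n. (-1) ^ (Suc n - k) * up s (a + k - 1) (Suc n - k))"
proof (induction n)
  case (Suc n)
  have *: "up s (a + k - 1) (Suc n - k) * s (a + n) = up s (a + k - 1) (Suc (Suc n) - k)"
    if "k \<in> {1..Suc n}" for k
    using that by (auto simp: Suc_diff_le)
  have "z1 s a (Suc (Suc n)) = 1 - (\<Sum>k = 1..Suc n. (-1) ^ (Suc n - k) * up s (a + k - 1) (Suc n - k)) * s (a + n)"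
    using Suc by (subst z1.simps(2)) (simp add: add.commute del: z1.simps)
  also have "\<dots> = 1 - (\<Sum>k = 1..Suc n. (-1) ^ (Suc n - k) * up s (a + k - 1) (Suc (Suc n) - k))"
    unfolding sum_distrib_right mult.assoc by (intro arg_cong2[of _ _ _ _ minus] sum.cong refl) (simp only: *)
  also have "\<dots> = 1 + (\<Sum>k = 1..Suc n. (-1) ^ (Suc (Suc n) - k) * up s (a + k - 1) (Suc (Suc n) - k))"
    unfolding diff_conv_add_uminus sum_negf[symmetric]
    by (intro arg_cong2[of _ _ _ _ plus] sum.cong refl) (auto simp: Suc_diff_le)
  finally show ?case .
qed simp

lemma op_antisymmetrizer: "op a n n (antisymmetrizer \<sigma> n) = alt s a n"
proof (induction n)
  case 0
  show ?case by (simp add: op_idt[of a 0])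
next
  case (Suc n)
  show ?case
  proof (cases "n = 0")
    case True
    then show ?thesis by (simp add: op_idt)
  next
    case False
    have "op a (Suc n) (Suc n) (\<lambda>I J. idt I J + (\<Sum>k = 1..n. (-1) ^ (Suc n - k) * sigma_right \<sigma> (Suc n) k (Suc n) I J)) = z1 s a (Suc n)"
      unfolding op_linear op_sum op_minus_one_power op_idt z1_eq_sum
      by (intro arg_cong2[of _ _ _ _ plus] sum.cong refl) (simp add: op_sigma_right)
    then show ?thesis
      using False Suc op_emb[of a 0 n 1 n "antisymmetrizer \<sigma> n"] by (simp flip: op_mult del: z1.simps)
  qed
qed

end

subsection \<open>Generalized inverses\<close>

text \<open>For a general braiding the antisymmetrizers are not multiples of idempotents, so a
  matrix with \<open>A B A = A\<close> replaces division by a factorial. In the induction on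
  columns, a new column either lies in the range covered so far or is separated from it by a linear
  functional.\<close>

lemma generalized_inverse_exists:
  fixes A :: "'i \<Rightarrow> 'j \<Rightarrow> complex"
  assumes "finite T" "finite S"
  shows "\<exists>B. \<forall>i\<in>S. \<forall>l\<in>T. (\<Sum>j\<in>T. \<Sum>k\<in>S. A i j * B j k * A k l) = A i l"
  using assms(1)
proof (induction T)
  case (insert a T)
  then obtain B where B: "(\<Sum>j\<in>T. \<Sum>k\<in>S. A i j * B j k * A k l) = A i l" if "i \<in> S" "l \<in> T" for i l
    by blast
  define P where "P i k = (\<Sum>j\<in>T. A i j * B j k)" for i k
  have PA: "(\<Sum>k\<in>S. P i k * A k l) = A i l" if "i \<in> S" "l \<in> T" for i l
    using B[OF that] unfolding P_def sum_distrib_right by (subst sum.swap) simp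
  define u where "u i = A i a - (\<Sum>k\<in>S. P i k * A k a)" for i
  have split: "(\<Sum>j\<in>insert a T. \<Sum>k\<in>S. A i j * (if j = a then \<phi> k else B j k - \<psi> j * \<phi> k) * A k l) =
      A i a * (\<Sum>k\<in>S. \<phi> k * A k l) + (\<Sum>k\<in>S. P i k * A k l) - (\<Sum>j\<in>T. A i j * \<psi> j) * (\<Sum>k\<in>S. \<phi> k * A k l)"
    for i l \<phi> \<psi>
  proof -
    have "(\<Sum>j\<in>T. \<Sum>k\<in>S. A i j * (if j = a then \<phi> k else B j k - \<psi> j * \<phi> k) * A k l) =
        (\<Sum>j\<in>T. \<Sum>k\<in>S. A i j * B j k * A k l - A i j * \<psi> j * (\<phi> k * A k l))"
      using insert.hyps by (intro sum.cong refl) (auto simp: algebra_simps)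
    also have "\<dots> = (\<Sum>j\<in>T. \<Sum>k\<in>S. A i j * B j k * A k l) - (\<Sum>j\<in>T. A i j * \<psi> j) * (\<Sum>k\<in>S. \<phi> k * A k l)"
      by (simp add: sum_subtractf sum_product)
    also have "(\<Sum>j\<in>T. \<Sum>k\<in>S. A i j * B j k * A k l) = (\<Sum>k\<in>S. P i k * A k l)"
      unfolding P_def sum_distrib_right by (rule sum.swap)
    finally show ?thesis using insert.hyps by (simp add: sum_distrib_left mult.assoc)
  qed
  show ?case
  proof (cases "\<exists>k\<in>S. u k \<noteq> 0")
    case False
    then have u0: "u i = 0" if "i \<in> S" for i using that by blast
    show ?thesis
    \<comment> \<open>The term \<open>0 * 0\<close> gives the witness the shape required by
      \<open>split\<close> with \<phi> and \<psi> zero.\<close>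
    proof (intro exI[of _ "\<lambda>j k. if j = a then 0 else B j k - 0 * 0"] ballI)
      fix i l assume "i \<in> S" "l \<in> insert a T"
      then show "(\<Sum>j\<in>insert a T. \<Sum>k\<in>S. A i j * (if j = a then 0 else B j k - 0 * 0) * A k l) = A i l"
        unfolding split[where \<phi> = "\<lambda>_. 0" and \<psi> = "\<lambda>_. 0"] using u0[of i] PA[of i l] by (auto simp: u_def)
    qed
  next
    case True
    then obtain z where z: "z \<in> S" "u z \<noteq> 0" by blast
    \<comment> \<open>Coordinate z of the residual \<open>1 - P\<close>, normalized: it kills the
      old columns and takes the value 1 on the new one. The function \<psi> then expresses the
      covered part of the new column by the old ones.\<close>
    define \<phi> where "\<phi> k = ((if k = z then 1 else 0) - P z k) / u z" for k
    define \<psi> where "\<psi> j = (\<Sum>k\<in>S. B j k * A k a)" for j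
    have \<phi>: "(\<Sum>k\<in>S. \<phi> k * A k l) = (A z l - (\<Sum>k\<in>S. P z k * A k l)) / u z" for l
      using z assms(2) unfolding \<phi>_def
      by (simp add: sum_divide_distrib[symmetric] left_diff_distrib sum_subtractf if_distrib[of "\<lambda>x. x * _"] cong: if_cong)
    have \<phi>T: "(\<Sum>k\<in>S. \<phi> k * A k l) = 0" if "l \<in> T" for l
      unfolding \<phi> using PA[OF z(1) that] by simp
    have \<phi>a: "(\<Sum>k\<in>S. \<phi> k * A k a) = 1"
      unfolding \<phi> using z by (simp add: u_def)
    have \<psi>: "(\<Sum>j\<in>T. A i j * \<psi> j) = (\<Sum>k\<in>S. P i k * A k a)" for i
      unfolding \<psi>_def P_def sum_distrib_left sum_distrib_right by (subst sum.swap) (simp add: mult.assoc)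
    show ?thesis
    proof (intro exI[of _ "\<lambda>j k. if j = a then \<phi> k else B j k - \<psi> j * \<phi> k"] ballI)
      fix i l assume "i \<in> S" "l \<in> insert a T"
      then show "(\<Sum>j\<in>insert a T. \<Sum>k\<in>S. A i j * (if j = a then \<phi> k else B j k - \<psi> j * \<phi> k) * A k l) = A i l"
        unfolding split \<psi> using PA[of i l] \<phi>T[of l] \<phi>a by auto
    qed
  qed
qed simp

lemma tensor_generalized_inverse:
  fixes T :: "'n::finite tensor"
  shows "\<exists>B. \<forall>I\<in>words s. \<forall>L\<in>words t. (T \<odot>\<^bsub>t\<^esub> B \<odot>\<^bsub>s\<^esub> T) I L = T I L"
proof -
  obtain B where "\<forall>I\<in>words s. \<forall>L\<in>words t. (\<Sum>J\<in>words t. \<Sum>K\<in>words s. T I J * B J K * T K L) = T I L"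
    using generalized_inverse_exists[OF finite_words finite_words] by blast
  then show ?thesis
    unfolding tmul_def sum_distrib_right by (subst sum.swap) blast
qed

text \<open>The generalized inverse is chosen for the tensor, not for the operator, so the same one
  serves at every position.\<close>

lemma op_generalized_inverse: "\<exists>B. \<forall>a. op a s t T * op a t s B * op a s t T = op a s t T"
proof -
  obtain B where B: "\<forall>I\<in>words s. \<forall>L\<in>words t. (T \<odot>\<^bsub>t\<^esub> B \<odot>\<^bsub>s\<^esub> T) I L = T I L"
    using tensor_generalized_inverse by blast
  show ?thesis unfolding op_mult by (intro exI[of _ B] allI op_cong) (use B in auto)
qed

subsection \<open>The spectral projector\<close>

lemma matrix_add_rdistrib: "(A + B) ** C = A ** C + B ** C" for A B :: "complex ^ 'n ^ 'm"
  by (simp add: matrix_matrix_mult_def vec_eq_iff distrib_right sum.distrib)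

text \<open>The projector isolates the generalized eigenspace on which \<open>1 - M\<close> fails to
  be invertible, so columns killed by it are reached by \<open>1 - M\<close>, even if the eigenvalue
  is not semisimple.\<close>

lemma spectral_projector_solvable:
  fixes M P :: "complex ^ 'm ^ 'm" and C :: "complex ^ 'n ^ 'm"
  assumes "spectral_projector M 1 P" "P ** C = 0"
  shows "\<exists>X. (mat 1 - M) ** X = C"
proof -
  have PP: "P ** P = P" and PM: "P ** M = M ** P"
    and range: "range (\<lambda>v. P *v v) = {v. \<exists>k. ((\<lambda>w. M *v w - 1 *s w) ^^ k) v = 0}"
    using assms(1) by (auto simp: spectral_projector_def)
  have fixed: "P *v v = v" if "((\<lambda>w. M *v w - 1 *s w) ^^ k) v = 0" for v k
  proof -
    have "v \<in> range (\<lambda>v. P *v v)" unfolding range using that by blast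
    then show ?thesis using PP by (auto simp: matrix_vector_mul_assoc)
  qed
  have nilp: "\<exists>k. ((\<lambda>w. M *v w - 1 *s w) ^^ k) (P *v v) = 0" for v
    using range by blast
  \<comment> \<open>On the range of \<open>P\<close> the matrix \<open>1 - M\<close> is nilpotent
    and adding \<open>P\<close> makes it unipotent; on the kernel of \<open>P\<close> it is
    unchanged and already injective.\<close>
  let ?N = "mat 1 - M + P"
  have N: "?N *v v = v - M *v v + P *v v" for v
    by (simp add: matrix_vector_mult_diff_rdistrib matrix_vector_mult_add_rdistrib)
  have inj: "v = 0" if "?N *v v = 0" for v
  proof -
    have eq: "v - M *v v + P *v v = 0" using that N by simp
    have "P *v (v - M *v v + P *v v) = 0" unfolding eq by simp
    then have "P *v v - M *v (P *v v) + P *v v = 0"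
      by (simp add: matrix_vector_right_distrib matrix_vector_mult_diff_distrib matrix_vector_mul_assoc PP PM)
    \<comment> \<open>On \<open>P *v v\<close> the locally nilpotent map \<open>M - 1\<close> acts
      as the identity, which forces this vector to be zero.\<close>
    then have *: "M *v (P *v v) - 1 *s (P *v v) = P *v v" by (simp add: algebra_simps)
    then have "((\<lambda>w. M *v w - 1 *s w) ^^ k) (P *v v) = P *v v" for k by (induction k) auto
    then have P0: "P *v v = 0" using nilp[of v] by auto
    then have "((\<lambda>w. M *v w - 1 *s w) ^^ 1) v = 0" using eq by (simp add: algebra_simps)
    then have "P *v v = v" by (rule fixed)
    then show "v = 0" using P0 by simp
  qed
  have "inj (\<lambda>v. ?N *v v)"
  proof (rule injI)
    fix x y assume "?N *v x = ?N *v y"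
    then have "?N *v (x - y) = 0" by (simp add: matrix_vector_mult_diff_distrib)
    then show "x = y" using inj by fastforce
  qed
  then obtain K where K: "K ** ?N = mat 1" using matrix_left_invertible_injective[of ?N] by blast
  then have K': "?N ** K = mat 1" using matrix_left_right_inverse by blast
  have comm: "P ** ?N = ?N ** P"
  proof (subst matrix_eq, intro allI)
    fix v
    have "P *v (M *v v) = M *v (P *v v)" by (simp add: matrix_vector_mul_assoc PM)
    then show "P ** ?N *v v = ?N ** P *v v"
      by (simp only: matrix_vector_mul_assoc[symmetric] N matrix_vector_right_distrib matrix_vector_mult_diff_distrib)
  qed
  have "P ** (K ** C) = K ** (?N ** P) ** (K ** C)" by (simp add: matrix_mul_assoc K)
  also have "\<dots> = K ** P ** (?N ** K) ** C" by (simp add: comm[symmetric] matrix_mul_assoc)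
  also have "\<dots> = 0" by (simp add: K' assms(2) flip: matrix_mul_assoc)
  finally have "P ** (K ** C) = 0" .
  moreover have "?N ** (K ** C) = C" by (simp add: matrix_mul_assoc K')
  ultimately have "(mat 1 - M) ** (K ** C) = C"
    by (simp add: matrix_add_rdistrib)
  then show ?thesis by blast
qed

subsection \<open>Initial condition and recurrence as operator identities\<close>

text \<open>Records that one tensor, independent of the position a, represents the whole family. The
  identities of the operator ring are proved for each a, but a solution of the recurrence has to be
  a single tensor.\<close>

definition loc :: "nat \<Rightarrow> nat \<Rightarrow> (nat \<Rightarrow> 'n::finite lop) \<Rightarrow> bool" where
  "loc m n f \<longleftrightarrow> (\<exists>T. \<forall>a. f a = op a m n T)"

lemma loc_mult: "loc m n f \<Longrightarrow> loc n k g \<Longrightarrow> loc m k (\<lambda>a. f a * g a)"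
  unfolding loc_def by (metis op_mult)

lemma loc_linear:
  assumes "loc m n f" "loc m n g"
  shows "loc m n (\<lambda>a. f a + g a)" "loc m n (\<lambda>a. f a - g a)" "loc m n (\<lambda>a. - f a)" "loc m n (\<lambda>a. (-1) ^ k * f a)"
proof -
  obtain T S where *: "\<And>a. f a = op a m n T" "\<And>a. g a = op a m n S" using assms by (auto simp: loc_def)
  show "loc m n (\<lambda>a. f a + g a)" "loc m n (\<lambda>a. f a - g a)" "loc m n (\<lambda>a. - f a)" "loc m n (\<lambda>a. (-1) ^ k * f a)"
    unfolding loc_def * op_linear(1-3)[symmetric] op_minus_one_power[symmetric] by blast+
qed

lemma loc_one: "loc n n (\<lambda>a. 1)"
  unfolding loc_def by (metis op_idt)

lemma loc_zero: "loc m n (\<lambda>a. 0)"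
  unfolding loc_def by (metis op_linear(4))

lemma loc_shift: "loc m n f \<Longrightarrow> loc (Suc m) (Suc n) (\<lambda>a. f (Suc a))"
  unfolding loc_def using op_emb[of _ 1 m 0 n] by (metis Nat.add_0_right Suc_eq_plus1 plus_1_eq_Suc)

lemma loc_extend: "loc m n f \<Longrightarrow> loc (Suc m) (Suc n) f"
  unfolding loc_def using op_emb[of _ 0 m 1 n] by (metis Nat.add_0_right Suc_eq_plus1 add_0)

lemma loc_sop: "loc 2 2 (sop B)"
  unfolding loc_def sop_def by blast

lemma loc_sop_last: "loc (Suc (Suc n)) (Suc (Suc n)) (\<lambda>a. sop B (a + n))"
proof (induction n)
  case 0
  show ?case using loc_sop[of B] by (simp add: numeral_2_eq_2)
next
  case (Suc n)
  then show ?case using loc_shift by fastforce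
qed

lemma loc_families:
  "loc (Suc n) (Suc n) (\<lambda>a. dn (sop B) a n)" "loc (Suc n) (Suc n) (\<lambda>a. up (sop B) a n)"
  "loc n n (\<lambda>a. z1 (sop B) a n)" "loc n n (\<lambda>a. z2 (sop B) a n)"
proof -
  show dn: "loc (Suc n) (Suc n) (\<lambda>a. dn (sop B) a n)" for n
    by (induction n) (auto intro: loc_one loc_mult loc_sop_last loc_extend)
  show "loc (Suc n) (Suc n) (\<lambda>a. up (sop B) a n)"
    by (induction n) (auto intro: loc_one loc_mult loc_sop_last loc_extend)
  show "loc n n (\<lambda>a. z1 (sop B) a n)"
  proof (induction n)
    case (Suc n)
    show ?case
    proof (cases n)
      case 0
      then show ?thesis using loc_one[of 1] by simp
    next
      case (Suc m)
      have "loc (Suc n) (Suc n) (\<lambda>a. 1 - z1 (sop B) a n * sop B (a + m))"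
        by (rule loc_linear(2)[OF loc_one loc_mult[OF _ loc_sop_last[of m, folded Suc]]]) (use Suc.IH loc_extend in blast)
      then show ?thesis using Suc by simp
    qed
  qed (simp add: loc_zero)
  show "loc n n (\<lambda>a. z2 (sop B) a n)"
  proof (induction n)
    case (Suc n)
    show ?case
      unfolding z2.simps by (rule loc_linear(1)[OF loc_extend[OF Suc] loc_linear(4)[OF dn dn]])
  qed (simp add: loc_zero)
qed

section \<open>Solving the initial condition and the recurrence\<close>

context quantum_lie
begin

lemma loc_w: "loc (Suc (Suc r)) (Suc r) (\<lambda>a. w a (Suc r))"
proof (induction r)
  case 0
  have "loc 2 1 (\<lambda>a. - op a 2 1 (c_tensor C))"
    by (rule loc_linear(3)) (auto simp: loc_def)
  then show ?case by (simp add: cop_def numeral_2_eq_2)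
next
  case (Suc r)
  have "loc (Suc (Suc (Suc r))) (Suc (Suc (Suc r))) (\<lambda>a. z1 s a (Suc (Suc (Suc r))) * dn s a (Suc (Suc r)))"
    by (rule loc_mult[OF loc_families(3) loc_families(1)])
  from loc_mult[OF loc_linear(2)[OF loc_linear(4)[OF this this] loc_families(4)] loc_shift[OF Suc]]
  show ?case by (simp only: wt.simps mult.assoc)
qed

text \<open>The stated recurrence has its factor to the right of the large antisymmetrizer,
  \<open>wt\<close> has it to the left of the small one. Exchanging them makes the previous tensor
  occur only between antisymmetrizers, as the recursion for \<open>A X A\<close> requires.\<close>

lemma alt_cocycle:
  "((-1) ^ Suc (Suc r) * z1 s a (Suc (Suc (Suc r))) * dn s a (Suc (Suc r)) - z2 s a (Suc (Suc (Suc r)))) * alt s (Suc a) (Suc (Suc r)) =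
    alt s a (Suc (Suc (Suc r))) * ((-1) ^ Suc (Suc r) * dn s a (Suc (Suc r)) - 1)"
proof -
  let ?A = "alt s (Suc a) (Suc (Suc r))" and ?f = "(-1) ^ Suc (Suc r) :: 'n lop"
  have "?f * z1 s a (Suc (Suc (Suc r))) * dn s a (Suc (Suc r)) * ?A =
      ?f * (z1 s a (Suc (Suc (Suc r))) * alt s a (Suc (Suc r))) * dn s a (Suc (Suc r))"
    by (simp only: mult.assoc dn_conj_shift(4)[OF order_refl])
  then show ?thesis
    by (simp only: alt.simps(2)[of s a "Suc (Suc r)", symmetric] alt_Suc_z2[of a "Suc (Suc r)", symmetric]
      left_diff_distrib right_diff_distrib minus_one_power_left_commute mult.assoc mult_1_left mult_1_right)
qed

lemma sop_diff: "sop (A - B) a = sop A a - sop B a"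
  unfolding sop_def op_linear(2)[symmetric] by (rule op_cong) (simp add: mat_tensor_def)

lemma initial_condition_iff:
  "initial_condition \<sigma> C X \<longleftrightarrow> (\<forall>a. alt s a 2 * op a 2 1 (X 1) = - c a)"
proof
  assume X: "initial_condition \<sigma> C X"
  show "\<forall>a. alt s a 2 * op a 2 1 (X 1) = - c a"
  proof
    fix a
    show "alt s a 2 * op a 2 1 (X 1) = - c a"
      unfolding op_antisymmetrizer[symmetric] op_mult cop_def op_linear(3)[symmetric] One_nat_def
      by (rule op_cong) (use X in \<open>auto simp: initial_condition_def length_Suc_conv dest!: length_2\<close>)
  qed
next
  assume *: "\<forall>a. alt s a 2 * op a 2 1 (X 1) = - c a"
  then have "op 0 2 1 (antisymmetrizer \<sigma> 2 \<odot>\<^bsub>2\<^esub> X 1) = op 0 2 1 (\<lambda>I J. - c_tensor C I J)"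
    by (simp add: op_linear(3) op_antisymmetrizer cop_def flip: op_mult)
  from op_inject[OF this] show "initial_condition \<sigma> C X"
    by (simp add: initial_condition_def)
qed

lemma recurrence_iff:
  "recurrence \<sigma> X (Suc (Suc r)) \<longleftrightarrow>
    (\<forall>a. alt s a (Suc (Suc (Suc r))) * op a (Suc (Suc (Suc r))) (Suc (Suc r)) (X (Suc (Suc r))) * alt s a (Suc (Suc r)) =
      ((-1) ^ Suc (Suc r) * z1 s a (Suc (Suc (Suc r))) * dn s a (Suc (Suc r)) - z2 s a (Suc (Suc (Suc r)))) *
        (alt s (Suc a) (Suc (Suc r)) * op (Suc a) (Suc (Suc r)) (Suc r) (X (Suc r)) * alt s (Suc a) (Suc r)))"
    (is "?L \<longleftrightarrow> (\<forall>a. ?P a = ?Q a)")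
proof -
  let ?r = "Suc (Suc r)"
  let ?l = "antisymmetrizer \<sigma> (?r + 1) \<odot>\<^bsub>?r + 1\<^esub> X ?r \<odot>\<^bsub>?r\<^esub> antisymmetrizer \<sigma> ?r"
  let ?s = "\<lambda>K L. (-1) ^ ?r * sigma_left \<sigma> (?r + 1) (?r + 1) 1 K L - idt K L"
  let ?d = "antisymmetrizer \<sigma> (?r + 1) \<odot>\<^bsub>?r + 1\<^esub> ?s
      \<odot>\<^bsub>?r + 1\<^esub> emb 1 ?r (?r - 1) (X (?r - 1)) \<odot>\<^bsub>?r\<^esub> emb 1 (?r - 1) (?r - 1) (antisymmetrizer \<sigma> (?r - 1))"
  have l: "op a (?r + 1) ?r ?l = ?P a" for a
    by (simp only: op_mult[symmetric] op_antisymmetrizer Suc_eq_plus1[symmetric])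
  have e1: "op a (Suc ?r) ?r (emb 1 ?r (Suc r) (X (Suc r))) = op (Suc a) ?r (Suc r) (X (Suc r))" for a
    using op_emb[of a 1 ?r 0 "Suc r" "X (Suc r)"] by simp
  have e2: "op a ?r ?r (emb 1 (Suc r) (Suc r) (antisymmetrizer \<sigma> (Suc r))) = alt s (Suc a) (Suc r)" for a
    using op_emb[of a 1 "Suc r" 0 "Suc r" "antisymmetrizer \<sigma> (Suc r)"]
    by (simp add: op_antisymmetrizer del: alt.simps antisymmetrizer.simps)
  have e3: "op a (Suc ?r) (Suc ?r) (sigma_left \<sigma> (Suc ?r) (Suc ?r) 1) = dn s a ?r" for a
    using op_sigma_left[of "Suc ?r" a] by simp
  have "op a (?r + 1) ?r ?d = alt s a (Suc ?r) * ((-1) ^ ?r * dn s a ?r - 1) * op (Suc a) ?r (Suc r) (X (Suc r)) * alt s (Suc a) (Suc r)" for a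
    unfolding Suc_eq_plus1[symmetric] diff_Suc_1 op_mult[symmetric] op_linear op_minus_one_power e1 e2 e3 op_antisymmetrizer op_idt ..
  then have d: "op a (?r + 1) ?r ?d = ?Q a" for a
    unfolding alt_cocycle[symmetric] by (simp only: mult.assoc)
  show ?thesis
  proof
    assume ?L
    then show "\<forall>a. ?P a = ?Q a"
      unfolding l[symmetric] d[symmetric] by (intro allI op_cong) (auto simp: recurrence_def)
  next
    assume "\<forall>a. ?P a = ?Q a"
    then have "op 0 (?r + 1) ?r ?l = op 0 (?r + 1) ?r ?d" unfolding l d by blast
    from op_inject[OF this] show ?L by (simp add: recurrence_def)
  qed
qed

lemma alt_generalized_inverse: "\<exists>B. \<forall>a. alt s a n * op a n n B * alt s a n = alt s a n"
  using op_generalized_inverse[of n n "antisymmetrizer \<sigma> n"] by (simp only: op_antisymmetrizer)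

lemma brst_tensors_exist: "\<exists>X. brst_tensors \<sigma> C h X"
proof -
  obtain P where "spectral_projector \<sigma> 1 P" "P ** C = 0" using projector by blast
  then obtain Y where Y: "(mat 1 - \<sigma>) ** Y = C" using spectral_projector_solvable by blast
  define x where "x I J = - c_tensor Y I J" for I J
  have x: "alt s a 2 * op a 2 1 x = - c a" for a
  proof -
    have "alt s a 2 = sop (mat 1 - \<sigma>) a"
      by (simp add: numeral_2_eq_2 sop_diff sop_one)
    then have "alt s a 2 * op a 2 1 x = op a 2 1 (mat_tensor (mat 1 - \<sigma>) \<odot>\<^bsub>2\<^esub> x)"
      by (simp add: sop_def op_mult)
    also have "\<dots> = op a 2 1 (\<lambda>I J. - c_tensor C I J)"
      by (rule op_cong)
        (auto simp: tmul_def x_def sum_words_2 Y[symmetric] matrix_matrix_mult_def sum_pair_UNIV sum_negf length_Suc_conv dest!: length_2)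
    finally show ?thesis by (simp add: op_linear(3) cop_def)
  qed
  have "\<exists>T. \<forall>a. alt s a (Suc (Suc (Suc r))) * op a (Suc (Suc (Suc r))) (Suc (Suc r)) T * alt s a (Suc (Suc r)) = w a (Suc (Suc r))" for r
  proof -
    let ?m = "Suc (Suc (Suc r))" and ?n = "Suc (Suc r)"
    obtain B where B: "\<And>a. alt s a ?m * op a ?m ?m B * alt s a ?m = alt s a ?m"
      using alt_generalized_inverse by blast
    obtain D where D: "\<And>a. alt s a ?n * op a ?n ?n D * alt s a ?n = alt s a ?n"
      using alt_generalized_inverse by blast
    obtain W where W: "\<And>a. w a ?n = op a ?m ?n W" using loc_w[of "Suc r"] by (auto simp: loc_def)
    \<comment> \<open>The solution is \<open>B W D\<close>, with generalized inverses on both sides: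
      left divisibility of \<open>w\<close> absorbs \<open>B\<close> and right divisibility absorbs
      \<open>D\<close>.\<close>
    have "alt s a ?m * op a ?m ?n (B \<odot>\<^bsub>?m\<^esub> W \<odot>\<^bsub>?n\<^esub> D) * alt s a ?n = w a ?n" for a
    proof -
      obtain y where y: "w a ?n = alt s a ?m * y" using w_left_divisible[of "\<lambda>a. op a 2 1 x" a "Suc r"] x by blast
      let ?B = "op a ?m ?m B" and ?D = "op a ?n ?n D"
      have "alt s a ?m * op a ?m ?n (B \<odot>\<^bsub>?m\<^esub> W \<odot>\<^bsub>?n\<^esub> D) * alt s a ?n = (alt s a ?m * ?B * w a ?n) * (?D * alt s a ?n)"
        by (simp only: op_mult[symmetric] W mult.assoc)
      also have "alt s a ?m * ?B * w a ?n = (alt s a ?m * ?B * alt s a ?m) * y" by (simp only: y mult.assoc)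
      also have "\<dots> = w a ?n" by (simp only: B y)
      also have "w a ?n * (?D * alt s a ?n) = wdiv a (Suc r) * (alt s a ?n * ?D * alt s a ?n)"
        by (simp only: w_right_divisible mult.assoc)
      finally show ?thesis by (simp only: D w_right_divisible)
    qed
    then show ?thesis by blast
  qed
  then obtain Z where Z: "\<And>r a. alt s a (Suc (Suc (Suc r))) * op a (Suc (Suc (Suc r))) (Suc (Suc r)) (Z r) * alt s a (Suc (Suc r)) = w a (Suc (Suc r))"
    by metis
  define X where "X r = (case r of Suc (Suc n) \<Rightarrow> Z n | _ \<Rightarrow> x)" for r
  have w: "alt s a (Suc (Suc r)) * op a (Suc (Suc r)) (Suc r) (X (Suc r)) * alt s a (Suc r) = w a (Suc r)" for a r
  proof (cases r)
    case 0
    then show ?thesis using x[of a] by (simp add: X_def numeral_2_eq_2)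
  next
    case (Suc n)
    then show ?thesis using Z[of a n] by (simp add: X_def del: alt.simps wt.simps)
  qed
  have "recurrence \<sigma> X (Suc (Suc r))" for r
    unfolding recurrence_iff w wt.simps by (rule allI) (rule refl)
  then have "recurrence \<sigma> X r" if "2 \<le> r" for r
    using that by (metis add_2_eq_Suc le_Suc_ex)
  moreover have "initial_condition \<sigma> C X"
    unfolding initial_condition_iff using x by (simp add: X_def)
  ultimately show ?thesis by (auto simp: brst_tensors_def)
qed

lemma alt_zero:
  assumes "is_height \<sigma> h" "h < n"
  shows "alt s a n = 0"
proof -
  have "op a n n (antisymmetrizer \<sigma> n) = op a n n (\<lambda>I J. 0)"
    by (rule op_cong) (use assms in \<open>auto simp: is_height_def\<close>)
  then show ?thesis by (simp add: op_antisymmetrizer op_linear)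
qed

text \<open>From the height on, the large antisymmetrizer vanishes and with it the prescribed
  tensor, so continuing by zero satisfies the recurrence in all degrees.\<close>

lemma brst_tensors_w:
  assumes "brst_tensors \<sigma> C h X" "is_height \<sigma> h"
  defines "Y \<equiv> \<lambda>r. if r < h then X r else (\<lambda>I J. 0)"
  shows "alt s a (Suc (Suc r)) * op a (Suc (Suc r)) (Suc r) (Y (Suc r)) * alt s a (Suc r) = w a (Suc r)"
proof (induction r arbitrary: a)
  case 0
  have "alt s a 2 * op a 2 1 (X 1) = - c a"
    using assms(1) by (simp only: brst_tensors_def initial_condition_iff)
  \<comment> \<open>If h is at most 1, the initial condition itself makes \<open>c\<close>
    vanish.\<close>
  then show ?case using alt_zero[OF assms(2), of "Suc (Suc 0)" a] by (auto simp: Y_def numeral_2_eq_2)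
next
  case (Suc r)
  show ?case
  proof (cases "Suc (Suc r) < h")
    case True
    then have "recurrence \<sigma> X (Suc (Suc r))" using assms(1) by (simp add: brst_tensors_def)
    then show ?thesis
      unfolding recurrence_iff using Suc[of "Suc a"] True by (simp add: Y_def del: alt.simps z1.simps z2.simps dn.simps)
  next
    case False
    then have "alt s a (Suc (Suc (Suc r))) = 0" by (intro alt_zero[OF assms(2)]) simp
    \<comment> \<open>\<open>alt_cocycle\<close> exhibits the vanishing antisymmetrizer as a left
      factor.\<close>
    moreover from this have "w a (Suc (Suc r)) = 0"
      unfolding wt.simps Suc[of "Suc a", symmetric] mult.assoc[symmetric] alt_cocycle by simp
    ultimately show ?thesis by simp
  qed
qed

end

section \<open>Calculations modulo a two-sided ideal\<close>

subsection \<open>The free algebra\<close>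

lemma single_mult: "Poly_Mapping.single v c * Poly_Mapping.single w d = Poly_Mapping.single (v @ w) (c * d)"
  for v w :: "'g list" and c d :: complex
  by (simp add: mult_single plus_list_def)

lemma one_eq_single: "(1 :: 'g free_alg) = Poly_Mapping.single [] 1"
  using single_one[where ?'a = "'g list" and ?'b = complex] by (simp add: zero_list_def)

lemma free_alg_expand: "x = (\<Sum>v\<in>Poly_Mapping.keys x. Poly_Mapping.single v (Poly_Mapping.lookup x v))"
  for x :: "'g free_alg"
  by (rule poly_mapping_eqI) (simp add: lookup_sum lookup_single when_def in_keys_iff)

lemma scalar_central: "x * scalar c = scalar c * x"
proof -
  have "(\<Sum>v\<in>Poly_Mapping.keys x. Poly_Mapping.single v (Poly_Mapping.lookup x v)) * scalar c =
      scalar c * (\<Sum>v\<in>Poly_Mapping.keys x. Poly_Mapping.single v (Poly_Mapping.lookup x v))"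
    by (simp add: scalar_def sum_distrib_left sum_distrib_right single_mult mult.commute)
  then show ?thesis by (simp flip: free_alg_expand)
qed

lemma scalar_simps:
  "scalar 0 = 0" "scalar 1 = 1" "scalar (a + b) = scalar a + scalar b" "scalar (a - b) = scalar a - scalar b"
  "scalar (- a) = - scalar a" "scalar (a * b) = scalar a * scalar b"
  by (simp_all add: scalar_def one_eq_single single_mult single_add single_diff single_uminus)

lemma scalar_sum: "scalar (\<Sum>i\<in>A. f i) = (\<Sum>i\<in>A. scalar (f i))"
  by (induction A rule: infinite_finite_induct) (simp_all add: scalar_simps)

lemma scalar_left_commute: "x * (scalar c * y) = scalar c * (x * y)"
  by (metis mult.assoc scalar_central)

lemma gam_word_simps:
  "gam_word [] = 1" "gam_word (j # J) = gam j * gam_word J" "gam_word (I @ J) = gam_word I * gam_word J"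
  by (simp_all add: gam_word_def)

lemma omg_word_simps:
  "omg_word [] = 1" "omg_word (j # J) = omg_word J * omg j" "omg_word (I @ J) = omg_word J * omg_word I"
  by (simp_all add: omg_word_def)

subsection \<open>Congruence\<close>

locale two_sided_ideal =
  fixes \<I> :: "'a::ring_1 set"
  assumes zero_mem: "0 \<in> \<I>"
    and add_mem: "x \<in> \<I> \<Longrightarrow> y \<in> \<I> \<Longrightarrow> x + y \<in> \<I>"
    and left_mem: "x \<in> \<I> \<Longrightarrow> a * x \<in> \<I>"
    and right_mem: "x \<in> \<I> \<Longrightarrow> x * a \<in> \<I>"
begin

definition eqv :: "'a \<Rightarrow> 'a \<Rightarrow> bool" (infix "\<doteq>" 50) where "x \<doteq> y \<longleftrightarrow> x - y \<in> \<I>"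

lemma minus_mem: "x \<in> \<I> \<Longrightarrow> - x \<in> \<I>"
  using left_mem[of x "-1"] by simp

lemma eqv_refl [simp]: "x \<doteq> x"
  by (simp add: eqv_def zero_mem)

lemma eqv_sym: "x \<doteq> y \<Longrightarrow> y \<doteq> x"
  unfolding eqv_def using minus_mem by fastforce

lemma eqv_trans [trans]: "x \<doteq> y \<Longrightarrow> y \<doteq> z \<Longrightarrow> x \<doteq> z"
  unfolding eqv_def using add_mem by fastforce

lemma eqv_eq_trans [trans]: "x \<doteq> y \<Longrightarrow> y = z \<Longrightarrow> x \<doteq> z" "x = y \<Longrightarrow> y \<doteq> z \<Longrightarrow> x \<doteq> z"
  by simp_all

lemma eqv_add: "x \<doteq> y \<Longrightarrow> x' \<doteq> y' \<Longrightarrow> x + x' \<doteq> y + y'"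
  unfolding eqv_def using add_mem[of "x - y" "x' - y'"] by (simp add: algebra_simps)

lemma eqv_minus: "x \<doteq> y \<Longrightarrow> - x \<doteq> - y"
  unfolding eqv_def using minus_mem[of "x - y"] by simp

lemma eqv_diff: "x \<doteq> y \<Longrightarrow> x' \<doteq> y' \<Longrightarrow> x - x' \<doteq> y - y'"
  using eqv_add[of x y "- x'" "- y'"] eqv_minus by simp

lemma eqv_mult: "x \<doteq> y \<Longrightarrow> x' \<doteq> y' \<Longrightarrow> x * x' \<doteq> y * y'"
  unfolding eqv_def using add_mem[OF right_mem[of "x - y" x'] left_mem[of "x' - y'" y]]
  by (simp add: algebra_simps)

lemma eqv_left: "x \<doteq> y \<Longrightarrow> z * x \<doteq> z * y"
  and eqv_right: "x \<doteq> y \<Longrightarrow> x * z \<doteq> y * z"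
  by (simp_all add: eqv_mult)

lemma eqv_sum: "(\<And>i. i \<in> A \<Longrightarrow> f i \<doteq> g i) \<Longrightarrow> (\<Sum>i\<in>A. f i) \<doteq> (\<Sum>i\<in>A. g i)"
  by (induction A rule: infinite_finite_induct) (auto intro: eqv_add)

lemma eqv_zero_iff: "x \<doteq> 0 \<longleftrightarrow> x \<in> \<I>"
  by (simp add: eqv_def)

lemma eqv_if_diff_eqv_0: "x - y \<doteq> 0 \<Longrightarrow> x \<doteq> y"
  by (simp add: eqv_def)

end

subsection \<open>Normally ordered elements\<close>

text \<open>The slot \<open>z\<close> between the \<Omega> and the \<gamma> holds 1 or a single
  \<chi>; the wedge relations apply on either side of it.\<close>

definition nb :: "nat \<Rightarrow> nat \<Rightarrow> 'n::finite tensor \<Rightarrow> 'n generator free_alg \<Rightarrow> 'n generator free_alg" where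
  "nb p t T z = (\<Sum>I\<in>words p. \<Sum>J\<in>words t. omg_word I * scalar (T I J) * z * gam_word J)"

lemma nb_cong: "(\<And>I J. length I = p \<Longrightarrow> length J = t \<Longrightarrow> T I J = S I J) \<Longrightarrow> nb p t T z = nb p t S z"
  by (simp add: nb_def)

lemma nb_add: "nb p t (\<lambda>I J. T I J + S I J) z = nb p t T z + nb p t S z"
  by (simp add: nb_def scalar_simps distrib_left distrib_right sum.distrib)

lemma nb_diff: "nb p t (\<lambda>I J. T I J - S I J) z = nb p t T z - nb p t S z"
  by (simp add: nb_def scalar_simps left_diff_distrib right_diff_distrib sum_subtractf)

lemma nb_zero: "nb p t (\<lambda>I J. 0) z = 0"
  by (simp add: nb_def scalar_simps)

lemma tmul_assoc: "(S \<odot>\<^bsub>m\<^esub> T) \<odot>\<^bsub>n\<^esub> U = S \<odot>\<^bsub>m\<^esub> (T \<odot>\<^bsub>n\<^esub> U)"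
  by (intro ext) (simp add: tmul_def sum_distrib_left sum_distrib_right mult.assoc sum.swap[of _ "words m"])

locale wedge_ideal = two_sided_ideal \<I> for \<I> :: "'n::finite generator free_alg set" +
  fixes \<sigma> :: "'n braiding"
  assumes gam_mem: "gam_rels \<sigma> \<subseteq> \<I>" and omg_mem: "omg_rels \<sigma> \<subseteq> \<I>"
begin

lemma gam_rel:
  assumes "\<And>J. length J = n \<Longrightarrow> (\<Sum>I\<in>words n. f I * antisymmetrizer \<sigma> n I J) = 0"
  shows "(\<Sum>I\<in>words n. scalar (f I) * gam_word I) \<doteq> 0"
proof (cases "n = 0")
  case True
  then show ?thesis using assms[of "[]"] by (simp add: idt_def scalar_simps)
next
  case False
  then have "(\<Sum>I\<in>words n. scalar (f I) * gam_word I) \<in> gam_rels \<sigma>"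
    unfolding gam_rels_def using assms by fastforce
  then show ?thesis using gam_mem by (auto simp: eqv_zero_iff)
qed

lemma omg_rel:
  assumes "\<And>I. length I = n \<Longrightarrow> (\<Sum>J\<in>words n. antisymmetrizer \<sigma> n I J * f J) = 0"
  shows "(\<Sum>J\<in>words n. omg_word J * scalar (f J)) \<doteq> 0"
proof (cases "n = 0")
  case True
  then show ?thesis using assms[of "[]"] by (simp add: idt_def scalar_simps)
next
  case False
  then have "(\<Sum>J\<in>words n. omg_word J * scalar (f J)) \<in> omg_rels \<sigma>"
    unfolding omg_rels_def using assms by fastforce
  then show ?thesis using omg_mem by (auto simp: eqv_zero_iff)
qed

text \<open>
  If \<open>B\<close> is a generalized inverse of the antisymmetrizer \<open>A\<close>, then \<open>\<gamma> = A B \<gamma>\<close> and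
  \<open>\<Omega> = \<Omega> B A\<close>, so only \<open>A T A\<close> matters.
\<close>

lemma gam_word_expand:
  "\<exists>B. \<forall>J\<in>words t. gam_word J \<doteq> (\<Sum>L\<in>words t. scalar ((antisymmetrizer \<sigma> t \<odot>\<^bsub>t\<^esub> B) J L) * gam_word L)"
proof -
  define A where "A = antisymmetrizer \<sigma>"
  obtain B where B: "\<forall>I\<in>words t. \<forall>L\<in>words t. (A t \<odot>\<^bsub>t\<^esub> B \<odot>\<^bsub>t\<^esub> A t) I L = A t I L"
    using tensor_generalized_inverse by blast
  let ?G = "A t \<odot>\<^bsub>t\<^esub> B"
  have g: "gam_word J \<doteq> (\<Sum>L\<in>words t. scalar (?G J L) * gam_word L)" if J: "length J = t" for J
  proof -
    have "(\<Sum>L\<in>words t. scalar ((if L = J then 1 else 0) - ?G J L) * gam_word L) \<doteq> 0"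
    proof (rule gam_rel)
      fix K :: "'n list" assume K: "length K = t"
      have "(\<Sum>L\<in>words t. ((if L = J then 1 else 0) - ?G J L) * A t L K) = A t J K - (?G \<odot>\<^bsub>t\<^esub> A t) J K"
        using J by (simp add: left_diff_distrib sum_subtractf tmul_def if_distrib[of "\<lambda>x. x * _"] sum_words_delta cong: if_cong)
      then show "(\<Sum>L\<in>words t. ((if L = J then 1 else 0) - ?G J L) * antisymmetrizer \<sigma> t L K) = 0"
        using B J K by (simp add: A_def)
    qed
    moreover have "(\<Sum>L\<in>words t. scalar ((if L = J then 1 else 0) - ?G J L) * gam_word L) =
        gam_word J - (\<Sum>L\<in>words t. scalar (?G J L) * gam_word L)"
      using J by (simp add: scalar_simps left_diff_distrib sum_subtractf if_distrib[of scalar] if_distrib[of "\<lambda>x. x * _"] sum_words_delta cong: if_cong)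
    ultimately show ?thesis by (auto intro: eqv_if_diff_eqv_0)
  qed
  then show ?thesis unfolding A_def by (intro exI[of _ B]) simp
qed

lemma omg_word_expand:
  "\<exists>D. \<forall>J\<in>words p. omg_word J \<doteq> (\<Sum>L\<in>words p. omg_word L * scalar ((D \<odot>\<^bsub>p\<^esub> antisymmetrizer \<sigma> p) L J))"
proof -
  define A where "A = antisymmetrizer \<sigma>"
  obtain D where D: "\<forall>I\<in>words p. \<forall>L\<in>words p. (A p \<odot>\<^bsub>p\<^esub> D \<odot>\<^bsub>p\<^esub> A p) I L = A p I L"
    using tensor_generalized_inverse by blast
  let ?H = "D \<odot>\<^bsub>p\<^esub> A p"
  have o: "omg_word J \<doteq> (\<Sum>L\<in>words p. omg_word L * scalar (?H L J))" if J: "length J = p" for J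
  proof -
    have "(\<Sum>L\<in>words p. omg_word L * scalar ((if L = J then 1 else 0) - ?H L J)) \<doteq> 0"
    proof (rule omg_rel)
      fix K :: "'n list" assume K: "length K = p"
      have "(\<Sum>L\<in>words p. A p K L * ((if L = J then 1 else 0) - ?H L J)) = A p K J - (A p \<odot>\<^bsub>p\<^esub> ?H) K J"
        using J by (simp add: right_diff_distrib sum_subtractf tmul_def if_distrib[of "\<lambda>x. _ * x"] sum_words_delta cong: if_cong)
      then show "(\<Sum>L\<in>words p. antisymmetrizer \<sigma> p K L * ((if L = J then 1 else 0) - ?H L J)) = 0"
        using D J K by (simp add: A_def tmul_assoc)
    qed
    moreover have "(\<Sum>L\<in>words p. omg_word L * scalar ((if L = J then 1 else 0) - ?H L J)) =
        omg_word J - (\<Sum>L\<in>words p. omg_word L * scalar (?H L J))"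
      using J by (simp add: scalar_simps right_diff_distrib sum_subtractf if_distrib[of scalar] if_distrib[of "\<lambda>x. _ * x"] sum_words_delta cong: if_cong)
    ultimately show ?thesis by (auto intro: eqv_if_diff_eqv_0)
  qed
  then show ?thesis unfolding A_def by (intro exI[of _ D]) simp
qed

text \<open>The wedge relations have numerical coefficients. Expanding \<Omega> through a
  generalized inverse lets them act on coefficients from the algebra which are annihilated only
  modulo the ideal, such as the quadratic terms in \<chi>.\<close>

lemma omg_vec_eqv_0:
  assumes "\<And>I. length I = p \<Longrightarrow> (\<Sum>J\<in>words p. scalar (antisymmetrizer \<sigma> p I J) * f J) \<doteq> 0"
  shows "(\<Sum>J\<in>words p. omg_word J * f J) \<doteq> 0"
proof -
  obtain D where D: "\<forall>J\<in>words p. omg_word J \<doteq> (\<Sum>L\<in>words p. omg_word L * scalar ((D \<odot>\<^bsub>p\<^esub> antisymmetrizer \<sigma> p) L J))"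
    using omg_word_expand by blast
  have "(\<Sum>J\<in>words p. omg_word J * f J) \<doteq>
      (\<Sum>J\<in>words p. (\<Sum>L\<in>words p. omg_word L * scalar ((D \<odot>\<^bsub>p\<^esub> antisymmetrizer \<sigma> p) L J)) * f J)"
    using D by (intro eqv_sum eqv_right) auto
  also have "\<dots> = (\<Sum>L\<in>words p. \<Sum>K\<in>words p. omg_word L * scalar (D L K) * (\<Sum>J\<in>words p. scalar (antisymmetrizer \<sigma> p K J) * f J))"
    unfolding tmul_def scalar_sum scalar_simps sum_distrib_left sum_distrib_right mult.assoc
    by (subst sum.swap) (intro sum.cong refl sum.swap)
  also have "\<dots> \<doteq> (\<Sum>L\<in>words p. \<Sum>K\<in>words p. omg_word L * scalar (D L K) * 0)"
    by (intro eqv_sum eqv_left assms) simp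
  finally show ?thesis by simp
qed

lemma nb_eqv_0:
  assumes "\<And>I J. length I = p \<Longrightarrow> length J = t \<Longrightarrow>
    (antisymmetrizer \<sigma> p \<odot>\<^bsub>p\<^esub> T \<odot>\<^bsub>t\<^esub> antisymmetrizer \<sigma> t) I J = 0"
  shows "nb p t T z \<doteq> 0"
proof -
  define A where "A = antisymmetrizer \<sigma>"
  obtain B where g: "\<forall>J\<in>words t. gam_word J \<doteq> (\<Sum>L\<in>words t. scalar ((A t \<odot>\<^bsub>t\<^esub> B) J L) * gam_word L)"
    unfolding A_def using gam_word_expand by blast
  obtain D where o: "\<forall>J\<in>words p. omg_word J \<doteq> (\<Sum>L\<in>words p. omg_word L * scalar ((D \<odot>\<^bsub>p\<^esub> A p) L J))"
    unfolding A_def using omg_word_expand by blast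
  let ?G = "A t \<odot>\<^bsub>t\<^esub> B" and ?H = "D \<odot>\<^bsub>p\<^esub> A p"
  have 1: "nb p t S z \<doteq> nb p t (S \<odot>\<^bsub>t\<^esub> ?G) z" for S
  proof -
    have "nb p t S z \<doteq> (\<Sum>I\<in>words p. \<Sum>J\<in>words t. omg_word I * scalar (S I J) * z * (\<Sum>L\<in>words t. scalar (?G J L) * gam_word L))"
      unfolding nb_def using g by (intro eqv_sum eqv_left) auto
    also have "\<dots> = (\<Sum>I\<in>words p. \<Sum>L\<in>words t. \<Sum>J\<in>words t. omg_word I * (scalar (S I J) * scalar (?G J L)) * z * gam_word L)"
      by (subst (2) sum.swap) (simp add: sum_distrib_left mult.assoc scalar_left_commute[of z])
    also have "\<dots> = nb p t (S \<odot>\<^bsub>t\<^esub> ?G) z"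
      unfolding nb_def tmul_def[of S] scalar_sum sum_distrib_left sum_distrib_right scalar_simps ..
    finally show ?thesis .
  qed
  have 2: "nb p t S z \<doteq> nb p t (?H \<odot>\<^bsub>p\<^esub> S) z" for S
  proof -
    have "nb p t S z \<doteq> (\<Sum>I\<in>words p. \<Sum>J\<in>words t. (\<Sum>L\<in>words p. omg_word L * scalar (?H L I)) * (scalar (S I J) * z * gam_word J))"
      unfolding nb_def mult.assoc using o by (intro eqv_sum eqv_right) auto
    also have "\<dots> = (\<Sum>I\<in>words p. \<Sum>L\<in>words p. \<Sum>J\<in>words t. omg_word L * (scalar (?H L I) * scalar (S I J)) * z * gam_word J)"
      by (subst (2) sum.swap) (simp add: sum_distrib_right mult.assoc)
    also have "\<dots> = (\<Sum>L\<in>words p. \<Sum>J\<in>words t. \<Sum>I\<in>words p. omg_word L * (scalar (?H L I) * scalar (S I J)) * z * gam_word J)"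
      by (subst sum.swap) (intro sum.cong refl sum.swap)
    also have "\<dots> = nb p t (?H \<odot>\<^bsub>p\<^esub> S) z"
      unfolding nb_def tmul_def[of ?H _ S] scalar_sum sum_distrib_left sum_distrib_right scalar_simps ..
    finally show ?thesis .
  qed
  have "nb p t T z \<doteq> nb p t (?H \<odot>\<^bsub>p\<^esub> (T \<odot>\<^bsub>t\<^esub> ?G)) z"
    using 1[of T] 2[of "T \<odot>\<^bsub>t\<^esub> ?G"] by (rule eqv_trans)
  also have "nb p t (?H \<odot>\<^bsub>p\<^esub> (T \<odot>\<^bsub>t\<^esub> ?G)) z = nb p t (\<lambda>I J. 0) z"
  proof (rule nb_cong)
    fix I J :: "'n list" assume "length I = p" "length J = t"
    have eq: "?H \<odot>\<^bsub>p\<^esub> (T \<odot>\<^bsub>t\<^esub> ?G) = D \<odot>\<^bsub>p\<^esub> ((A p \<odot>\<^bsub>p\<^esub> T \<odot>\<^bsub>t\<^esub> A t) \<odot>\<^bsub>t\<^esub> B)" by (simp only: tmul_assoc)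
    show "(?H \<odot>\<^bsub>p\<^esub> (T \<odot>\<^bsub>t\<^esub> ?G)) I J = 0"
      unfolding eq using assms unfolding A_def tmul_def[of D] tmul_def[of _ _ B] by simp
  qed
  finally show ?thesis by (simp add: nb_zero)
qed

end

subsection \<open>Tensors of the normal ordering\<close>

text \<open>
  \<open>invt\<close> and \<open>kap\<close> are the coefficients of \<open>\<gamma>\<^sub>J \<Omega>\<^sup>k\<close> in normal order, \<open>tau\<close> and \<open>tau0\<close> those of
  \<open>\<chi>\<^sub>j \<Omega>\<^sup>I\<close>.
\<close>

primrec invt :: "'n::finite braiding \<Rightarrow> nat \<Rightarrow> 'n tensor" where
  "invt B 0 = idt"
| "invt B (Suc t) = emb 0 2 2 (mat_tensor B) \<odot>\<^bsub>Suc (Suc t)\<^esub> emb 1 (Suc t) (Suc t) (invt B t)"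

primrec kap :: "'n::finite braiding \<Rightarrow> nat \<Rightarrow> 'n tensor" where
  "kap B 0 = (\<lambda>I J. 0)"
| "kap B (Suc t) = (\<lambda>I J. emb 1 t t (kap B t) I J + (-1) ^ t * invt B t I J)"

primrec tau :: "'n::finite braiding \<Rightarrow> nat \<Rightarrow> 'n tensor" where
  "tau B 0 = idt"
| "tau B (Suc n) = emb 1 (Suc n) (Suc n) (tau B n) \<odot>\<^bsub>Suc (Suc n)\<^esub> emb 0 2 2 (mat_tensor B)"

primrec tau0 :: "'n::finite braiding \<Rightarrow> 'n struct_consts \<Rightarrow> nat \<Rightarrow> 'n tensor" where
  "tau0 B C 0 = (\<lambda>I J. 0)"
| "tau0 B C (Suc n) = (\<lambda>I J. emb 1 (Suc n) n (tau0 B C n) I J +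
     (emb 1 (Suc n) (Suc n) (tau B n) \<odot>\<^bsub>Suc (Suc n)\<^esub> emb 0 2 1 (c_tensor C)) I J)"

lemma emb_Cons:
  "length I = s \<Longrightarrow> length J = t \<Longrightarrow> emb (Suc 0) s t T (x # I) (y # J) = (if x = y then T I J else 0)"
  by (simp add: emb_def)

lemma invt_Suc:
  assumes "length J = t" "length L = Suc t"
  shows "invt B (Suc t) (p # j # J) (x # L) = (\<Sum>b\<in>UNIV. B $ (p, j) $ (x, b) * invt B t (b # J) L)"
proof -
  have "invt B (Suc t) ([] @ [p, j] @ J) (x # L) =
      (\<Sum>Y\<in>words 2. mat_tensor B [p, j] Y * emb 1 (Suc t) (Suc t) (invt B t) ([] @ Y @ J) (x # L))"
    unfolding invt.simps by (rule emb_tmul) (use assms in auto)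
  then show ?thesis
    using assms by (simp add: sum_words_2 emb_Cons sum_if_const if_distrib[of "\<lambda>x. _ * x"] cong: if_cong)
qed

lemma tau_Suc:
  assumes "length L = Suc n" "length I = n"
  shows "tau B (Suc n) (p # L) (u # i # I) = (\<Sum>x\<in>UNIV. tau B n L (x # I) * B $ (p, x) $ (u, i))"
proof -
  have "tau B (Suc n) (p # L) (u # i # I) =
      (\<Sum>K\<in>words 2. emb 1 (Suc n) (Suc n) (tau B n) (p # L) (K @ drop 2 (u # i # I)) * mat_tensor B K (take 2 (u # i # I)))"
    unfolding tau.simps by (rule tmul_emb_0) (use assms in auto)
  then show ?thesis
    using assms by (simp add: sum_words_2 emb_Cons sum_if_const if_distrib[of "\<lambda>x. x * _"] cong: if_cong)
qed

lemma tau0_Suc: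
  assumes "length L = Suc n" "length I = n"
  shows "tau0 B C (Suc n) (p # L) (i # I) = (if p = i then tau0 B C n L I else 0) +
    (\<Sum>x\<in>UNIV. tau B n L (x # I) * C $ (p, x) $ i)"
proof -
  have "(emb 1 (Suc n) (Suc n) (tau B n) \<odot>\<^bsub>Suc (Suc n)\<^esub> emb 0 2 1 (c_tensor C)) (p # L) (i # I) =
      (\<Sum>K\<in>words 2. emb 1 (Suc n) (Suc n) (tau B n) (p # L) (K @ drop 1 (i # I)) * c_tensor C K (take 1 (i # I)))"
    by (rule tmul_emb_0) (use assms in auto)
  then show ?thesis
    using assms by (simp add: sum_words_2 emb_Cons sum_if_const if_distrib[of "\<lambda>x. x * _"] cong: if_cong)
qed

section \<open>The normal ordering tensors as elements of the braid group algebra\<close>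

context quantum_lie
begin

lemma op_invt: "op a (Suc t) (Suc t) (invt (matrix_inv \<sigma>) t) = up si a t"
proof (induction t arbitrary: a)
  case (Suc t)
  have "op a (Suc (Suc t)) (Suc (Suc t)) (emb 0 2 2 (mat_tensor (matrix_inv \<sigma>))) = si a"
    using op_emb[of a 0 2 t 2 "mat_tensor (matrix_inv \<sigma>)"] by (simp add: sop_def)
  moreover have "op a (Suc (Suc t)) (Suc (Suc t)) (emb 1 (Suc t) (Suc t) (invt (matrix_inv \<sigma>) t)) = up si (Suc a) t"
    using op_emb[of a 1 "Suc t" 0 "Suc t" "invt (matrix_inv \<sigma>) t"] Suc by simp
  ultimately show ?case by (simp only: invt.simps op_mult[symmetric] up_Suc')
qed (simp add: op_idt)

lemma op_kap: "op a t t (kap (matrix_inv \<sigma>) t) = z1 si a t"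
proof (induction t arbitrary: a)
  case (Suc t)
  have "op a (Suc t) (Suc t) (emb 1 t t (kap (matrix_inv \<sigma>) t)) = z1 si (Suc a) t"
    using op_emb[of a 1 t 0 t "kap (matrix_inv \<sigma>) t"] Suc by simp
  then show ?case by (simp only: kap.simps op_linear op_minus_one_power op_invt z1_Suc')
qed (simp add: op_linear)

lemma op_tau: "op a (Suc n) (Suc n) (tau \<sigma> n) = dn s a n"
proof (induction n arbitrary: a)
  case (Suc n)
  have "op a (Suc (Suc n)) (Suc (Suc n)) (emb 0 2 2 (mat_tensor \<sigma>)) = s a"
    using op_emb[of a 0 2 n 2 "mat_tensor \<sigma>"] by (simp add: sop_def)
  moreover have "op a (Suc (Suc n)) (Suc (Suc n)) (emb 1 (Suc n) (Suc n) (tau \<sigma> n)) = dn s (Suc a) n"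
    using op_emb[of a 1 "Suc n" 0 "Suc n" "tau \<sigma> n"] Suc by simp
  ultimately show ?case by (simp only: tau.simps op_mult[symmetric] dn_Suc')
qed (simp add: op_idt)

lemma op_tau0: "op a (Suc n) n (tau0 \<sigma> C n) = t0 a n"
proof (induction n arbitrary: a)
  case (Suc n)
  have "op a (Suc (Suc n)) (Suc n) (emb 0 2 1 (c_tensor C)) = c a"
    using op_emb[of a 0 2 n 1 "c_tensor C"] by (simp add: cop_def)
  moreover have "op a (Suc (Suc n)) (Suc (Suc n)) (emb 1 (Suc n) (Suc n) (tau \<sigma> n)) = dn s (Suc a) n"
    using op_emb[of a 1 "Suc n" 0 "Suc n" "tau \<sigma> n"] op_tau by simp
  moreover have "op a (Suc (Suc n)) (Suc n) (emb 1 (Suc n) n (tau0 \<sigma> C n)) = t0 (Suc a) n"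
    using op_emb[of a 1 "Suc n" 0 n "tau0 \<sigma> C n"] Suc by simp
  ultimately show ?case by (simp only: tau0.simps op_linear op_mult[symmetric] tz.simps)
qed (simp add: op_linear)

end

subsection \<open>Moving \<open>\<Omega>\<close> through \<open>\<gamma>\<close> and \<open>\<chi>\<close> through both\<close>

lemma if_scalar: "scalar (if P then a else b) = (if P then scalar a else scalar b)"
  by simp

locale gam_omg_ideal = two_sided_ideal \<I> for \<I> :: "'n::finite generator free_alg set" +
  fixes \<sigma> :: "'n braiding"
  assumes gam_omg_mem: "gam_omg_rels \<sigma> \<subseteq> \<I>"
begin

abbreviation "B \<equiv> matrix_inv \<sigma>"

lemma gam_omg: "gam j * omg i \<doteq> - (\<Sum>p\<in>UNIV. \<Sum>x\<in>UNIV. omg p * scalar (B $ (p, j) $ (x, i)) * gam x) + scalar (delta i j)"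
  unfolding eqv_def using gam_omg_mem unfolding gam_omg_rels_def by blast

text \<open>What has become of \<Omega> after passing the t factors \<gamma> with indices
  \<open>J\<close>. The word \<open>L\<close> is one letter longer: it lists the new indices of the
  \<gamma>, followed by the original index of \<Omega>.\<close>

definition ox :: "nat \<Rightarrow> 'n list \<Rightarrow> 'n list \<Rightarrow> 'n generator free_alg" where
  "ox t J L = (\<Sum>p\<in>UNIV. omg p * scalar ((-1) ^ t * invt B t (p # J) L))"

lemma gam_ox:
  assumes "length J = t" "length L = Suc t"
  shows "gam j * ox t J L \<doteq> (\<Sum>x\<in>UNIV. ox (Suc t) (j # J) (x # L) * gam x) + scalar ((-1) ^ t * invt B t (j # J) L)"
proof -
  let ?c = "\<lambda>b. (-1) ^ t * invt B t (b # J) L"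
  have "gam j * ox t J L = (\<Sum>b\<in>UNIV. gam j * omg b * scalar (?c b))"
    by (simp add: ox_def sum_distrib_left mult.assoc)
  also have "\<dots> \<doteq> (\<Sum>b\<in>UNIV. (- (\<Sum>p\<in>UNIV. \<Sum>x\<in>UNIV. omg p * scalar (B $ (p, j) $ (x, b)) * gam x) + scalar (delta b j)) * scalar (?c b))"
    by (intro eqv_sum eqv_right gam_omg)
  also have "\<dots> = (\<Sum>b\<in>UNIV. \<Sum>p\<in>UNIV. \<Sum>x\<in>UNIV. omg p * scalar (- (B $ (p, j) $ (x, b) * ?c b)) * gam x) + (\<Sum>b\<in>UNIV. scalar (delta b j * ?c b))"
    by (simp add: left_diff_distrib sum_subtractf sum_distrib_left sum_distrib_right scalar_simps(5,6) mult.assoc sum_negf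
        scalar_central[of "gam _"] scalar_left_commute[of "gam _"])
  also have "(\<Sum>b\<in>UNIV. scalar (delta b j * ?c b)) = scalar (?c j)"
    by (simp add: delta_def if_distrib[of scalar] if_distrib[of "\<lambda>x. x * _"] scalar_simps(1) cong: if_cong)
  also have "(\<Sum>b\<in>UNIV. \<Sum>p\<in>UNIV. \<Sum>x\<in>UNIV. omg p * scalar (- (B $ (p, j) $ (x, b) * ?c b)) * gam x) =
      (\<Sum>x\<in>UNIV. \<Sum>p\<in>UNIV. \<Sum>b\<in>UNIV. omg p * scalar (- (B $ (p, j) $ (x, b) * ?c b)) * gam x)"
    by (rule sum_swap_3)
  also have "\<dots> = (\<Sum>x\<in>UNIV. ox (Suc t) (j # J) (x # L) * gam x)"
  proof (rule sum.cong[OF refl])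
    fix x
    have "(-1) ^ Suc t * invt B (Suc t) (p # j # J) (x # L) = (\<Sum>b\<in>UNIV. - (B $ (p, j) $ (x, b) * ?c b))" for p
      unfolding invt_Suc[OF assms] by (simp add: sum_distrib_left sum_negf mult.left_commute)
    then show "(\<Sum>p\<in>UNIV. \<Sum>b\<in>UNIV. omg p * scalar (- (B $ (p, j) $ (x, b) * ?c b)) * gam x) = ox (Suc t) (j # J) (x # L) * gam x"
      by (simp only: ox_def scalar_sum sum_distrib_left sum_distrib_right)
  qed
  finally show ?thesis .
qed

text \<open>Either \<Omega> passes all \<gamma> or it is contracted with one of them. For the empty
  word the truncated length is 0 and the second sum vanishes because \<open>kap B 0\<close> is
  zero.\<close>

lemma gam_word_omg:
  "gam_word J * omg k \<doteq> (\<Sum>S\<in>words (length J). ox (length J) J (S @ [k]) * gam_word S)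
    + (\<Sum>S\<in>words (length J - 1). scalar (kap B (length J) J (S @ [k])) * gam_word S)"
proof (induction J)
  case Nil
  have "ox 0 [] [k] = omg k"
    by (simp add: ox_def idt_def if_distrib[of scalar] if_distrib[of "\<lambda>x. _ * x"] scalar_simps cong: if_cong)
  then show ?case by (simp add: gam_word_simps scalar_simps)
next
  case (Cons j J)
  let ?t = "length J"
  \<comment> \<open>A contraction either took place among the old letters, leaving \<open>j\<close>
    in front, or involves \<open>j\<close> and the \<Omega> that has passed the others; these are
    the two summands in the recursion of \<open>kap\<close>.\<close>
  have kap: "(\<Sum>S\<in>words (?t - 1). scalar (kap B ?t J (S @ [k])) * gam_word (j # S)) +
      (\<Sum>S\<in>words ?t. scalar ((-1) ^ ?t * invt B ?t (j # J) (S @ [k])) * gam_word S) =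
      (\<Sum>S\<in>words ?t. scalar (kap B (Suc ?t) (j # J) (S @ [k])) * gam_word S)"
  proof (cases ?t)
    case 0
    then show ?thesis by (simp add: scalar_simps emb_def)
  next
    case (Suc u)
    have "(\<Sum>S\<in>words u. scalar (kap B (Suc u) J (S @ [k])) * gam_word (j # S)) =
        (\<Sum>S\<in>words (Suc u). scalar (emb (Suc 0) (Suc u) (Suc u) (kap B (Suc u)) (j # J) (S @ [k])) * gam_word S)"
      using Suc by (simp add: sum_words_Suc emb_Cons if_distrib[of scalar] if_distrib[of "\<lambda>x. x * _"] sum_if_const scalar_simps(1)
        sum.swap[of _ "words u"] del: kap.simps cong: if_cong)
    then show ?thesis
      unfolding Suc by (subst (2) kap.simps(2)) (simp add: scalar_simps(3) distrib_right sum.distrib del: kap.simps invt.simps power_Suc)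
  qed
  have "gam_word (j # J) * omg k \<doteq> gam j * ((\<Sum>S\<in>words ?t. ox ?t J (S @ [k]) * gam_word S)
      + (\<Sum>S\<in>words (?t - 1). scalar (kap B ?t J (S @ [k])) * gam_word S))"
    unfolding gam_word_simps mult.assoc by (intro eqv_left Cons)
  also have "\<dots> = (\<Sum>S\<in>words ?t. (gam j * ox ?t J (S @ [k])) * gam_word S)
      + (\<Sum>S\<in>words (?t - 1). scalar (kap B ?t J (S @ [k])) * gam_word (j # S))"
    by (simp add: distrib_left sum_distrib_left gam_word_simps mult.assoc scalar_left_commute[of "gam j"])
  also have "\<dots> \<doteq> (\<Sum>S\<in>words ?t. ((\<Sum>x\<in>UNIV. ox (Suc ?t) (j # J) (x # S @ [k]) * gam x) + scalar ((-1) ^ ?t * invt B ?t (j # J) (S @ [k]))) * gam_word S)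
      + (\<Sum>S\<in>words (?t - 1). scalar (kap B ?t J (S @ [k])) * gam_word (j # S))"
    by (intro eqv_add eqv_sum eqv_right gam_ox eqv_refl) auto
  also have "\<dots> = (\<Sum>S\<in>words ?t. \<Sum>x\<in>UNIV. ox (Suc ?t) (j # J) (x # S @ [k]) * gam_word (x # S)) +
      ((\<Sum>S\<in>words (?t - 1). scalar (kap B ?t J (S @ [k])) * gam_word (j # S)) +
      (\<Sum>S\<in>words ?t. scalar ((-1) ^ ?t * invt B ?t (j # J) (S @ [k])) * gam_word S))"
    by (simp add: distrib_right sum.distrib sum_distrib_right gam_word_simps mult.assoc)
  also have "\<dots> = (\<Sum>S\<in>words (Suc ?t). ox (Suc ?t) (j # J) (S @ [k]) * gam_word S) +
      (\<Sum>S\<in>words ?t. scalar (kap B (Suc ?t) (j # J) (S @ [k])) * gam_word S)"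
    unfolding kap by (simp add: sum_words_Suc sum.swap[of _ UNIV])
  finally show ?case by simp
qed

end

section \<open>Moving \<chi> through words in \<Omega> and in \<gamma>\<close>

locale chi_ideal = two_sided_ideal \<I> for \<I> :: "'n::finite generator free_alg set" +
  fixes \<sigma> :: "'n braiding" and C :: "'n struct_consts"
  assumes gam_chi_mem: "gam_chi_rels \<sigma> C \<subseteq> \<I>" and chi_omg_mem: "chi_omg_rels \<sigma> C \<subseteq> \<I>"
begin

lemma gam_chi: "gam i * chi j \<doteq> (\<Sum>m\<in>UNIV. \<Sum>k\<in>UNIV. scalar (\<sigma> $ (i, j) $ (m, k)) * chi m * gam k) + (\<Sum>k\<in>UNIV. scalar (C $ (i, j) $ k) * gam k)"
  unfolding eqv_def using gam_chi_mem unfolding gam_chi_rels_def by blast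

lemma chi_omg: "chi j * omg i \<doteq> (\<Sum>p\<in>UNIV. omg p * ((\<Sum>x\<in>UNIV. scalar (\<sigma> $ (p, j) $ (x, i)) * chi x) + scalar (C $ (p, j) $ i)))"
  unfolding eqv_def using chi_omg_mem unfolding chi_omg_rels_def by blast

text \<open>Both cross relations of \<chi> contain the same tensors, so one family of coefficients
  serves for \<chi> moving to the right through \<Omega> and to the left through \<gamma>.\<close>

definition cx :: "nat \<Rightarrow> 'n list \<Rightarrow> 'n list \<Rightarrow> 'n generator free_alg" where
  "cx n L I = (\<Sum>x\<in>UNIV. scalar (tau \<sigma> n L (x # I)) * chi x) + scalar (tau0 \<sigma> C n L I)"

lemma cx_0: "cx 0 [j] [] = chi j"
  by (simp add: cx_def idt_def if_distrib[of scalar] if_distrib[of "\<lambda>x. x * _"] scalar_simps cong: if_cong)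

lemma cx_Suc:
  assumes "length L = Suc n" "length I = n"
  shows "cx (Suc n) (p # L) (i # I) =
    (\<Sum>x\<in>UNIV. scalar (tau \<sigma> n L (x # I)) * ((\<Sum>u\<in>UNIV. scalar (\<sigma> $ (p, x) $ (u, i)) * chi u) + scalar (C $ (p, x) $ i)))
    + (if p = i then scalar (tau0 \<sigma> C n L I) else 0)"
  unfolding cx_def tau_Suc[OF assms] tau0_Suc[OF assms]
  by (simp add: scalar_sum scalar_simps(1,3,6) sum_distrib_left sum_distrib_right distrib_left sum.distrib mult.assoc
      sum.swap[of "\<lambda>u x. scalar (tau \<sigma> n L (x # I)) * _ u x"] if_scalar)

lemma cx_omg:
  assumes "length L = Suc n" "length I = n"
  shows "cx n L I * omg i \<doteq> (\<Sum>p\<in>UNIV. omg p * cx (Suc n) (p # L) (i # I))"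
proof -
  let ?t = "\<lambda>x. scalar (tau \<sigma> n L (x # I))"
  let ?f = "\<lambda>p x. (\<Sum>u\<in>UNIV. scalar (\<sigma> $ (p, x) $ (u, i)) * chi u) + scalar (C $ (p, x) $ i)"
  have "cx n L I * omg i = (\<Sum>x\<in>UNIV. ?t x * (chi x * omg i)) + scalar (tau0 \<sigma> C n L I) * omg i"
    by (simp add: cx_def distrib_right sum_distrib_right mult.assoc)
  also have "\<dots> \<doteq> (\<Sum>x\<in>UNIV. ?t x * (\<Sum>p\<in>UNIV. omg p * ?f p x)) + scalar (tau0 \<sigma> C n L I) * omg i"
    by (intro eqv_add eqv_sum eqv_left chi_omg eqv_refl)
  also have "(\<Sum>x\<in>UNIV. ?t x * (\<Sum>p\<in>UNIV. omg p * ?f p x)) = (\<Sum>p\<in>UNIV. omg p * (\<Sum>x\<in>UNIV. ?t x * ?f p x))"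
    unfolding sum_distrib_left[of _ _ UNIV] by (subst sum.swap) (simp only: scalar_left_commute[of "omg _"])
  also have "scalar (tau0 \<sigma> C n L I) * omg i = (\<Sum>p\<in>UNIV. omg p * (if p = i then scalar (tau0 \<sigma> C n L I) else 0))"
    by (simp add: if_distrib[of "\<lambda>x. _ * x"] scalar_central[of "omg i"] cong: if_cong)
  finally show ?thesis
    unfolding cx_Suc[OF assms] by (simp only: distrib_left sum.distrib)
qed

lemma gam_cx:
  assumes "length L = Suc n" "length I = n"
  shows "gam i * cx n L I \<doteq> (\<Sum>k\<in>UNIV. cx (Suc n) (i # L) (k # I) * gam k)"
proof -
  let ?t = "\<lambda>x. scalar (tau \<sigma> n L (x # I))"
  let ?f = "\<lambda>k x. (\<Sum>u\<in>UNIV. scalar (\<sigma> $ (i, x) $ (u, k)) * chi u) + scalar (C $ (i, x) $ k)"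
  have g: "gam i * chi x \<doteq> (\<Sum>k\<in>UNIV. ?f k x * gam k)" for x
    using gam_chi[of i x] by (subst (asm) sum.swap) (simp add: distrib_right sum.distrib sum_distrib_right)
  have "gam i * cx n L I = (\<Sum>x\<in>UNIV. ?t x * (gam i * chi x)) + scalar (tau0 \<sigma> C n L I) * gam i"
    by (simp add: cx_def distrib_left sum_distrib_left scalar_left_commute[of "gam i"] scalar_central[of "gam i"])
  also have "\<dots> \<doteq> (\<Sum>x\<in>UNIV. ?t x * (\<Sum>k\<in>UNIV. ?f k x * gam k)) + scalar (tau0 \<sigma> C n L I) * gam i"
    by (intro eqv_add eqv_sum eqv_left g eqv_refl)
  also have "(\<Sum>x\<in>UNIV. ?t x * (\<Sum>k\<in>UNIV. ?f k x * gam k)) = (\<Sum>k\<in>UNIV. (\<Sum>x\<in>UNIV. ?t x * ?f k x) * gam k)"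
    unfolding sum_distrib_left[of "?t _"] sum_distrib_right[of _ UNIV "gam _"] mult.assoc by (rule sum.swap)
  also have "scalar (tau0 \<sigma> C n L I) * gam i = (\<Sum>k\<in>UNIV. (if i = k then scalar (tau0 \<sigma> C n L I) else 0) * gam k)"
    by (simp add: if_distrib[of "\<lambda>x. x * _"] cong: if_cong)
  finally show ?thesis
    unfolding cx_Suc[OF assms] by (simp only: distrib_right sum.distrib)
qed

lemma chi_omg_word: "chi j * omg_word I \<doteq> (\<Sum>K\<in>words (length I). omg_word K * cx (length I) (K @ [j]) I)"
proof (induction I)
  case (Cons i I)
  let ?n = "length I"
  have "chi j * omg_word (i # I) \<doteq> (\<Sum>K\<in>words ?n. omg_word K * cx ?n (K @ [j]) I) * omg i"
    unfolding omg_word_simps mult.assoc[symmetric] by (intro eqv_right Cons)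
  also have "\<dots> = (\<Sum>K\<in>words ?n. omg_word K * (cx ?n (K @ [j]) I * omg i))"
    by (simp add: sum_distrib_right mult.assoc)
  also have "\<dots> \<doteq> (\<Sum>K\<in>words ?n. omg_word K * (\<Sum>p\<in>UNIV. omg p * cx (Suc ?n) (p # K @ [j]) (i # I)))"
    by (intro eqv_sum eqv_left cx_omg) auto
  also have "\<dots> = (\<Sum>K\<in>words (Suc ?n). omg_word K * cx (Suc ?n) (K @ [j]) (i # I))"
    by (simp add: sum_words_Suc sum_distrib_left omg_word_simps mult.assoc sum.swap[of _ UNIV])
  finally show ?case by simp
qed (simp add: omg_word_simps cx_0)

lemma gam_word_chi: "gam_word J * chi j \<doteq> (\<Sum>K\<in>words (length J). cx (length J) (J @ [j]) K * gam_word K)"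
proof (induction J)
  case (Cons i J)
  let ?n = "length J"
  have "gam_word (i # J) * chi j \<doteq> gam i * (\<Sum>K\<in>words ?n. cx ?n (J @ [j]) K * gam_word K)"
    unfolding gam_word_simps mult.assoc by (intro eqv_left Cons)
  also have "\<dots> = (\<Sum>K\<in>words ?n. gam i * cx ?n (J @ [j]) K * gam_word K)"
    by (simp add: sum_distrib_left mult.assoc)
  also have "\<dots> \<doteq> (\<Sum>K\<in>words ?n. (\<Sum>k\<in>UNIV. cx (Suc ?n) (i # J @ [j]) (k # K) * gam k) * gam_word K)"
    by (intro eqv_sum eqv_right gam_cx) auto
  also have "\<dots> = (\<Sum>K\<in>words (Suc ?n). cx (Suc ?n) (i # J @ [j]) K * gam_word K)"
    by (simp add: sum_words_Suc sum_distrib_right gam_word_simps mult.assoc sum.swap[of _ UNIV])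
  finally show ?case by simp
qed (simp add: gam_word_simps cx_0)

end

section \<open>Commutators of the ghost part of the BRST operator\<close>

text \<open>The index of \<Omega> occupies the last upper strand, which the antisymmetrizers do not
  touch, so an operator identity on one more strand can be read with that index fixed.\<close>

lemma (in quantum_lie) sandwich_last:
  assumes "alt s 0 p * op 0 p (Suc t) T * alt s 0 t = 0" "length I = p" "length J = t"
  shows "(antisymmetrizer \<sigma> p \<odot>\<^bsub>p\<^esub> (\<lambda>I S. T I (S @ [k])) \<odot>\<^bsub>t\<^esub> antisymmetrizer \<sigma> t) I J = 0"
proof -
  let ?A = "antisymmetrizer \<sigma>"
  have "op 0 (Suc t) (Suc t) (emb 0 t t (?A t)) = alt s 0 t"
    using op_emb[of 0 0 t 1 t "?A t"] by (simp add: op_antisymmetrizer)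
  then have "op 0 p (Suc t) (?A p \<odot>\<^bsub>p\<^esub> T \<odot>\<^bsub>Suc t\<^esub> emb 0 t t (?A t)) = op 0 p (Suc t) (\<lambda>I J. 0)"
    using assms(1) by (simp only: op_mult[symmetric] op_antisymmetrizer op_linear)
  from op_inject[OF this, of I "J @ [k]"]
  have "(?A p \<odot>\<^bsub>p\<^esub> T \<odot>\<^bsub>Suc t\<^esub> emb 0 t t (?A t)) I (J @ [k]) = 0" using assms(2,3) by simp
  also have "(?A p \<odot>\<^bsub>p\<^esub> T \<odot>\<^bsub>Suc t\<^esub> emb 0 t t (?A t)) I (J @ [k]) =
      (\<Sum>K\<in>words t. (?A p \<odot>\<^bsub>p\<^esub> T) I (K @ [k]) * ?A t K J)"
    by (subst tmul_emb_0[where k = 1]) (use assms(3) in simp_all)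
  finally show ?thesis by (simp only: tmul_def)
qed

lemma (in quantum_lie) sandwich_row:
  assumes "alt s 0 p * op 0 (Suc p) t T * alt s 0 t = 0" "length I = p" "length J = t"
  shows "(antisymmetrizer \<sigma> p \<odot>\<^bsub>p\<^esub> (\<lambda>I S. T (I @ [j]) S) \<odot>\<^bsub>t\<^esub> antisymmetrizer \<sigma> t) I J = 0"
proof -
  let ?A = "antisymmetrizer \<sigma>"
  have "op 0 (Suc p) (Suc p) (emb 0 p p (?A p)) = alt s 0 p"
    using op_emb[of 0 0 p 1 p "?A p"] by (simp add: op_antisymmetrizer)
  then have "op 0 (Suc p) t (emb 0 p p (?A p) \<odot>\<^bsub>Suc p\<^esub> (T \<odot>\<^bsub>t\<^esub> ?A t)) = op 0 (Suc p) t (\<lambda>I J. 0)"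
    using assms(1) by (simp only: op_mult[symmetric] op_antisymmetrizer op_linear mult.assoc)
  from op_inject[OF this, of "I @ [j]" J]
  have "(emb 0 p p (?A p) \<odot>\<^bsub>Suc p\<^esub> (T \<odot>\<^bsub>t\<^esub> ?A t)) (I @ [j]) J = 0" using assms(2,3) by simp
  also have "(emb 0 p p (?A p) \<odot>\<^bsub>Suc p\<^esub> (T \<odot>\<^bsub>t\<^esub> ?A t)) (I @ [j]) J =
      (\<Sum>K\<in>words p. ?A p I K * (T \<odot>\<^bsub>t\<^esub> ?A t) (K @ [j]) J)"
    using emb_tmul[of "[]" 0 I p "[j]" 1 "Suc p" p "?A p" "T \<odot>\<^bsub>t\<^esub> ?A t" J] assms(2) by simp
  finally show ?thesis unfolding tmul_assoc by (simp only: tmul_def)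
qed

text \<open>Here the incoming index of \<chi> is the last lower strand and its outgoing index the
  first upper strand; the antisymmetrizer of the \<gamma> is therefore shifted by one.\<close>

lemma (in quantum_lie) sandwich_row_front:
  assumes "alt s 0 p * op 0 (Suc p) (Suc t) T * alt s 1 t = 0" "length I = p" "length J = t"
  shows "(antisymmetrizer \<sigma> p \<odot>\<^bsub>p\<^esub> (\<lambda>I S. T (I @ [j]) (x # S)) \<odot>\<^bsub>t\<^esub> antisymmetrizer \<sigma> t) I J = 0"
proof -
  let ?A = "antisymmetrizer \<sigma>"
  have 1: "op 0 (Suc p) (Suc p) (emb 0 p p (?A p)) = alt s 0 p"
    using op_emb[of 0 0 p 1 p "?A p"] by (simp add: op_antisymmetrizer)
  have 2: "op 0 (Suc t) (Suc t) (emb 1 t t (?A t)) = alt s 1 t"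
    using op_emb[of 0 1 t 0 t "?A t"] by (simp add: op_antisymmetrizer)
  have "op 0 (Suc p) (Suc t) (emb 0 p p (?A p) \<odot>\<^bsub>Suc p\<^esub> (T \<odot>\<^bsub>Suc t\<^esub> emb 1 t t (?A t))) = op 0 (Suc p) (Suc t) (\<lambda>I J. 0)"
    using assms(1) by (simp only: op_mult[symmetric] 1 2 op_linear mult.assoc)
  from op_inject[OF this, of "I @ [j]" "x # J"]
  have "(emb 0 p p (?A p) \<odot>\<^bsub>Suc p\<^esub> (T \<odot>\<^bsub>Suc t\<^esub> emb 1 t t (?A t))) (I @ [j]) (x # J) = 0" using assms(2,3) by simp
  also have "(emb 0 p p (?A p) \<odot>\<^bsub>Suc p\<^esub> (T \<odot>\<^bsub>Suc t\<^esub> emb 1 t t (?A t))) (I @ [j]) (x # J) =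
      (\<Sum>K\<in>words p. ?A p I K * (T \<odot>\<^bsub>Suc t\<^esub> emb 1 t t (?A t)) (K @ [j]) (x # J))"
    using emb_tmul[of "[]" 0 I p "[j]" 1 "Suc p" p "?A p" "T \<odot>\<^bsub>Suc t\<^esub> emb 1 t t (?A t)" "x # J"] assms(2) by simp
  finally have *: "\<dots> = 0" .
  have e: "(T \<odot>\<^bsub>Suc t\<^esub> emb 1 t t (?A t)) (K @ [j]) (x # J) = (\<Sum>S\<in>words t. T (K @ [j]) (x # S) * ?A t S J)" for K
    using assms(3) by (simp add: tmul_def sum_words_Suc emb_Cons if_distrib[of "\<lambda>x. _ * x"] sum_if_const cong: if_cong)
  show ?thesis using * unfolding e tmul_assoc unfolding tmul_def .
qed

context gam_omg_ideal
begin

lemma nb_omg: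
  "nb p t T 1 * omg k \<doteq> nb (Suc p) t (\<lambda>I S. (-1) ^ t * (emb 1 p t T \<odot>\<^bsub>Suc t\<^esub> invt B t) I (S @ [k])) 1
    + nb p (t - 1) (\<lambda>I S. (T \<odot>\<^bsub>t\<^esub> kap B t) I (S @ [k])) 1"
proof -
  have e: "(emb 1 p t T \<odot>\<^bsub>Suc t\<^esub> invt B t) (q # I) L = (\<Sum>J\<in>words t. T I J * invt B t (q # J) L)"
    if "length I = p" for q I L
    using emb_tmul[of "[q]" 1 I p "[]" 0 "Suc t" t T "invt B t" L] that by simp
  have "nb p t T 1 * omg k = (\<Sum>I\<in>words p. \<Sum>J\<in>words t. omg_word I * scalar (T I J) * (gam_word J * omg k))"
    by (simp add: nb_def sum_distrib_right mult.assoc)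
  also have "\<dots> \<doteq> (\<Sum>I\<in>words p. \<Sum>J\<in>words t. omg_word I * scalar (T I J) *
      ((\<Sum>S\<in>words t. ox t J (S @ [k]) * gam_word S) + (\<Sum>S\<in>words (t - 1). scalar (kap B t J (S @ [k])) * gam_word S)))"
    by (intro eqv_sum eqv_left) (use gam_word_omg in fastforce)
  also have "\<dots> = (\<Sum>I\<in>words p. \<Sum>J\<in>words t. \<Sum>S\<in>words t. omg_word I * scalar (T I J) * ox t J (S @ [k]) * gam_word S)
      + (\<Sum>I\<in>words p. \<Sum>J\<in>words t. \<Sum>S\<in>words (t - 1). omg_word I * scalar (T I J * kap B t J (S @ [k])) * gam_word S)"
    by (simp add: distrib_left sum.distrib sum_distrib_left scalar_simps(6) mult.assoc)
  also have "(\<Sum>I\<in>words p. \<Sum>J\<in>words t. \<Sum>S\<in>words (t - 1). omg_word I * scalar (T I J * kap B t J (S @ [k])) * gam_word S)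
      = nb p (t - 1) (\<lambda>I S. (T \<odot>\<^bsub>t\<^esub> kap B t) I (S @ [k])) 1"
    unfolding nb_def tmul_def scalar_sum sum_distrib_left sum_distrib_right mult_1_right
    by (intro sum.cong refl sum.swap)
  also have "(\<Sum>I\<in>words p. \<Sum>J\<in>words t. \<Sum>S\<in>words t. omg_word I * scalar (T I J) * ox t J (S @ [k]) * gam_word S) =
      nb (Suc p) t (\<lambda>I S. (-1) ^ t * (emb 1 p t T \<odot>\<^bsub>Suc t\<^esub> invt B t) I (S @ [k])) 1"
  proof -
    have "(\<Sum>J\<in>words t. omg_word I * scalar (T I J) * ox t J (S @ [k]) * gam_word S) =
        (\<Sum>q\<in>UNIV. omg_word (q # I) * scalar ((-1) ^ t * (emb 1 p t T \<odot>\<^bsub>Suc t\<^esub> invt B t) (q # I) (S @ [k])) * gam_word S)"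
      if "length I = p" for I S
    proof -
      have "(\<Sum>J\<in>words t. omg_word I * scalar (T I J) * ox t J (S @ [k]) * gam_word S) =
        (\<Sum>J\<in>words t. \<Sum>q\<in>UNIV. omg_word I * omg q * scalar ((-1) ^ t * (T I J * invt B t (q # J) (S @ [k]))) * gam_word S)"
        unfolding ox_def by (simp add: sum_distrib_left sum_distrib_right mult.assoc mult.left_commute[of _ "T _ _"]
          scalar_simps(6)[of "T _ _"] scalar_central[of "omg _"] scalar_left_commute[of "omg _"])
      also have "\<dots> = (\<Sum>q\<in>UNIV. omg_word (q # I) * scalar ((-1) ^ t * (emb 1 p t T \<odot>\<^bsub>Suc t\<^esub> invt B t) (q # I) (S @ [k])) * gam_word S)"
        unfolding e[OF that] omg_word_simps by (subst sum.swap) (simp add: sum_distrib_left sum_distrib_right scalar_sum)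
      finally show ?thesis .
    qed
    then have "(\<Sum>I\<in>words p. \<Sum>S\<in>words t. \<Sum>J\<in>words t. omg_word I * scalar (T I J) * ox t J (S @ [k]) * gam_word S) =
      (\<Sum>I\<in>words p. \<Sum>S\<in>words t. \<Sum>q\<in>UNIV. omg_word (q # I) * scalar ((-1) ^ t * (emb 1 p t T \<odot>\<^bsub>Suc t\<^esub> invt B t) (q # I) (S @ [k])) * gam_word S)"
      by simp
    also have "\<dots> = (\<Sum>q\<in>UNIV. \<Sum>I\<in>words p. \<Sum>S\<in>words t. omg_word (q # I) * scalar ((-1) ^ t * (emb 1 p t T \<odot>\<^bsub>Suc t\<^esub> invt B t) (q # I) (S @ [k])) * gam_word S)"
      by (rule trans[OF sum.cong[OF refl sum.swap] sum.swap])
    finally have *: "(\<Sum>I\<in>words p. \<Sum>S\<in>words t. \<Sum>J\<in>words t. omg_word I * scalar (T I J) * ox t J (S @ [k]) * gam_word S) = \<dots>" .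
    show ?thesis
      unfolding nb_def sum_words_Suc mult_1_right by (rule trans[OF sum.cong[OF refl sum.swap] *])
  qed
  finally show ?thesis .
qed

end

text \<open>\<open>omg_word\<close> reverses its argument, so an \<Omega> multiplied from the left
  becomes the last letter.\<close>

lemma omg_nb: "omg k * nb p t T 1 = nb (Suc p) t (\<lambda>I S. emb 0 p t T I (S @ [k])) 1"
proof -
  have "emb 0 p t T (I @ [j]) (S @ [k]) = (if j = k then T I S else 0)" if "length I = p" "length S = t" for I j S
    using that by (simp add: emb_def)
  then show ?thesis
    by (simp add: nb_def sum_words_Suc' sum_distrib_left omg_word_simps mult.assoc if_scalar scalar_simps(1)
        if_distrib[of "\<lambda>x. _ * x"] if_distrib[of "\<lambda>x. x * _"] sum_if_const sum.swap[of _ UNIV] cong: if_cong)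
qed

context chi_ideal
begin

lemma chi_nb:
  "chi j * nb p t T 1 \<doteq> (\<Sum>x\<in>UNIV. nb p t (\<lambda>K J. (tau \<sigma> p \<odot>\<^bsub>Suc p\<^esub> emb 1 p t T) (K @ [j]) (x # J)) (chi x))
    + nb p t (\<lambda>K J. (tau0 \<sigma> C p \<odot>\<^bsub>p\<^esub> T) (K @ [j]) J) 1"
proof -
  have e: "(tau \<sigma> p \<odot>\<^bsub>Suc p\<^esub> emb 1 p t T) L (x # J) = (\<Sum>I\<in>words p. tau \<sigma> p L (x # I) * T I J)" if "length J = t" for L x J
    using that by (simp add: tmul_def sum_words_Suc emb_Cons if_distrib[of "\<lambda>x. _ * x"] sum_if_const cong: if_cong)
  have "chi j * nb p t T 1 = (\<Sum>I\<in>words p. \<Sum>J\<in>words t. chi j * omg_word I * (scalar (T I J) * gam_word J))"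
    by (simp add: nb_def sum_distrib_left mult.assoc)
  also have "\<dots> \<doteq> (\<Sum>I\<in>words p. \<Sum>J\<in>words t. (\<Sum>K\<in>words p. omg_word K * cx p (K @ [j]) I) * (scalar (T I J) * gam_word J))"
    by (intro eqv_sum eqv_right) (use chi_omg_word in fastforce)
  also have "\<dots> = (\<Sum>I\<in>words p. \<Sum>J\<in>words t. \<Sum>K\<in>words p. omg_word K * cx p (K @ [j]) I * (scalar (T I J) * gam_word J))"
    by (simp only: sum_distrib_right)
  also have "\<dots> = (\<Sum>K\<in>words p. \<Sum>J\<in>words t. \<Sum>I\<in>words p. omg_word K * cx p (K @ [j]) I * (scalar (T I J) * gam_word J))"
    by (rule sum_swap_3)
  also have "\<dots> = (\<Sum>K\<in>words p. \<Sum>J\<in>words t.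
      (\<Sum>x\<in>UNIV. omg_word K * scalar ((tau \<sigma> p \<odot>\<^bsub>Suc p\<^esub> emb 1 p t T) (K @ [j]) (x # J)) * chi x * gam_word J) +
      omg_word K * scalar ((tau0 \<sigma> C p \<odot>\<^bsub>p\<^esub> T) (K @ [j]) J) * gam_word J)"
  proof (intro sum.cong refl)
    fix K J :: "'n list" assume "J \<in> words t"
    then have J: "length J = t" by simp
    have "(\<Sum>I\<in>words p. omg_word K * cx p (K @ [j]) I * (scalar (T I J) * gam_word J)) =
      (\<Sum>I\<in>words p. \<Sum>x\<in>UNIV. omg_word K * scalar (tau \<sigma> p (K @ [j]) (x # I) * T I J) * chi x * gam_word J) +
      (\<Sum>I\<in>words p. omg_word K * scalar (tau0 \<sigma> C p (K @ [j]) I * T I J) * gam_word J)"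
      unfolding cx_def by (simp add: distrib_left distrib_right sum.distrib sum_distrib_left sum_distrib_right
        scalar_simps(6) mult.assoc scalar_left_commute[of "chi _"])
    then show "(\<Sum>I\<in>words p. omg_word K * cx p (K @ [j]) I * (scalar (T I J) * gam_word J)) =
      (\<Sum>x\<in>UNIV. omg_word K * scalar ((tau \<sigma> p \<odot>\<^bsub>Suc p\<^esub> emb 1 p t T) (K @ [j]) (x # J)) * chi x * gam_word J) +
      omg_word K * scalar ((tau0 \<sigma> C p \<odot>\<^bsub>p\<^esub> T) (K @ [j]) J) * gam_word J"
      unfolding e[OF J] tmul_def[of "tau0 \<sigma> C p"] scalar_sum sum_distrib_left sum_distrib_right
      by (subst (asm) sum.swap) simp
  qed
  also have "\<dots> = (\<Sum>x\<in>UNIV. nb p t (\<lambda>K J. (tau \<sigma> p \<odot>\<^bsub>Suc p\<^esub> emb 1 p t T) (K @ [j]) (x # J)) (chi x))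
    + nb p t (\<lambda>K J. (tau0 \<sigma> C p \<odot>\<^bsub>p\<^esub> T) (K @ [j]) J) 1"
    unfolding nb_def sum.distrib by (simp add: sum.swap[of _ UNIV])
  finally show ?thesis .
qed

lemma nb_chi:
  "nb p t T 1 * chi j \<doteq> (\<Sum>x\<in>UNIV. nb p t (\<lambda>K J. (emb 0 p t T \<odot>\<^bsub>Suc t\<^esub> tau \<sigma> t) (K @ [j]) (x # J)) (chi x))
    + nb p t (\<lambda>K J. (emb 0 p t T \<odot>\<^bsub>Suc t\<^esub> tau0 \<sigma> C t) (K @ [j]) J) 1"
proof -
  have e: "(emb 0 p t T \<odot>\<^bsub>Suc t\<^esub> S) (I @ [j]) L = (\<Sum>J\<in>words t. T I J * S (J @ [j]) L)" if "length I = p" for S L I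
    using emb_tmul[of "[]" 0 I p "[j]" 1 "Suc t" t T S L] that by simp
  have "nb p t T 1 * chi j = (\<Sum>I\<in>words p. \<Sum>J\<in>words t. omg_word I * scalar (T I J) * (gam_word J * chi j))"
    by (simp add: nb_def sum_distrib_right mult.assoc)
  also have "\<dots> \<doteq> (\<Sum>I\<in>words p. \<Sum>J\<in>words t. omg_word I * scalar (T I J) * (\<Sum>K\<in>words t. cx t (J @ [j]) K * gam_word K))"
    by (intro eqv_sum eqv_left) (use gam_word_chi in fastforce)
  also have "\<dots> = (\<Sum>I\<in>words p. \<Sum>K\<in>words t. \<Sum>J\<in>words t. omg_word I * scalar (T I J) * cx t (J @ [j]) K * gam_word K)"
    by (subst (2) sum.swap) (simp add: sum_distrib_left mult.assoc)
  also have "\<dots> = (\<Sum>I\<in>words p. \<Sum>K\<in>words t.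
      (\<Sum>x\<in>UNIV. omg_word I * scalar ((emb 0 p t T \<odot>\<^bsub>Suc t\<^esub> tau \<sigma> t) (I @ [j]) (x # K)) * chi x * gam_word K) +
      omg_word I * scalar ((emb 0 p t T \<odot>\<^bsub>Suc t\<^esub> tau0 \<sigma> C t) (I @ [j]) K) * gam_word K)"
  proof (intro sum.cong refl)
    fix I K :: "'n list" assume "I \<in> words p"
    then have I: "length I = p" by simp
    have "(\<Sum>J\<in>words t. omg_word I * scalar (T I J) * cx t (J @ [j]) K * gam_word K) =
      (\<Sum>J\<in>words t. \<Sum>x\<in>UNIV. omg_word I * scalar (T I J * tau \<sigma> t (J @ [j]) (x # K)) * chi x * gam_word K) +
      (\<Sum>J\<in>words t. omg_word I * scalar (T I J * tau0 \<sigma> C t (J @ [j]) K) * gam_word K)"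
      unfolding cx_def by (simp add: distrib_left distrib_right sum.distrib sum_distrib_left sum_distrib_right
        scalar_simps(6) mult.assoc)
    then show "(\<Sum>J\<in>words t. omg_word I * scalar (T I J) * cx t (J @ [j]) K * gam_word K) =
      (\<Sum>x\<in>UNIV. omg_word I * scalar ((emb 0 p t T \<odot>\<^bsub>Suc t\<^esub> tau \<sigma> t) (I @ [j]) (x # K)) * chi x * gam_word K) +
      omg_word I * scalar ((emb 0 p t T \<odot>\<^bsub>Suc t\<^esub> tau0 \<sigma> C t) (I @ [j]) K) * gam_word K"
      unfolding e[OF I] scalar_sum sum_distrib_left sum_distrib_right
      by (subst (asm) sum.swap) simp
  qed
  also have "\<dots> = (\<Sum>x\<in>UNIV. nb p t (\<lambda>K J. (emb 0 p t T \<odot>\<^bsub>Suc t\<^esub> tau \<sigma> t) (K @ [j]) (x # J)) (chi x))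
    + nb p t (\<lambda>K J. (emb 0 p t T \<odot>\<^bsub>Suc t\<^esub> tau0 \<sigma> C t) (K @ [j]) J) 1"
    unfolding nb_def sum.distrib by (simp add: sum.swap[of _ UNIV])
  finally show ?thesis .
qed

end

lemma sum_shift_top: "h (Suc M) = 0 \<Longrightarrow> (\<Sum>r = 1..M. h r) = (\<Sum>r = 1..M. h (Suc r)) + h (1 :: nat)"
  for h :: "nat \<Rightarrow> 'b::comm_monoid_add"
  using sum.atLeast_Suc_atMost[of 1 "Suc M" h] sum.shift_bounds_cl_Suc_ivl[of h 1 M]
  by (simp add: add.commute)

lemma (in two_sided_ideal) eqv_if_sum_diff_eqv_0: "(a - b) + (a' - b') \<doteq> 0 \<Longrightarrow> a + a' \<doteq> b + b'"
  by (simp add: eqv_def algebra_simps)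

text \<open>
  \<open>Y\<close> is the family \<open>X\<close> of the statement, continued by zero beyond the height, for which the
  recurrence then holds in all degrees.
\<close>

locale brst_ideal = quantum_lie \<sigma> C + wedge_ideal \<I> \<sigma> + gam_omg_ideal \<I> \<sigma>
  for \<sigma> :: "'n::finite braiding" and C :: "'n struct_consts" and \<I> :: "'n generator free_alg set" +
  fixes Y :: "nat \<Rightarrow> 'n tensor" and M :: nat
  assumes Y_w: "alt s a (Suc (Suc r)) * op a (Suc (Suc r)) (Suc r) (Y (Suc r)) * alt s a (Suc r) = w a (Suc r)"
    and Y_zero: "M < r \<Longrightarrow> Y r I J = 0"
begin

definition Qg :: "'n generator free_alg" where
  "Qg = (\<Sum>r = 1..M. nb (Suc r) r (Y r) 1)"

text \<open>The differential of \<open>\<Omega>^k\<close> as in a Chevalley-Eilenberg complex, with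
  coefficients determined by the structure constants through the initial condition.\<close>

definition om2 :: "'n \<Rightarrow> 'n generator free_alg" where
  "om2 k = (\<Sum>I\<in>words 2. omg_word I * scalar (Y 1 I [k]))"

lemma Qg_omg_coefficient:
  assumes "1 \<le> r"
  shows "nb (Suc (Suc r)) r (\<lambda>I S. emb 0 (Suc r) r (Y r) I (S @ [k])
      + (-1) ^ r * (emb 1 (Suc r) r (Y r) \<odot>\<^bsub>Suc r\<^esub> invt B r) I (S @ [k])
      + (Y (Suc r) \<odot>\<^bsub>Suc r\<^esub> kap B (Suc r)) I (S @ [k])) 1 \<doteq> 0"
proof -
  obtain q where r: "r = Suc q" using assms by (cases r) auto
  let ?T = "\<lambda>I J. emb 0 (Suc r) r (Y r) I J + (-1) ^ r * (emb 1 (Suc r) r (Y r) \<odot>\<^bsub>Suc r\<^esub> invt B r) I J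
      + (Y (Suc r) \<odot>\<^bsub>Suc r\<^esub> kap B (Suc r)) I J"
  have e0: "op a (Suc (Suc r)) (Suc r) (emb 0 (Suc r) r (Y r)) = op a (Suc r) r (Y r)" for a
    using op_emb[of a 0 "Suc r" 1 r "Y r"] by simp
  have e1: "op a (Suc (Suc r)) (Suc r) (emb 1 (Suc r) r (Y r)) = op (Suc a) (Suc r) r (Y r)" for a
    using op_emb[of a 1 "Suc r" 0 r "Y r"] by simp
  have "op 0 (Suc (Suc r)) (Suc r) ?T = op 0 (Suc r) r (Y r) + (-1) ^ r * op (Suc 0) (Suc r) r (Y r) * up si 0 r
      + op 0 (Suc (Suc r)) (Suc r) (Y (Suc r)) * z1 si 0 (Suc r)"
    by (simp only: op_linear op_minus_one_power op_mult[symmetric] e0 e1 op_invt op_kap mult.assoc)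
  then have "alt s 0 (Suc (Suc r)) * op 0 (Suc (Suc r)) (Suc r) ?T * alt s 0 r = 0"
    using omega_commutator_coefficient[of 0 q "op 0 (Suc r) r (Y r)" "op (Suc 0) (Suc r) r (Y r)" "op 0 (Suc (Suc r)) (Suc r) (Y (Suc r))"]
      Y_w[of 0 q] Y_w[of "Suc 0" q] Y_w[of 0 "Suc q"] unfolding r by (simp only: simp_thms)
  from nb_eqv_0[OF sandwich_last[OF this], of k 1] show ?thesis by simp
qed

lemma Qg_omg: "Qg * omg k + omg k * Qg \<doteq> om2 k"
proof -
  let ?f = "\<lambda>r. nb (Suc (Suc r)) r (\<lambda>I S. emb 0 (Suc r) r (Y r) I (S @ [k])) 1"
  let ?g = "\<lambda>r. nb (Suc (Suc r)) r (\<lambda>I S. (-1) ^ r * (emb 1 (Suc r) r (Y r) \<odot>\<^bsub>Suc r\<^esub> invt B r) I (S @ [k])) 1"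
  let ?h = "\<lambda>r. nb (Suc r) (r - 1) (\<lambda>I S. (Y r \<odot>\<^bsub>r\<^esub> kap B r) I (S @ [k])) 1"
  have "Qg * omg k + omg k * Qg \<doteq> (\<Sum>r = 1..M. ?g r + ?h r) + (\<Sum>r = 1..M. ?f r)"
    unfolding Qg_def sum_distrib_left sum_distrib_right by (intro eqv_add eqv_sum nb_omg) (simp add: omg_nb)
  \<comment> \<open>A contraction in degree r + 1 leaves as many \<Omega> and \<gamma> as
    multiplication by \<Omega> in degree r, hence the shift of index. The contraction in degree M +
    1 vanishes; the one in degree 1 remains and contains no \<gamma>.\<close>
  also have "\<dots> = (\<Sum>r = 1..M. ?f r + ?g r + ?h (Suc r)) + ?h 1"
  proof -
    have "?h (Suc M) = 0" using Y_zero[of "Suc M"] by (simp add: nb_def tmul_def scalar_simps)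
    then have "(\<Sum>r = 1..M. ?h r) = (\<Sum>r = 1..M. ?h (Suc r)) + ?h 1" by (rule sum_shift_top)
    then show ?thesis by (simp add: sum.distrib)
  qed
  also have "\<dots> = (\<Sum>r = 1..M. nb (Suc (Suc r)) r (\<lambda>I S. emb 0 (Suc r) r (Y r) I (S @ [k])
      + (-1) ^ r * (emb 1 (Suc r) r (Y r) \<odot>\<^bsub>Suc r\<^esub> invt B r) I (S @ [k])
      + (Y (Suc r) \<odot>\<^bsub>Suc r\<^esub> kap B (Suc r)) I (S @ [k])) 1) + ?h 1"
    by (simp only: nb_add diff_Suc_1)
  also have "\<dots> \<doteq> (\<Sum>r = 1..M. 0) + ?h 1"
    by (intro eqv_add eqv_sum Qg_omg_coefficient eqv_refl) simp
  also have "(\<Sum>r = 1..M. 0) + ?h 1 = om2 k"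
  proof -
    have "kap B (Suc 0) J [k] = idt J [k]" if "length J = Suc 0" for J
      using that by (simp add: emb_def)
    then have "(Y 1 \<odot>\<^bsub>1\<^esub> kap B 1) I [k] = Y 1 I [k]" if "length I = 2" for I
      by (simp add: tmul_def idt_def if_distrib[of "\<lambda>x. _ * x"] sum_words_delta del: kap.simps cong: if_cong sum.cong_simp)
    then show ?thesis by (simp add: om2_def nb_def gam_word_simps numeral_2_eq_2)
  qed
  finally show ?thesis .
qed

text \<open>By \<open>Qg_omg\<close> the graded commutator with \<open>Qg\<close> is an odd
  derivation on the \<Omega> sending \<open>\<Omega>^k\<close> to \<open>om2 k\<close>. The claim is
  that it squares to zero on generators, which after antisymmetrization is
  \<open>maurer_cartan_closed\<close>.\<close>

lemma Qg_om2: "Qg * om2 k \<doteq> om2 k * Qg"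
proof -
  let ?x = "Y 1" and ?E = "emb 1 2 1 (Y 1)" and ?F = "emb 0 2 1 (Y 1)"
  have w1: "alt s a 2 * op a 2 1 (Y 1) = - c a" for a
    using Y_w[of a 0] by (simp add: numeral_2_eq_2)
  have om2: "om2 k = (\<Sum>i\<in>UNIV. \<Sum>j\<in>UNIV. omg j * omg i * scalar (Y 1 [i, j] [k]))" for k
    by (simp add: om2_def sum_words_2 omg_word_simps mult.assoc)
  have 1: "Qg * (omg j * omg i) - omg j * omg i * Qg \<doteq> om2 j * omg i - omg j * om2 i" for i j
  proof -
    have "Qg * (omg j * omg i) - omg j * omg i * Qg = (Qg * omg j + omg j * Qg) * omg i - omg j * (Qg * omg i + omg i * Qg)"
      by (simp add: algebra_simps)
    also have "\<dots> \<doteq> om2 j * omg i - omg j * om2 i" by (intro eqv_diff eqv_left eqv_right Qg_omg)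
    finally show ?thesis .
  qed
  have "Qg * om2 k - om2 k * Qg = (\<Sum>i\<in>UNIV. \<Sum>j\<in>UNIV. (Qg * (omg j * omg i) - omg j * omg i * Qg) * scalar (Y 1 [i, j] [k]))"
    unfolding om2[of k] by (simp add: sum_distrib_left sum_distrib_right left_diff_distrib sum_subtractf mult.assoc scalar_central[of Qg])
  also have "\<dots> \<doteq> (\<Sum>i\<in>UNIV. \<Sum>j\<in>UNIV. (om2 j * omg i - omg j * om2 i) * scalar (Y 1 [i, j] [k]))"
    by (intro eqv_sum eqv_right 1)
  also have "\<dots> = nb 3 0 (\<lambda>L S. (?E \<odot>\<^bsub>2\<^esub> Y 1) L (S @ [k]) - (?F \<odot>\<^bsub>2\<^esub> Y 1) L (S @ [k])) 1"
  proof -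
    have E: "(?E \<odot>\<^bsub>2\<^esub> Y 1) (i # I) [k] = (\<Sum>j\<in>UNIV. Y 1 I [j] * Y 1 [i, j] [k])" if "length I = 2" for i I
      using emb_tmul[of "[i]" 1 I 2 "[]" 0 2 1 "Y 1" "Y 1" "[k]"] that by (simp add: sum_words_1)
    have F: "(?F \<odot>\<^bsub>2\<^esub> Y 1) (I @ [j]) [k] = (\<Sum>i\<in>UNIV. Y 1 I [i] * Y 1 [i, j] [k])" if "length I = 2" for j I
      using emb_tmul[of "[]" 0 I 2 "[j]" 1 2 1 "Y 1" "Y 1" "[k]"] that by (simp add: sum_words_1)
    have "nb 3 0 (\<lambda>L S. (?E \<odot>\<^bsub>2\<^esub> Y 1) L (S @ [k])) 1 = (\<Sum>i\<in>UNIV. \<Sum>I\<in>words 2. omg_word (i # I) * scalar ((?E \<odot>\<^bsub>2\<^esub> Y 1) (i # I) [k]))"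
      using sum_words_Suc[where n = 2 and f = "\<lambda>L. omg_word L * scalar ((?E \<odot>\<^bsub>2\<^esub> Y 1) L [k])"] by (simp add: nb_def gam_word_simps)
    also have "\<dots> = (\<Sum>i\<in>UNIV. \<Sum>I\<in>words 2. \<Sum>j\<in>UNIV. omg_word I * scalar (Y 1 I [j]) * omg i * scalar (Y 1 [i, j] [k]))"
    proof (intro sum.cong refl)
      fix i and I :: "'n list" assume "I \<in> words 2"
      then have I: "length I = 2" by simp
      show "omg_word (i # I) * scalar ((?E \<odot>\<^bsub>2\<^esub> Y 1) (i # I) [k]) =
          (\<Sum>j\<in>UNIV. omg_word I * scalar (Y 1 I [j]) * omg i * scalar (Y 1 [i, j] [k]))"
        unfolding E[OF I] scalar_sum scalar_simps(6) omg_word_simps sum_distrib_left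
        by (simp add: mult.assoc scalar_left_commute[of "omg _"])
    qed
    also have "\<dots> = (\<Sum>i\<in>UNIV. \<Sum>j\<in>UNIV. om2 j * omg i * scalar (Y 1 [i, j] [k]))"
      unfolding om2_def sum_distrib_right by (intro sum.cong refl sum.swap)
    finally have e: "nb 3 0 (\<lambda>L S. (?E \<odot>\<^bsub>2\<^esub> Y 1) L (S @ [k])) 1 = \<dots>" .
    have "nb 3 0 (\<lambda>L S. (?F \<odot>\<^bsub>2\<^esub> Y 1) L (S @ [k])) 1 = (\<Sum>I\<in>words 2. \<Sum>j\<in>UNIV. omg_word (I @ [j]) * scalar ((?F \<odot>\<^bsub>2\<^esub> Y 1) (I @ [j]) [k]))"
      using sum_words_Suc'[where n = 2 and f = "\<lambda>L. omg_word L * scalar ((?F \<odot>\<^bsub>2\<^esub> Y 1) L [k])"] by (simp add: nb_def gam_word_simps)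
    also have "\<dots> = (\<Sum>I\<in>words 2. \<Sum>j\<in>UNIV. \<Sum>i\<in>UNIV. omg j * (omg_word I * scalar (Y 1 I [i])) * scalar (Y 1 [i, j] [k]))"
    proof (intro sum.cong refl)
      fix j and I :: "'n list" assume "I \<in> words 2"
      then have I: "length I = 2" by simp
      show "omg_word (I @ [j]) * scalar ((?F \<odot>\<^bsub>2\<^esub> Y 1) (I @ [j]) [k]) =
          (\<Sum>i\<in>UNIV. omg j * (omg_word I * scalar (Y 1 I [i])) * scalar (Y 1 [i, j] [k]))"
        unfolding F[OF I] scalar_sum scalar_simps(6) omg_word_simps sum_distrib_left
        by (simp add: mult.assoc)
    qed
    also have "\<dots> = (\<Sum>i\<in>UNIV. \<Sum>j\<in>UNIV. omg j * om2 i * scalar (Y 1 [i, j] [k]))"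
      unfolding om2_def sum_distrib_left sum_distrib_right by (rule sum_swap_3)
    finally show ?thesis unfolding nb_diff e by (simp add: left_diff_distrib sum_subtractf)
  qed
  also have "\<dots> \<doteq> 0"
  proof (rule nb_eqv_0)
    fix I J :: "'n list"
    assume IJ: "length I = 3" "length J = 0"
    let ?T = "\<lambda>L J. (?E \<odot>\<^bsub>2\<^esub> Y 1) L J - (?F \<odot>\<^bsub>2\<^esub> Y 1) L J"
    have "op 0 3 2 ?E = op 1 2 1 (Y 1)" "op 0 3 2 ?F = op 0 2 1 (Y 1)"
      using op_emb[of 0 1 2 0 1 "Y 1"] op_emb[of 0 0 2 1 1 "Y 1"] by (simp_all add: numeral_3_eq_3 numeral_2_eq_2)
    then have "op 0 3 1 ?T = (op 1 2 1 (Y 1) - op 0 2 1 (Y 1)) * op 0 2 1 (Y 1)"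
      by (simp only: op_linear op_mult[symmetric] left_diff_distrib)
    then have "alt s 0 3 * op 0 3 (Suc 0) ?T * alt s 0 0 = 0"
      using maurer_cartan_closed[OF w1 w1[of "Suc 0"]] by (simp add: mult.assoc)
    from sandwich_last[OF this IJ] show "(antisymmetrizer \<sigma> 3 \<odot>\<^bsub>3\<^esub> (\<lambda>L S. (?E \<odot>\<^bsub>2\<^esub> Y 1) L (S @ [k]) - (?F \<odot>\<^bsub>2\<^esub> Y 1) L (S @ [k]))
        \<odot>\<^bsub>0\<^esub> antisymmetrizer \<sigma> 0) I J = 0" .
  qed
  finally show ?thesis by (rule eqv_if_diff_eqv_0)
qed

lemma Qg_square_omg: "Qg * Qg * omg k \<doteq> omg k * (Qg * Qg)"
proof -
  have "Qg * omg k \<doteq> om2 k - omg k * Qg"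
    using eqv_diff[OF Qg_omg eqv_refl, of k "omg k * Qg"] by simp
  note * = this
  have "Qg * Qg * omg k \<doteq> Qg * (om2 k - omg k * Qg)" unfolding mult.assoc by (intro eqv_left *)
  also have "\<dots> = Qg * om2 k - Qg * omg k * Qg" by (simp add: algebra_simps)
  also have "\<dots> \<doteq> om2 k * Qg - (om2 k - omg k * Qg) * Qg" by (intro eqv_diff eqv_right * Qg_om2)
  also have "\<dots> = omg k * (Qg * Qg)" by (simp add: algebra_simps)
  finally show ?thesis .
qed

lemma Qg_square_omg_word: "Qg * Qg * omg_word K \<doteq> omg_word K * (Qg * Qg)"
proof (induction K)
  case (Cons k K)
  have "Qg * Qg * omg_word (k # K) \<doteq> omg_word K * (Qg * Qg) * omg k"
    unfolding omg_word_simps mult.assoc[of _ "omg_word K", symmetric] by (intro eqv_right Cons)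
  also have "\<dots> \<doteq> omg_word K * (omg k * (Qg * Qg))"
    unfolding mult.assoc[of "omg_word K"] by (intro eqv_left Qg_square_omg)
  finally show ?case by (simp add: omg_word_simps mult.assoc)
qed (simp add: omg_word_simps)

end

text \<open>The relations involving \<chi> are kept apart, so that the results on \<open>Qg\<close>
  alone also apply modulo the annihilator of the Fock quotient.\<close>

locale brst_full_ideal = brst_ideal \<sigma> C \<I> Y M + chi_ideal \<I> \<sigma> C
  for \<sigma> :: "'n::finite braiding" and C :: "'n struct_consts" and \<I> :: "'n generator free_alg set"
    and Y :: "nat \<Rightarrow> 'n tensor" and M :: nat +
  assumes chi_mem: "chi_rels \<sigma> C \<subseteq> \<I>"
begin

lemma chi_Qg: "chi j * Qg \<doteq> Qg * chi j"
proof -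
  have "chi j * nb (Suc r) r (Y r) 1 \<doteq> nb (Suc r) r (Y r) 1 * chi j" if rM: "r \<in> {1..M}" for r
  proof -
    obtain q where r: "r = Suc q" using rM by (cases r) auto
    let ?y = "Y r" and ?p = "Suc r"
    \<comment> \<open>\<open>?T\<close> compares the terms in which a \<chi> survives,
      \<open>?S\<close> those in which it has been absorbed; they cancel separately.\<close>
    let ?T = "\<lambda>I J. (tau \<sigma> ?p \<odot>\<^bsub>Suc ?p\<^esub> emb 1 ?p r ?y) I J - (emb 0 ?p r ?y \<odot>\<^bsub>Suc r\<^esub> tau \<sigma> r) I J"
    let ?S = "\<lambda>I J. (tau0 \<sigma> C ?p \<odot>\<^bsub>?p\<^esub> ?y) I J - (emb 0 ?p r ?y \<odot>\<^bsub>Suc r\<^esub> tau0 \<sigma> C r) I J"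
    have e0: "op 0 (Suc ?p) (Suc r) (emb 0 ?p r ?y) = op 0 ?p r ?y"
      using op_emb[of 0 0 ?p 1 r ?y] by simp
    have e1: "op 0 (Suc ?p) (Suc r) (emb 1 ?p r ?y) = op (Suc 0) ?p r ?y"
      using op_emb[of 0 1 ?p 0 r ?y] by simp
    note coef = chi_commutator_coefficients[OF Y_w[of 0 q] Y_w[of "Suc 0" q], folded r]
    have "op 0 (Suc ?p) (Suc r) ?T = dn s 0 ?p * op (Suc 0) ?p r ?y - op 0 ?p r ?y * dn s 0 r"
      by (simp only: op_linear op_mult[symmetric] e0 e1 op_tau)
    then have T: "alt s 0 ?p * op 0 (Suc ?p) (Suc r) ?T * alt s 1 r = 0"
      using coef(1) by (simp only: One_nat_def)
    have "op 0 (Suc ?p) r ?S = t0 0 ?p * op 0 ?p r ?y - op 0 ?p r ?y * t0 0 r"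
      by (simp only: op_linear op_mult[symmetric] e0 op_tau0)
    then have S: "alt s 0 ?p * op 0 (Suc ?p) r ?S * alt s 0 r = 0"
      using coef(2) by simp
    have "(\<Sum>x\<in>UNIV. nb ?p r (\<lambda>K J. ?T (K @ [j]) (x # J)) (chi x)) + nb ?p r (\<lambda>K J. ?S (K @ [j]) J) 1 \<doteq> (\<Sum>x\<in>(UNIV :: 'n set). 0) + 0"
      by (rule eqv_add[OF eqv_sum[OF nb_eqv_0[OF sandwich_row_front[OF T]]] nb_eqv_0[OF sandwich_row[OF S]]])
    then have "((\<Sum>x\<in>UNIV. nb ?p r (\<lambda>K J. (tau \<sigma> ?p \<odot>\<^bsub>Suc ?p\<^esub> emb 1 ?p r ?y) (K @ [j]) (x # J)) (chi x))
        + nb ?p r (\<lambda>K J. (tau0 \<sigma> C ?p \<odot>\<^bsub>?p\<^esub> ?y) (K @ [j]) J) 1) \<doteq>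
      ((\<Sum>x\<in>UNIV. nb ?p r (\<lambda>K J. (emb 0 ?p r ?y \<odot>\<^bsub>Suc r\<^esub> tau \<sigma> r) (K @ [j]) (x # J)) (chi x))
        + nb ?p r (\<lambda>K J. (emb 0 ?p r ?y \<odot>\<^bsub>Suc r\<^esub> tau0 \<sigma> C r) (K @ [j]) J) 1)"
      unfolding nb_diff sum_subtractf by (intro eqv_if_sum_diff_eqv_0) simp
    from eqv_trans[OF eqv_trans[OF chi_nb this] eqv_sym[OF nb_chi]] show ?thesis .
  qed
  then show ?thesis unfolding Qg_def sum_distrib_left sum_distrib_right by (rule eqv_sum)
qed

lemma chi_chi: "chi i * chi j \<doteq> (\<Sum>m\<in>UNIV. \<Sum>k\<in>UNIV. scalar (\<sigma> $ (i, j) $ (m, k)) * chi m * chi k) + (\<Sum>k\<in>UNIV. scalar (C $ (i, j) $ k) * chi k)"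
  unfolding eqv_def using chi_mem unfolding chi_rels_def by (fastforce simp: diff_diff_eq)

section \<open>The term linear in \<chi> and the cancellation of the quadratic terms\<close>

definition Q0 :: "'n generator free_alg" where
  "Q0 = (\<Sum>i\<in>UNIV. omg i * chi i)"

text \<open>Moving \<chi> past \<Omega> produces exactly the right side of the defining relation of
  the \<chi>, which can be read backwards as a plain product of two \<chi>.\<close>

lemma Q0_square: "Q0 * Q0 \<doteq> (\<Sum>p\<in>UNIV. \<Sum>i\<in>UNIV. omg i * omg p * (chi p * chi i))"
proof -
  have "Q0 * Q0 = (\<Sum>i\<in>UNIV. \<Sum>j\<in>UNIV. omg i * (chi i * omg j) * chi j)"
    by (simp add: Q0_def sum_product mult.assoc)
  also have "\<dots> \<doteq> (\<Sum>i\<in>UNIV. \<Sum>j\<in>UNIV. omg i * (\<Sum>p\<in>UNIV. omg p * ((\<Sum>x\<in>UNIV. scalar (\<sigma> $ (p, i) $ (x, j)) * chi x) + scalar (C $ (p, i) $ j))) * chi j)"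
    by (intro eqv_sum eqv_right eqv_left chi_omg)
  also have "\<dots> = (\<Sum>i\<in>UNIV. \<Sum>j\<in>UNIV. \<Sum>p\<in>UNIV. omg i * omg p * ((\<Sum>x\<in>UNIV. scalar (\<sigma> $ (p, i) $ (x, j)) * chi x * chi j) + scalar (C $ (p, i) $ j) * chi j))"
    by (simp add: sum_distrib_left sum_distrib_right distrib_left distrib_right mult.assoc)
  also have "\<dots> = (\<Sum>p\<in>UNIV. \<Sum>i\<in>UNIV. \<Sum>j\<in>UNIV. omg i * omg p * ((\<Sum>x\<in>UNIV. scalar (\<sigma> $ (p, i) $ (x, j)) * chi x * chi j) + scalar (C $ (p, i) $ j) * chi j))"
    by (rule trans[OF sum.cong[OF refl sum.swap] sum.swap])
  also have "\<dots> = (\<Sum>p\<in>UNIV. \<Sum>i\<in>UNIV. omg i * omg p * ((\<Sum>x\<in>UNIV. \<Sum>j\<in>UNIV. scalar (\<sigma> $ (p, i) $ (x, j)) * chi x * chi j) + (\<Sum>j\<in>UNIV. scalar (C $ (p, i) $ j) * chi j)))"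
  proof (intro sum.cong refl)
    fix p i
    show "(\<Sum>j\<in>UNIV. omg i * omg p * ((\<Sum>x\<in>UNIV. scalar (\<sigma> $ (p, i) $ (x, j)) * chi x * chi j) + scalar (C $ (p, i) $ j) * chi j)) =
      omg i * omg p * ((\<Sum>x\<in>UNIV. \<Sum>j\<in>UNIV. scalar (\<sigma> $ (p, i) $ (x, j)) * chi x * chi j) + (\<Sum>j\<in>UNIV. scalar (C $ (p, i) $ j) * chi j))"
      by (subst sum.swap) (simp only: sum_distrib_left distrib_left sum.distrib)
  qed
  also have "\<dots> \<doteq> (\<Sum>p\<in>UNIV. \<Sum>i\<in>UNIV. omg i * omg p * (chi p * chi i))"
    by (intro eqv_sum eqv_left eqv_sym[OF chi_chi])
  finally show ?thesis .
qed

text \<open>Applying \<open>1 - \<sigma>\<close> to the product of two \<chi> gives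
  \<open>C \<chi>\<close>, and the initial condition makes the antisymmetrizer of the remaining
  coefficient equal to \<open>- C\<close>. The sum of the coefficients is thus killed by the
  antisymmetrizer and vanishes next to the \<Omega>.\<close>

lemma quadratic_cancellation:
  "(\<Sum>p\<in>UNIV. \<Sum>i\<in>UNIV. omg i * omg p * (chi p * chi i)) + (\<Sum>i\<in>UNIV. om2 i * chi i) \<doteq> 0"
proof -
  let ?f = "\<lambda>J. chi (J ! 0) * chi (J ! 1) + (\<Sum>k\<in>UNIV. scalar (Y 1 J [k]) * chi k)"
  let ?A = "antisymmetrizer \<sigma> 2"
  have "op 0 2 1 (?A \<odot>\<^bsub>2\<^esub> Y 1) = op 0 2 1 (\<lambda>I J. - c_tensor C I J)"
    using Y_w[of 0 0] by (simp add: op_linear(3) op_antisymmetrizer cop_def numeral_2_eq_2 del: antisymmetrizer.simps flip: op_mult)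
  note op_inject[OF this]
  then have AY: "(\<Sum>J\<in>words 2. ?A [i, j] J * Y 1 J [k]) = - C $ (i, j) $ k" for i j k
    by (simp add: tmul_def del: antisymmetrizer.simps)
  have "op 0 2 2 ?A = op 0 2 2 (\<lambda>I J. idt I J - mat_tensor \<sigma> I J)"
    by (simp add: op_linear op_idt op_antisymmetrizer sop_def numeral_2_eq_2 del: antisymmetrizer.simps)
  note op_inject[OF this]
  then have A: "?A [i, j] [m, k] = (if i = m \<and> j = k then 1 else 0) - \<sigma> $ (i, j) $ (m, k)" for i j m k
    by (simp add: idt_def del: antisymmetrizer.simps)
  have *: "(\<Sum>J\<in>words 2. scalar (?A [i, j] J) * ?f J) \<doteq> 0" for i j
  proof -
    have "(\<Sum>J\<in>words 2. scalar (?A [i, j] J) * ?f J) =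
      (\<Sum>J\<in>words 2. scalar (?A [i, j] J) * (chi (J ! 0) * chi (J ! 1))) +
      (\<Sum>k\<in>UNIV. scalar (\<Sum>J\<in>words 2. ?A [i, j] J * Y 1 J [k]) * chi k)"
    proof -
      have "(\<Sum>J\<in>words 2. scalar (?A [i, j] J) * (\<Sum>k\<in>UNIV. scalar (Y 1 J [k]) * chi k)) =
        (\<Sum>k\<in>UNIV. scalar (\<Sum>J\<in>words 2. ?A [i, j] J * Y 1 J [k]) * chi k)"
        unfolding scalar_sum scalar_simps(6) sum_distrib_left sum_distrib_right mult.assoc by (rule sum.swap)
      then show ?thesis by (simp only: distrib_left sum.distrib)
    qed
    also have "(\<Sum>J\<in>words 2. scalar (?A [i, j] J) * (chi (J ! 0) * chi (J ! 1))) =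
      chi i * chi j - (\<Sum>m\<in>UNIV. \<Sum>k\<in>UNIV. scalar (\<sigma> $ (i, j) $ (m, k)) * chi m * chi k)"
    proof -
      have "(\<Sum>m\<in>UNIV. \<Sum>k\<in>UNIV. (if i = m \<and> j = k then chi m * chi k else 0)) = (\<Sum>m\<in>UNIV. if i = m then chi m * chi j else 0)"
        by (intro sum.cong refl) simp
      then show ?thesis
        by (simp add: sum_words_2 A scalar_simps(1,2,4) left_diff_distrib sum_subtractf if_scalar if_distrib[of "\<lambda>x. x * _"] mult.assoc
          del: antisymmetrizer.simps cong: if_cong)
    qed
    also have "(\<Sum>k\<in>UNIV. scalar (\<Sum>J\<in>words 2. ?A [i, j] J * Y 1 J [k]) * chi k) = - (\<Sum>k\<in>UNIV. scalar (C $ (i, j) $ k) * chi k)"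
      unfolding AY by (simp add: scalar_simps(5) sum_negf)
    also have "chi i * chi j - (\<Sum>m\<in>UNIV. \<Sum>k\<in>UNIV. scalar (\<sigma> $ (i, j) $ (m, k)) * chi m * chi k) + - (\<Sum>k\<in>UNIV. scalar (C $ (i, j) $ k) * chi k) \<doteq> 0"
      using chi_chi[of i j] by (simp add: eqv_def algebra_simps)
    finally show ?thesis .
  qed
  have "(\<Sum>J\<in>words 2. omg_word J * ?f J) \<doteq> 0"
  proof (rule omg_vec_eqv_0)
    fix I :: "'n list" assume "length I = 2"
    then obtain i j where "I = [i, j]" using length_2 by blast
    then show "(\<Sum>J\<in>words 2. scalar (?A I J) * ?f J) \<doteq> 0" using *[of i j] by (simp only:)
  qed
  also have "(\<Sum>J\<in>words 2. omg_word J * ?f J) =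
     (\<Sum>p\<in>UNIV. \<Sum>i\<in>UNIV. omg i * omg p * (chi p * chi i)) + (\<Sum>i\<in>UNIV. om2 i * chi i)"
  proof -
    have "(\<Sum>J\<in>words 2. omg_word J * (\<Sum>k\<in>UNIV. scalar (Y 1 J [k]) * chi k)) = (\<Sum>i\<in>UNIV. om2 i * chi i)"
      unfolding om2_def sum_distrib_left sum_distrib_right mult.assoc by (rule sum.swap)
    moreover have "(\<Sum>J\<in>words 2. omg_word J * (chi (J ! 0) * chi (J ! 1)) :: 'n generator free_alg) = (\<Sum>p\<in>UNIV. \<Sum>i\<in>UNIV. omg i * omg p * (chi p * chi i))"
      by (simp add: sum_words_2 omg_word_simps mult.assoc)
    ultimately show ?thesis by (simp only: distrib_left sum.distrib)
  qed
  finally show ?thesis by simp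
qed

lemma square_eqv: "(Q0 + Qg) * (Q0 + Qg) \<doteq> Qg * Qg"
proof -
  have "Qg * Q0 + Q0 * Qg \<doteq> (\<Sum>i\<in>UNIV. om2 i * chi i)"
  proof -
    have "Qg * Q0 + Q0 * Qg = (\<Sum>i\<in>UNIV. Qg * omg i * chi i + omg i * (chi i * Qg))"
      by (simp add: Q0_def sum_distrib_left sum_distrib_right sum.distrib mult.assoc)
    also have "\<dots> \<doteq> (\<Sum>i\<in>UNIV. Qg * omg i * chi i + omg i * (Qg * chi i))"
      by (intro eqv_sum eqv_add eqv_left chi_Qg eqv_refl)
    also have "\<dots> = (\<Sum>i\<in>UNIV. (Qg * omg i + omg i * Qg) * chi i)"
      by (simp add: distrib_right mult.assoc)
    also have "\<dots> \<doteq> (\<Sum>i\<in>UNIV. om2 i * chi i)" by (intro eqv_sum eqv_right Qg_omg)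
    finally show ?thesis .
  qed
  from eqv_add[OF Q0_square this]
  have "Q0 * Q0 + (Qg * Q0 + Q0 * Qg) \<doteq> 0" using quadratic_cancellation by (rule eqv_trans)
  from eqv_add[OF this eqv_refl[of "Qg * Qg"]] show ?thesis by (simp add: algebra_simps)
qed

end

section \<open>The Fock representation\<close>

text \<open>
  A vector is a function of words \<open>u\<close>, to be read as the coefficient of \<open>\<Omega>\<^sup>u\<close> with the letters
  from left to right; \<open>omg_word\<close> takes its indices in the opposite order, whence the reversals.
  Every \<open>\<chi>\<^sub>i\<close> acts as zero, so only the relations between \<open>\<gamma>\<close> and \<open>\<Omega>\<close> and the two wedge
  algebras are represented.
\<close>

type_synonym 'n fock = "'n list \<Rightarrow> complex"

fun om :: "'n \<Rightarrow> 'n fock \<Rightarrow> 'n fock" where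
  "om k v [] = 0"
| "om k v (q # u) = (if q = k then v u else 0)"

text \<open>Read off from the relation between \<gamma> and \<Omega>: at \<open>p # u\<close> either
  a leading letter j was annihilated in front of p, or the letter p arose from a letter k that
  \<gamma> was braided past, leaving a \<gamma> with index x to act on the rest.\<close>

primrec gaw :: "'n::finite braiding \<Rightarrow> 'n list \<Rightarrow> 'n \<Rightarrow> 'n fock \<Rightarrow> complex" where
  "gaw B [] = (\<lambda>j v. v [j])"
| "gaw B (p # u) = (\<lambda>j v. v (j # p # u) - (\<Sum>x\<in>UNIV. \<Sum>k\<in>UNIV. B $ (p, j) $ (x, k) * gaw B u x (\<lambda>u. v (k # u))))"

fun step :: "'n::finite braiding \<Rightarrow> 'n generator \<Rightarrow> 'n fock \<Rightarrow> 'n fock" where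
  "step B (Chi i) v = (\<lambda>u. 0)"
| "step B (Gam j) v = (\<lambda>u. gaw B u j v)"
| "step B (Omg k) v = om k v"

primrec aw :: "'n::finite braiding \<Rightarrow> 'n generator list \<Rightarrow> 'n fock \<Rightarrow> 'n fock" where
  "aw B [] v = v"
| "aw B (g # w) v = step B g (aw B w v)"

definition act :: "'n::finite braiding \<Rightarrow> 'n generator free_alg \<Rightarrow> 'n fock \<Rightarrow> 'n fock" where
  "act B x v u = (\<Sum>w\<in>Poly_Mapping.keys x. Poly_Mapping.lookup x w * aw B w v u)"

lemma om_linear: "om k (\<lambda>u. \<Sum>i\<in>A. f i * v i u) u = (\<Sum>i\<in>A. f i * om k (v i) u)"
  by (cases u) auto

lemma gaw_linear: "gaw B u j (\<lambda>u. \<Sum>i\<in>A. f i * v i u) = (\<Sum>i\<in>A. f i * gaw B u j (v i))"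
proof (induction u arbitrary: j v)
  case (Cons p u)
  have "(\<Sum>x\<in>UNIV. \<Sum>k\<in>UNIV. B $ (p, j) $ (x, k) * (\<Sum>i\<in>A. f i * gaw B u x (\<lambda>u. v i (k # u)))) =
      (\<Sum>i\<in>A. \<Sum>x\<in>UNIV. \<Sum>k\<in>UNIV. f i * (B $ (p, j) $ (x, k) * gaw B u x (\<lambda>u. v i (k # u))))"
    unfolding sum_distrib_left mult.left_commute[of _ "f _"]
    by (rule trans[OF sum.cong[OF refl sum.swap] sum.swap])
  then show ?case
    by (simp add: Cons right_diff_distrib sum_subtractf sum_distrib_left)
qed simp

lemma step_linear: "step B g (\<lambda>u. \<Sum>i\<in>A. f i * v i u) u = (\<Sum>i\<in>A. f i * step B g (v i) u)"
  by (cases g) (simp_all add: om_linear gaw_linear)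

lemma aw_linear: "aw B w (\<lambda>u. \<Sum>i\<in>A. f i * v i u) u = (\<Sum>i\<in>A. f i * aw B w (v i) u)"
proof (induction w arbitrary: u)
  case (Cons g w)
  have "aw B w (\<lambda>u. \<Sum>i\<in>A. f i * v i u) = (\<lambda>u. \<Sum>i\<in>A. f i * aw B w (v i) u)" using Cons by blast
  then show ?case by (simp add: step_linear)
qed simp

lemma aw_append: "aw B (w @ w') v = aw B w (aw B w' v)"
  by (induction w) simp_all

lemma act_single: "act B (Poly_Mapping.single w c) v u = c * aw B w v u"
  by (simp add: act_def)

lemma act_add: "act B (x + y) v u = act B x v u + act B y v u"
  unfolding act_def by (rule setsum_keys_plus_distrib) (simp_all add: distrib_right)

lemma act_zero [simp]: "act B 0 v u = 0"
  by (simp add: act_def)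

lemma act_sum: "act B (\<Sum>i\<in>A. x i) v u = (\<Sum>i\<in>A. act B (x i) v u)"
  by (induction A rule: infinite_finite_induct) (simp_all add: act_add)

lemma act_minus: "act B (- x) v u = - act B x v u"
  using act_add[of B x "- x" v u] by (simp add: minus_unique)

lemma act_diff: "act B (x - y) v u = act B x v u - act B y v u"
  using act_add[of B x "- y" v u] by (simp add: act_minus)

lemma act_linear: "act B x (\<lambda>u. \<Sum>i\<in>A. f i * v i u) u = (\<Sum>i\<in>A. f i * act B x (v i) u)"
  unfolding act_def aw_linear sum_distrib_left by (subst sum.swap) (simp add: mult.left_commute)

lemma act_mult: "act B (x * y) v = act B x (act B y v)"
proof
  fix u
  let ?x = "Poly_Mapping.lookup x" and ?y = "Poly_Mapping.lookup y"
  have "x * y = (\<Sum>w\<in>Poly_Mapping.keys x. Poly_Mapping.single w (?x w)) * (\<Sum>w\<in>Poly_Mapping.keys y. Poly_Mapping.single w (?y w))"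
    by (simp flip: free_alg_expand)
  also have "\<dots> = (\<Sum>w\<in>Poly_Mapping.keys x. \<Sum>w'\<in>Poly_Mapping.keys y. Poly_Mapping.single (w @ w') (?x w * ?y w'))"
    by (simp add: sum_product single_mult)
  finally have "act B (x * y) v u = (\<Sum>w\<in>Poly_Mapping.keys x. \<Sum>w'\<in>Poly_Mapping.keys y. ?x w * (?y w' * aw B w (aw B w' v) u))"
    by (simp add: act_sum act_single aw_append mult.assoc)
  also have "\<dots> = (\<Sum>w\<in>Poly_Mapping.keys x. ?x w * aw B w (act B y v) u)"
    unfolding act_def[of B y, abs_def] by (simp add: aw_linear sum_distrib_left)
  finally show "act B (x * y) v u = act B x (act B y v) u" by (simp add: act_def)
qed

lemma act_zero_vec: "act B x (\<lambda>u. 0) u = 0"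
  using act_linear[of B x "\<lambda>_. 0" "\<lambda>_ _. 0" "{}" u] by simp

lemma act_gen: "act B (gen g) v = step B g v" "act B (scalar c) v u = c * v u" "act B 1 v = v"
  by (auto simp: gen_def scalar_def one_eq_single act_single)

lemma gaw_zero: "gaw B u j (\<lambda>u. 0) = 0"
  using gaw_linear[of B u j "\<lambda>_. 0" "\<lambda>_ _. 0" "{}"] by simp

definition vac :: "'n fock" where "vac u = (if u = [] then 1 else 0)"

lemma gaw_vac: "gaw B u j vac = 0"
  by (cases u) (simp_all add: vac_def gaw_zero)

lemma act_gam_vac: "act B (gam j) vac u = 0"
  by (simp add: act_gen gaw_vac)

lemma act_gam_word_vac: "J \<noteq> [] \<Longrightarrow> act B (gam_word J) vac u = 0"
proof (induction J arbitrary: u rule: rev_induct)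
  case (snoc j J)
  have "act B (gam j) vac = (\<lambda>u. 0)" by (rule ext) (rule act_gam_vac)
  then show ?case by (simp add: gam_word_simps act_mult act_zero_vec del: act_gen)
qed simp

lemma act_omg_word: "act B (omg_word J) v (rev L) = (if length J \<le> length L \<and> drop (length L - length J) L = J then v (rev (take (length L - length J) L)) else 0)"
proof (induction J arbitrary: L rule: rev_induct)
  case Nil
  then show ?case by (simp add: omg_word_simps act_gen)
next
  case (snoc j J)
  show ?case
  proof (cases L rule: rev_cases)
    case Nil
    then show ?thesis by (simp add: omg_word_simps act_mult act_gen)
  next
    case (snoc K q)
    have "act B (omg_word (J @ [j])) v (rev L) = (if q = j then act B (omg_word J) v (rev K) else 0)"
      by (simp add: snoc omg_word_simps act_mult act_gen)
    also have "\<dots> = (if length (J @ [j]) \<le> length L \<and> drop (length L - length (J @ [j])) L = J @ [j]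
        then v (rev (take (length L - length (J @ [j])) L)) else 0)"
      unfolding snoc.IH by (auto simp: snoc)
    finally show ?thesis .
  qed
qed

text \<open>Annihilator of the free Fock space, before the \<Omega> are subjected to wedge
  relations. The relations between \<gamma> and \<Omega> hold there exactly, so normal ordering
  becomes an identity between actions.\<close>

definition exact_ideal :: "'n::finite braiding \<Rightarrow> 'n generator free_alg set" where
  "exact_ideal B = {x. \<forall>v u. act B x v u = 0}"

lemma exact_ideal: "gam_omg_ideal (exact_ideal (matrix_inv \<sigma>)) \<sigma>"
proof
  let ?B = "matrix_inv \<sigma>"
  show "0 \<in> exact_ideal ?B" by (simp add: exact_ideal_def)
  show "x + y \<in> exact_ideal ?B" if "x \<in> exact_ideal ?B" "y \<in> exact_ideal ?B" for x y
    using that by (simp add: exact_ideal_def act_add)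
  show "a * x \<in> exact_ideal ?B" if "x \<in> exact_ideal ?B" for a x
  proof -
    have "act ?B x v = (\<lambda>u. 0)" for v using that by (auto simp: exact_ideal_def)
    then show ?thesis by (simp add: exact_ideal_def act_mult act_zero_vec)
  qed
  show "x * a \<in> exact_ideal ?B" if "x \<in> exact_ideal ?B" for a x
    using that by (simp add: exact_ideal_def act_mult)
  show "gam_omg_rels \<sigma> \<subseteq> exact_ideal ?B"
  proof
    fix x assume "x \<in> gam_omg_rels \<sigma>"
    then obtain i j where x: "x = gam j * omg i - (- (\<Sum>p\<in>UNIV. \<Sum>s\<in>UNIV. omg p * scalar (?B $ (p,j) $ (s,i)) * gam s) + scalar (delta i j))"
      by (auto simp: gam_omg_rels_def)
    have o: "omg p * scalar b * gam s = scalar b * omg p * gam s" for p b s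
      by (simp add: scalar_central)
    have "act ?B x v u = 0" for v u
    proof (cases u)
      case Nil
      then show ?thesis
        by (simp add: x o act_diff act_add act_minus act_sum act_mult act_gen delta_def)
    next
      case (Cons q u')
      have 1: "(\<lambda>u. om i v (k # u)) = (if k = i then v else (\<lambda>u. 0))" for k by auto
      have "(\<Sum>x\<in>UNIV. \<Sum>k\<in>UNIV. ?B $ (q, j) $ (x, k) * gaw ?B u' x (\<lambda>u. om i v (k # u))) =
          (\<Sum>x\<in>UNIV. ?B $ (q, j) $ (x, i) * gaw ?B u' x v)"
      proof (rule sum.cong[OF refl])
        fix x
        have "(\<Sum>k\<in>UNIV. ?B $ (q, j) $ (x, k) * gaw ?B u' x (\<lambda>u. om i v (k # u))) =
          (\<Sum>k\<in>UNIV. if k = i then ?B $ (q, j) $ (x, k) * gaw ?B u' x v else 0)"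
          unfolding 1 by (intro sum.cong refl) (simp add: gaw_zero)
        then show "(\<Sum>k\<in>UNIV. ?B $ (q, j) $ (x, k) * gaw ?B u' x (\<lambda>u. om i v (k # u))) = ?B $ (q, j) $ (x, i) * gaw ?B u' x v"
          by simp
      qed
      moreover have "(\<Sum>p\<in>UNIV. \<Sum>x\<in>UNIV. ?B $ (p, j) $ (x, i) * (if q = p then gaw ?B u' x v else 0)) =
          (\<Sum>x\<in>UNIV. ?B $ (q, j) $ (x, i) * gaw ?B u' x v)"
        by (subst sum.swap) (simp add: if_distrib[of "\<lambda>x. _ * x"] cong: if_cong)
      ultimately show ?thesis
        by (simp add: x o act_diff act_add act_minus act_sum act_mult act_gen delta_def Cons)
    qed
    then show "x \<in> exact_ideal ?B" by (simp add: exact_ideal_def)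
  qed
qed

section \<open>The wedge relations of the \<gamma> on the free Fock space\<close>

context quantum_lie
begin

abbreviation "Bi \<equiv> matrix_inv \<sigma>"

interpretation ex: gam_omg_ideal "exact_ideal Bi" \<sigma>
  by (rule exact_ideal)

lemma act_gam_word_omg:
  "act Bi (gam_word J) (om k v) u = (\<Sum>S\<in>words (length J). act Bi (ex.ox (length J) J (S @ [k])) (act Bi (gam_word S) v) u)
    + (\<Sum>S\<in>words (length J - 1). kap Bi (length J) J (S @ [k]) * act Bi (gam_word S) v u)"
proof -
  have "gam_word J * omg k - ((\<Sum>S\<in>words (length J). ex.ox (length J) J (S @ [k]) * gam_word S)
      + (\<Sum>S\<in>words (length J - 1). scalar (kap Bi (length J) J (S @ [k])) * gam_word S)) \<in> exact_ideal Bi"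
    using ex.gam_word_omg[of J k] unfolding ex.eqv_def .
  then show ?thesis
    by (simp add: exact_ideal_def act_diff act_add act_sum act_mult act_gen)
qed

lemma act_ox:
  "act Bi (ex.ox t J L) v u = (\<Sum>p\<in>UNIV. (-1) ^ t * invt Bi t (p # J) L * om p v u)"
  unfolding ex.ox_def scalar_central[of "omg _"] by (simp add: act_sum act_mult act_gen)

lemma inv_alt_exchange:
  assumes "length J = r" "length L = r"
  shows "(\<Sum>S\<in>words r. invt Bi r (p # J) (S @ [k]) * antisymmetrizer \<sigma> r S L) =
    (\<Sum>K\<in>words r. antisymmetrizer \<sigma> r J K * invt Bi r (p # K) (L @ [k]))"
proof -
  let ?A = "antisymmetrizer \<sigma> r"
  have "op 0 (Suc r) (Suc r) (invt Bi r \<odot>\<^bsub>Suc r\<^esub> emb 0 r r ?A) = up si 0 r * alt s 0 r"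
    using op_emb[of 0 0 r 1 r ?A] by (simp add: op_invt op_antisymmetrizer flip: op_mult)
  also have "\<dots> = alt s (Suc 0) r * up si 0 r" by (rule up_si_alt)
  also have "\<dots> = op 0 (Suc r) (Suc r) (emb 1 r r ?A \<odot>\<^bsub>Suc r\<^esub> invt Bi r)"
    using op_emb[of 0 1 r 0 r ?A] by (simp add: op_invt op_antisymmetrizer flip: op_mult)
  finally have "(invt Bi r \<odot>\<^bsub>Suc r\<^esub> emb 0 r r ?A) (p # J) (L @ [k]) = (emb 1 r r ?A \<odot>\<^bsub>Suc r\<^esub> invt Bi r) (p # J) (L @ [k])"
    by (rule op_inject) (use assms in auto)
  moreover have "(invt Bi r \<odot>\<^bsub>Suc r\<^esub> emb 0 r r ?A) (p # J) (L @ [k]) = (\<Sum>S\<in>words r. invt Bi r (p # J) (S @ [k]) * ?A S L)"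
    by (subst tmul_emb_0[where k = 1]) (use assms in auto)
  moreover have "(emb 1 r r ?A \<odot>\<^bsub>Suc r\<^esub> invt Bi r) ([p] @ J @ []) (L @ [k]) = (\<Sum>K\<in>words r. ?A J K * invt Bi r ([p] @ K @ []) (L @ [k]))"
    by (rule emb_tmul) (use assms in auto)
  ultimately show ?thesis by simp
qed

lemma kap_alt_exchange:
  assumes "length J = Suc r" "length L = r"
  shows "(\<Sum>S\<in>words r. kap Bi (Suc r) J (S @ [k]) * antisymmetrizer \<sigma> r S L) =
    (-1) ^ r * (antisymmetrizer \<sigma> (Suc r) \<odot>\<^bsub>Suc r\<^esub> invt Bi r) J (L @ [k])"
proof -
  let ?A = "antisymmetrizer \<sigma> r"
  have "op 0 (Suc r) (Suc r) (kap Bi (Suc r) \<odot>\<^bsub>Suc r\<^esub> emb 0 r r ?A) = z1 si 0 (Suc r) * alt s 0 r"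
    using op_emb[of 0 0 r 1 r ?A] by (simp add: op_kap op_antisymmetrizer flip: op_mult del: kap.simps z1.simps)
  also have "\<dots> = op 0 (Suc r) (Suc r) (\<lambda>I J. (-1) ^ r * (antisymmetrizer \<sigma> (Suc r) \<odot>\<^bsub>Suc r\<^esub> invt Bi r) I J)"
    by (simp only: z1_si_alt op_minus_one_power op_mult[symmetric] op_invt op_antisymmetrizer mult.assoc)
  finally have "(kap Bi (Suc r) \<odot>\<^bsub>Suc r\<^esub> emb 0 r r ?A) J (L @ [k]) = (-1) ^ r * (antisymmetrizer \<sigma> (Suc r) \<odot>\<^bsub>Suc r\<^esub> invt Bi r) J (L @ [k])"
    by (rule op_inject) (use assms in auto)
  moreover have "(kap Bi (Suc r) \<odot>\<^bsub>Suc r\<^esub> emb 0 r r ?A) J (L @ [k]) = (\<Sum>S\<in>words r. kap Bi (Suc r) J (S @ [k]) * ?A S L)"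
    by (subst tmul_emb_0[where k = 1]) (use assms in auto)
  ultimately show ?thesis by simp
qed

lemma act_sum_gam_word:
  "act Bi (\<Sum>I\<in>A. scalar (f I) * gam_word I) v u = (\<Sum>I\<in>A. f I * act Bi (gam_word I) v u)"
  by (simp add: act_sum act_mult act_gen)

lemma fock_expand:
  fixes v :: "'n fock"
  shows "v = (\<lambda>u. (\<Sum>k\<in>UNIV. om k (\<lambda>u. v (k # u)) u) + v [] * vac u)"
proof
  fix u show "v u = (\<Sum>k\<in>UNIV. om k (\<lambda>u. v (k # u)) u) + v [] * vac u"
    by (cases u) (simp_all add: vac_def)
qed

lemma act_fock_expand: "act Bi x v u = (\<Sum>k\<in>UNIV. act Bi x (om k (\<lambda>u. v (k # u))) u) + v [] * act Bi x vac u"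
proof -
  \<comment> \<open>The option type indexes the components beginning with a letter together with the
    vacuum component, so that linearity applies to all of them at once.\<close>
  let ?f = "\<lambda>i. case i of None \<Rightarrow> v [] | Some k \<Rightarrow> 1" and ?w = "\<lambda>i. case i of None \<Rightarrow> vac | Some k \<Rightarrow> om k (\<lambda>u. v (k # u))"
  have *: "(\<Sum>i\<in>UNIV. g i) = (\<Sum>k\<in>UNIV. g (Some k)) + g None" for g :: "'n option \<Rightarrow> complex"
    by (simp add: UNIV_option_conv sum.reindex add.commute)
  have "v = (\<lambda>u. \<Sum>i\<in>UNIV. ?f i * ?w i u)"
    using fock_expand[of v] by (simp add: *)
  then have "act Bi x v u = act Bi x (\<lambda>u. \<Sum>i\<in>UNIV. ?f i * ?w i u) u" by (rule arg_cong)
  then show ?thesis unfolding act_linear by (simp add: *)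
qed

text \<open>The wedge relations of the \<gamma> hold already before dividing by those of the
  \<Omega>. On a vector beginning with \<Omega>, either that \<Omega> passes the \<gamma> and
  shortens the word \<open>u\<close>, or it removes one \<gamma>; both decrease
  \<open>r + length u\<close>, and the exchange lemmas keep the coefficients in the kernel of the
  antisymmetrizer.\<close>

lemma act_gam_rel:
  assumes "\<And>L. length L = r \<Longrightarrow> (\<Sum>J\<in>words r. f J * antisymmetrizer \<sigma> r J L) = 0"
  shows "(\<Sum>J\<in>words r. f J * act Bi (gam_word J) v u) = 0"
  using assms
proof (induction "r + length u" arbitrary: r u v f rule: less_induct)
  case less
  show ?case
  proof (cases r)
    case 0
    then show ?thesis using less.prems[of "[]"] by (simp add: idt_def)
  next
    case (Suc q)
    let ?A = "antisymmetrizer \<sigma>"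
    have vac: "act Bi (gam_word J) vac u = 0" if "length J = r" for J
      using that Suc by (intro act_gam_word_vac) auto
    have "(\<Sum>J\<in>words r. f J * act Bi (gam_word J) (om k v) u) = 0" for k v
    proof -
      \<comment> \<open>Here \<Omega> has passed all \<gamma> and consumes the first letter of
        \<open>u\<close>.\<close>
      have 1: "(\<Sum>S\<in>words r. (\<Sum>J\<in>words r. f J * invt Bi r (p # J) (S @ [k])) * act Bi (gam_word S) v u') = 0"
        if "length u' < length u" for p u'
      proof (rule less.hyps)
        fix L :: "'n list" assume L: "length L = r"
        have "(\<Sum>S\<in>words r. (\<Sum>J\<in>words r. f J * invt Bi r (p # J) (S @ [k])) * ?A r S L) =
          (\<Sum>J\<in>words r. f J * (\<Sum>S\<in>words r. invt Bi r (p # J) (S @ [k]) * ?A r S L))"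
          unfolding sum_distrib_left sum_distrib_right mult.assoc by (rule sum.swap)
        also have "\<dots> = (\<Sum>J\<in>words r. f J * (\<Sum>K\<in>words r. ?A r J K * invt Bi r (p # K) (L @ [k])))"
          using L by (intro sum.cong refl) (simp add: inv_alt_exchange)
        also have "\<dots> = (\<Sum>K\<in>words r. (\<Sum>J\<in>words r. f J * ?A r J K) * invt Bi r (p # K) (L @ [k]))"
          unfolding sum_distrib_left sum_distrib_right mult.assoc by (rule sum.swap)
        finally show "(\<Sum>S\<in>words r. (\<Sum>J\<in>words r. f J * invt Bi r (p # J) (S @ [k])) * ?A r S L) = 0"
          using less.prems by simp
      qed (use that in simp)
      \<comment> \<open>Here \<Omega> has been contracted, which leaves q = r - 1 factors
        \<gamma>.\<close>
      have 2: "(\<Sum>S\<in>words q. (\<Sum>J\<in>words r. f J * kap Bi r J (S @ [k])) * act Bi (gam_word S) v u) = 0"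
      proof (rule less.hyps)
        fix L :: "'n list" assume L: "length L = q"
        have "(\<Sum>S\<in>words q. (\<Sum>J\<in>words r. f J * kap Bi r J (S @ [k])) * ?A q S L) =
          (\<Sum>J\<in>words r. f J * (\<Sum>S\<in>words q. kap Bi r J (S @ [k]) * ?A q S L))"
          unfolding sum_distrib_left sum_distrib_right mult.assoc by (rule sum.swap)
        also have "\<dots> = (\<Sum>J\<in>words r. f J * ((-1) ^ q * (?A r \<odot>\<^bsub>r\<^esub> invt Bi q) J (L @ [k])))"
          using L Suc by (intro sum.cong refl) (simp add: kap_alt_exchange del: kap.simps antisymmetrizer.simps)
        also have "\<dots> = (-1) ^ q * (\<Sum>K\<in>words r. (\<Sum>J\<in>words r. f J * ?A r J K) * invt Bi q K (L @ [k]))"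
          unfolding tmul_def sum_distrib_left sum_distrib_right mult.assoc mult.left_commute[of "f _" "(-1) ^ q"] by (rule sum.swap)
        finally show "(\<Sum>S\<in>words q. (\<Sum>J\<in>words r. f J * kap Bi r J (S @ [k])) * ?A q S L) = 0"
          using less.prems by simp
      qed (use Suc in simp)
      have "(\<Sum>J\<in>words r. f J * act Bi (gam_word J) (om k v) u) =
        (\<Sum>J\<in>words r. f J * (\<Sum>S\<in>words r. \<Sum>p\<in>UNIV. (-1) ^ r * invt Bi r (p # J) (S @ [k]) * om p (act Bi (gam_word S) v) u))
        + (\<Sum>J\<in>words r. f J * (\<Sum>S\<in>words q. kap Bi r J (S @ [k]) * act Bi (gam_word S) v u))"
        unfolding sum.distrib[symmetric] distrib_left[symmetric]
        by (intro sum.cong refl) (use Suc in \<open>simp add: act_gam_word_omg act_ox del: kap.simps\<close>)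
      also have "(\<Sum>J\<in>words r. f J * (\<Sum>S\<in>words q. kap Bi r J (S @ [k]) * act Bi (gam_word S) v u)) =
        (\<Sum>S\<in>words q. (\<Sum>J\<in>words r. f J * kap Bi r J (S @ [k])) * act Bi (gam_word S) v u)"
        unfolding sum_distrib_left sum_distrib_right mult.assoc by (rule sum.swap)
      also note 2
      also have "(\<Sum>J\<in>words r. f J * (\<Sum>S\<in>words r. \<Sum>p\<in>UNIV. (-1) ^ r * invt Bi r (p # J) (S @ [k]) * om p (act Bi (gam_word S) v) u)) =
        (-1) ^ r * (\<Sum>p\<in>UNIV. \<Sum>S\<in>words r. (\<Sum>J\<in>words r. f J * invt Bi r (p # J) (S @ [k])) * om p (act Bi (gam_word S) v) u)"
      proof -
        have "(\<Sum>J\<in>words r. f J * (\<Sum>S\<in>words r. \<Sum>p\<in>UNIV. (-1) ^ r * invt Bi r (p # J) (S @ [k]) * om p (act Bi (gam_word S) v) u)) =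
          (\<Sum>J\<in>words r. \<Sum>S\<in>words r. \<Sum>p\<in>UNIV. (-1) ^ r * (f J * invt Bi r (p # J) (S @ [k]) * om p (act Bi (gam_word S) v) u))"
          unfolding sum_distrib_left by (intro sum.cong refl) (simp only: mult_ac)
        also have "\<dots> = (\<Sum>p\<in>UNIV. \<Sum>S\<in>words r. \<Sum>J\<in>words r. (-1) ^ r * (f J * invt Bi r (p # J) (S @ [k]) * om p (act Bi (gam_word S) v) u))"
          by (rule sum_swap_3)
        finally show ?thesis unfolding sum_distrib_left sum_distrib_right .
      qed
      also have "(\<Sum>p\<in>UNIV. \<Sum>S\<in>words r. (\<Sum>J\<in>words r. f J * invt Bi r (p # J) (S @ [k])) * om p (act Bi (gam_word S) v) u) = 0"
      proof (cases u)
        case (Cons x u')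
        show ?thesis
        proof (rule sum.neutral, rule ballI)
          fix p
          show "(\<Sum>S\<in>words r. (\<Sum>J\<in>words r. f J * invt Bi r (p # J) (S @ [k])) * om p (act Bi (gam_word S) v) u) = 0"
            using 1[of u' p] Cons by (cases "x = p") simp_all
        qed
      qed simp
      finally show ?thesis by simp
    qed
    note om = this
    have "(\<Sum>J\<in>words r. f J * act Bi (gam_word J) v u) =
      (\<Sum>k\<in>UNIV. \<Sum>J\<in>words r. f J * act Bi (gam_word J) (om k (\<lambda>u. v (k # u))) u)"
      by (subst sum.swap, rule sum.cong[OF refl], subst act_fock_expand) (simp add: vac sum_distrib_left)
    then show ?thesis using om by simp
  qed
qed

subsection \<open>The relations hold on the quotient of the Fock space\<close>

text \<open>The vectors that vanish in the wedge algebra of the \<Omega>, degree by degree; the Fock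
  quotient is taken by these.\<close>

definition null_vecs :: "'n fock set" where
  "null_vecs = {v. \<forall>n I. length I = n \<longrightarrow> (\<Sum>J\<in>words n. antisymmetrizer \<sigma> n I J * v (rev J)) = 0}"

definition fock_ideal :: "'n generator free_alg set" where
  "fock_ideal = {x. \<forall>v. act Bi x v \<in> null_vecs}"

lemma null_vecsD: "v \<in> null_vecs \<Longrightarrow> length I = n \<Longrightarrow> (\<Sum>J\<in>words n. antisymmetrizer \<sigma> n I J * v (rev J)) = 0"
  unfolding null_vecs_def by blast

lemma null_vecs_zero: "(\<lambda>u. 0) \<in> null_vecs"
  by (simp add: null_vecs_def)

lemma null_vecs_sum: "(\<And>i. i \<in> A \<Longrightarrow> v i \<in> null_vecs) \<Longrightarrow> (\<lambda>u. \<Sum>i\<in>A. f i * v i u) \<in> null_vecs"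
proof -
  assume v: "\<And>i. i \<in> A \<Longrightarrow> v i \<in> null_vecs"
  have "(\<Sum>J\<in>words n. antisymmetrizer \<sigma> n I J * (\<Sum>i\<in>A. f i * v i (rev J))) = 0" if "length I = n" for n I
  proof -
    have "(\<Sum>J\<in>words n. antisymmetrizer \<sigma> n I J * (\<Sum>i\<in>A. f i * v i (rev J))) =
        (\<Sum>i\<in>A. f i * (\<Sum>J\<in>words n. antisymmetrizer \<sigma> n I J * v i (rev J)))"
      unfolding sum_distrib_left mult.left_commute[of _ "f _"] by (rule sum.swap)
    then show ?thesis using v that by (simp add: null_vecsD)
  qed
  then show ?thesis by (simp add: null_vecs_def)
qed

lemma null_vecs_add: "v \<in> null_vecs \<Longrightarrow> v' \<in> null_vecs \<Longrightarrow> (\<lambda>u. v u + v' u) \<in> null_vecs"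
  by (auto simp: null_vecs_def distrib_left sum.distrib)

lemma null_vecs_diff: "v \<in> null_vecs \<Longrightarrow> v' \<in> null_vecs \<Longrightarrow> (\<lambda>u. v u - v' u) \<in> null_vecs"
  by (auto simp: null_vecs_def right_diff_distrib sum_subtractf)

lemma antisymmetrizer_Suc_tmul:
  "\<exists>Z. \<forall>I J. length I = Suc m \<longrightarrow> length J = Suc m \<longrightarrow>
    antisymmetrizer \<sigma> (Suc m) I J = (Z \<odot>\<^bsub>Suc m\<^esub> emb 0 m m (antisymmetrizer \<sigma> m)) I J"
proof -
  obtain Z where "\<And>a. z1 s a (Suc m) = op a (Suc m) (Suc m) Z" using loc_families(3)[of "Suc m" \<sigma>] by (auto simp: loc_def)
  then have "op 0 (Suc m) (Suc m) (antisymmetrizer \<sigma> (Suc m)) = op 0 (Suc m) (Suc m) (Z \<odot>\<^bsub>Suc m\<^esub> emb 0 m m (antisymmetrizer \<sigma> m))"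
    using op_emb[of 0 0 m 1 m "antisymmetrizer \<sigma> m"]
    by (simp add: op_antisymmetrizer flip: op_mult del: antisymmetrizer.simps z1.simps)
  from op_inject[OF this] show ?thesis by blast
qed

text \<open>Repeatedly splitting off the first strand leaves the antisymmetrizer of the last r
  strands on the right, with a cofactor given by one tensor for all positions.\<close>

lemma alt_right_factor: "\<exists>x. loc (a + r) (a + r) x \<and> (\<forall>b. alt s b (a + r) = x b * alt s (b + a) r)"
proof (induction a)
  case 0
  show ?case using loc_one by (intro exI[of _ "\<lambda>_. 1"]) simp
next
  case (Suc a)
  then obtain x where x: "loc (a + r) (a + r) x" "\<And>b. alt s b (a + r) = x b * alt s (b + a) r" by blast
  have "alt s b (Suc (a + r)) = z2 s b (Suc (a + r)) * x (Suc b) * alt s (b + Suc a) r" for b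
    unfolding alt_Suc_z2 x(2)[of "Suc b"] by (simp add: mult.assoc)
  moreover have "loc (Suc (a + r)) (Suc (a + r)) (\<lambda>b. z2 s b (Suc (a + r)) * x (Suc b))"
    using loc_mult[OF loc_families(4) loc_shift[OF x(1)]] .
  ultimately show ?case by auto
qed

lemma antisymmetrizer_right_factor:
  "\<exists>Z. \<forall>I J. length I = a + r \<longrightarrow> length J = a + r \<longrightarrow>
    antisymmetrizer \<sigma> (a + r) I J = (Z \<odot>\<^bsub>a + r\<^esub> emb a r r (antisymmetrizer \<sigma> r)) I J"
proof -
  obtain x Z where x: "\<And>b. alt s b (a + r) = x b * alt s (b + a) r" and Z: "\<And>b. x b = op b (a + r) (a + r) Z"
    using alt_right_factor[of a r] by (auto simp: loc_def)
  have "op 0 (a + r) (a + r) (antisymmetrizer \<sigma> (a + r)) = op 0 (a + r) (a + r) (Z \<odot>\<^bsub>a + r\<^esub> emb a r r (antisymmetrizer \<sigma> r))"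
    using op_emb[of 0 a r 0 r "antisymmetrizer \<sigma> r"] x[of 0] Z[of 0]
    by (simp add: op_antisymmetrizer flip: op_mult)
  from op_inject[OF this] show ?thesis by blast
qed

text \<open>The new letter stands at the last strand of the reversed word, and the antisymmetrizer
  of m + 1 strands has that of the first m as a right factor.\<close>

lemma om_null_vecs: "v \<in> null_vecs \<Longrightarrow> om k v \<in> null_vecs"
proof -
  assume v: "v \<in> null_vecs"
  have "(\<Sum>J\<in>words n. antisymmetrizer \<sigma> n I J * om k v (rev J)) = 0" if I: "length I = n" for n I
  proof (cases n)
    case (Suc m)
    let ?A = "antisymmetrizer \<sigma>"
    obtain Z where Z: "\<And>I J. length I = Suc m \<Longrightarrow> length J = Suc m \<Longrightarrow> ?A (Suc m) I J = (Z \<odot>\<^bsub>Suc m\<^esub> emb 0 m m (?A m)) I J"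
      using antisymmetrizer_Suc_tmul[of m] by blast
    have Z': "?A (Suc m) I (J @ [k]) = (\<Sum>K\<in>words m. Z I (K @ [k]) * ?A m K J)" if "length J = m" for J
    proof -
      have "?A (Suc m) I (J @ [k]) = (Z \<odot>\<^bsub>Suc m\<^esub> emb 0 m m (?A m)) I (J @ [k])" using that I Suc by (intro Z) auto
      also have "\<dots> = (\<Sum>K\<in>words m. Z I (K @ drop m (J @ [k])) * ?A m K (take m (J @ [k])))"
        by (rule tmul_emb_0[where k = 1]) (use that in auto)
      finally show ?thesis using that by simp
    qed
    have "(\<Sum>J\<in>words (Suc m). ?A (Suc m) I J * om k v (rev J)) = (\<Sum>J\<in>words m. ?A (Suc m) I (J @ [k]) * v (rev J))"
      by (simp add: sum_words_Suc' if_distrib[of "\<lambda>x. _ * x"] del: antisymmetrizer.simps cong: if_cong)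
    also have "\<dots> = (\<Sum>J\<in>words m. \<Sum>K\<in>words m. Z I (K @ [k]) * (?A m K J * v (rev J)))"
      by (intro sum.cong refl) (simp add: Z' sum_distrib_right mult.assoc del: antisymmetrizer.simps)
    also have "\<dots> = (\<Sum>K\<in>words m. Z I (K @ [k]) * (\<Sum>J\<in>words m. ?A m K J * v (rev J)))"
      by (subst sum.swap) (simp add: sum_distrib_left)
    also have "\<dots> = 0" by (intro sum.neutral ballI) (simp add: null_vecsD[OF v])
    finally show ?thesis using Suc by simp
  qed simp
  then show ?thesis by (simp add: null_vecs_def)
qed

text \<open>The tensor by which \<gamma> acts on vectors. \<open>gaw\<close> works from the left end
  of a word, the last strand after reversal, so the result is a right coset sum \<open>z1r\<close>
  in the inverse generators.\<close>

primrec cc :: "nat \<Rightarrow> 'n tensor" where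
  "cc 0 = idt"
| "cc (Suc n) = (\<lambda>I J. idt I J - (emb n 2 2 (mat_tensor Bi) \<odot>\<^bsub>Suc (Suc n)\<^esub> emb 0 (Suc n) (Suc n) (cc n)) I J)"

lemma op_cc: "op 0 (Suc n) (Suc n) (cc n) = z1r si 0 (Suc n)"
proof (induction n)
  case (Suc n)
  have "op 0 (Suc (Suc n)) (Suc (Suc n)) (emb n 2 2 (mat_tensor Bi)) = si n"
    using op_emb[of 0 n 2 0 2 "mat_tensor Bi"] by (simp add: sop_def)
  moreover have "op 0 (Suc (Suc n)) (Suc (Suc n)) (emb 0 (Suc n) (Suc n) (cc n)) = z1r si 0 (Suc n)"
    using op_emb[of 0 0 "Suc n" 1 "Suc n" "cc n"] Suc by (simp del: cc.simps)
  ultimately show ?case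
    by (simp add: op_linear op_idt del: z1r.simps(2) flip: op_mult) (simp del: z1r.simps(2) add: z1r.simps(2)[of _ _ "Suc n"])
qed (simp add: op_idt)

lemma cc_Suc:
  assumes "length J = n" "length K = Suc n"
  shows "cc (Suc n) (J @ [p, j]) (K @ [k]) =
    (if J @ [p, j] = K @ [k] then 1 else 0) - (\<Sum>x\<in>UNIV. Bi $ (p, j) $ (x, k) * cc n (J @ [x]) K)"
proof -
  have "(emb n 2 2 (mat_tensor Bi) \<odot>\<^bsub>Suc (Suc n)\<^esub> emb 0 (Suc n) (Suc n) (cc n)) (J @ [p, j] @ []) (K @ [k]) =
      (\<Sum>L\<in>words 2. mat_tensor Bi [p, j] L * emb 0 (Suc n) (Suc n) (cc n) (J @ L @ []) (K @ [k]))"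
    by (rule emb_tmul) (use assms in auto)
  also have "\<dots> = (\<Sum>x\<in>UNIV. \<Sum>y\<in>UNIV. Bi $ (p, j) $ (x, y) * (if y = k then cc n (J @ [x]) K else 0))"
    unfolding sum_words_2 using assms by (intro sum.cong refl) (simp add: emb_def)
  finally show ?thesis by (simp add: idt_def if_distrib[of "\<lambda>x. _ * x"] cong: if_cong)
qed

lemma gaw_cc: "gaw Bi (rev J) j v = (\<Sum>K\<in>words (Suc (length J)). cc (length J) (J @ [j]) K * v (rev K))"
proof (induction J arbitrary: j v rule: rev_induct)
  case Nil
  show ?case by (simp add: sum_words_1 idt_def if_distrib[of "\<lambda>x. x * _"] cong: if_cong)
next
  case (snoc p J)
  let ?n = "length J"
  have "(\<Sum>K\<in>words (Suc (Suc ?n)). cc (Suc ?n) (J @ [p, j]) K * v (rev K)) =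
    (\<Sum>K\<in>words (Suc ?n). \<Sum>k\<in>UNIV. ((if J @ [p, j] = K @ [k] then 1 else 0) - (\<Sum>x\<in>UNIV. Bi $ (p, j) $ (x, k) * cc ?n (J @ [x]) K)) * v (k # rev K))"
    unfolding sum_words_Suc'[of _ "Suc ?n"] by (intro sum.cong refl) (simp add: cc_Suc del: cc.simps)
  also have "\<dots> = (\<Sum>K\<in>words (Suc ?n). \<Sum>k\<in>UNIV. (if J @ [p, j] = K @ [k] then v (k # rev K) else 0))
     - (\<Sum>K\<in>words (Suc ?n). \<Sum>k\<in>UNIV. \<Sum>x\<in>UNIV. Bi $ (p, j) $ (x, k) * (cc ?n (J @ [x]) K * v (k # rev K)))"
    by (simp add: left_diff_distrib sum_subtractf sum_distrib_right mult.assoc if_distrib[of "\<lambda>x. x * _"] cong: if_cong)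
  also have "(\<Sum>K\<in>words (Suc ?n). \<Sum>k\<in>UNIV. (if J @ [p, j] = K @ [k] then v (k # rev K) else 0)) =
      (\<Sum>L\<in>words (Suc (Suc ?n)). if J @ [p, j] = L then v (rev L) else 0)"
    unfolding sum_words_Suc'[of _ "Suc ?n"] by (intro sum.cong refl) simp
  also have "\<dots> = v (j # p # rev J)" by (subst sum_words_delta) simp_all
  also have "(\<Sum>K\<in>words (Suc ?n). \<Sum>k\<in>UNIV. \<Sum>x\<in>UNIV. Bi $ (p, j) $ (x, k) * (cc ?n (J @ [x]) K * v (k # rev K))) =
      (\<Sum>x\<in>UNIV. \<Sum>k\<in>UNIV. Bi $ (p, j) $ (x, k) * gaw Bi (rev J) x (\<lambda>u. v (k # u)))"
    unfolding snoc.IH sum_distrib_left by (rule sum_swap_3)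
  finally show ?case by simp
qed

text \<open>By \<open>alt_z1r_si\<close> the antisymmetrizer followed by the action of \<gamma> is
  an operator applied to the next larger antisymmetrizer, which kills the vector.\<close>

lemma gam_null_vecs: "v \<in> null_vecs \<Longrightarrow> (\<lambda>u. gaw Bi u j v) \<in> null_vecs"
proof -
  assume v: "v \<in> null_vecs"
  let ?A = "antisymmetrizer \<sigma>"
  have "(\<Sum>J\<in>words n. ?A n I J * gaw Bi (rev J) j v) = 0" if I: "length I = n" for n I
  proof -
    have A: "op 0 (Suc n) (Suc n) (emb 0 n n (?A n)) = alt s 0 n"
      using op_emb[of 0 0 n 1 n "?A n"] by (simp add: op_antisymmetrizer)
    obtain D where D: "dn si 0 n = op 0 (Suc n) (Suc n) D" using loc_families(1)[of n Bi] by (auto simp: loc_def)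
    have "op 0 (Suc n) (Suc n) (emb 0 n n (?A n) \<odot>\<^bsub>Suc n\<^esub> cc n) = op 0 (Suc n) (Suc n) (\<lambda>I J. (-1) ^ n * (D \<odot>\<^bsub>Suc n\<^esub> ?A (Suc n)) I J)"
      unfolding op_minus_one_power op_mult[symmetric] A op_cc op_antisymmetrizer D[symmetric] alt_z1r_si by (simp only: mult.assoc)
    note op_inject[OF this]
    then have e: "(\<Sum>J\<in>words n. ?A n I J * cc n (J @ [j]) K) = (-1) ^ n * (D \<odot>\<^bsub>Suc n\<^esub> ?A (Suc n)) (I @ [j]) K" if "length K = Suc n" for K
      using emb_tmul[of "[]" 0 I n "[j]" 1 "Suc n" n "?A n" "cc n" K] I that by (simp del: cc.simps antisymmetrizer.simps)
    have "(\<Sum>J\<in>words n. ?A n I J * gaw Bi (rev J) j v) = (\<Sum>J\<in>words n. \<Sum>K\<in>words (Suc n). ?A n I J * cc n (J @ [j]) K * v (rev K))"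
      by (intro sum.cong refl) (simp add: gaw_cc sum_distrib_left mult.assoc del: cc.simps antisymmetrizer.simps)
    also have "\<dots> = (\<Sum>K\<in>words (Suc n). (\<Sum>J\<in>words n. ?A n I J * cc n (J @ [j]) K) * v (rev K))"
      unfolding sum_distrib_right by (rule sum.swap)
    also have "\<dots> = (\<Sum>K\<in>words (Suc n). \<Sum>L\<in>words (Suc n). (-1) ^ n * D (I @ [j]) L * (?A (Suc n) L K * v (rev K)))"
      by (intro sum.cong refl) (simp add: e tmul_def[of D] sum_distrib_left sum_distrib_right mult.assoc del: antisymmetrizer.simps)
    also have "\<dots> = (\<Sum>L\<in>words (Suc n). (-1) ^ n * D (I @ [j]) L * (\<Sum>K\<in>words (Suc n). ?A (Suc n) L K * v (rev K)))"
      by (subst sum.swap) (simp only: sum_distrib_left)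
    also have "\<dots> = 0" by (intro sum.neutral ballI) (simp add: null_vecsD[OF v] del: antisymmetrizer.simps)
    finally show ?thesis .
  qed
  then show ?thesis by (simp add: null_vecs_def del: antisymmetrizer.simps)
qed

lemma act_null_vecs: "v \<in> null_vecs \<Longrightarrow> act Bi x v \<in> null_vecs"
proof -
  assume v: "v \<in> null_vecs"
  have "step Bi g v \<in> null_vecs" if "v \<in> null_vecs" for g v
    using that by (cases g) (simp_all add: null_vecs_zero gam_null_vecs om_null_vecs)
  then have "aw Bi w v \<in> null_vecs" for w using v by (induction w) simp_all
  then show ?thesis unfolding act_def[of Bi x v, abs_def] by (intro null_vecs_sum)
qed

lemma fock_ideal_two_sided: "two_sided_ideal fock_ideal"
proof
  show "0 \<in> fock_ideal" by (simp add: fock_ideal_def null_vecs_def)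
  show "x + y \<in> fock_ideal" if "x \<in> fock_ideal" "y \<in> fock_ideal" for x y
  proof -
    have "act Bi (x + y) v = (\<lambda>u. act Bi x v u + act Bi y v u)" for v by (rule ext) (rule act_add)
    then show ?thesis using that null_vecs_add by (simp add: fock_ideal_def)
  qed
  show "a * x \<in> fock_ideal" if "x \<in> fock_ideal" for a x
    using that act_null_vecs by (simp add: fock_ideal_def act_mult)
  show "x * a \<in> fock_ideal" if "x \<in> fock_ideal" for a x
    using that by (simp add: fock_ideal_def act_mult)
qed

text \<open>The relation multiplies a vector by the tensor \<open>d\<close> in its last r strands,
  and every larger antisymmetrizer has that of these strands as a right factor.\<close>

lemma omg_rels_fock: "omg_rels \<sigma> \<subseteq> fock_ideal"
proof
  let ?A = "antisymmetrizer \<sigma>"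
  fix x assume "x \<in> omg_rels \<sigma>"
  then obtain r d where x: "x = (\<Sum>J\<in>words r. omg_word J * scalar (d J))" and d: "\<And>I. length I = r \<Longrightarrow> (\<Sum>J\<in>words r. ?A r I J * d J) = 0"
    by (auto simp: omg_rels_def)
  have "(\<Sum>L\<in>words m. ?A m I L * act Bi x v (rev L)) = 0" if I: "length I = m" for m I v
  proof -
    have actx: "act Bi x v (rev L) = (\<Sum>J\<in>words r. d J * act Bi (omg_word J) v (rev L))" for L
      by (simp add: x scalar_central act_sum act_mult act_gen)
    show ?thesis
    proof (cases "r \<le> m")
      case False
      then show ?thesis by (simp add: actx act_omg_word)
    next
      case True
      then obtain a where m: "m = a + r" by (metis add.commute le_Suc_ex)
      obtain Z where Z: "\<And>I J. length I = a + r \<Longrightarrow> length J = a + r \<Longrightarrow> ?A (a + r) I J = (Z \<odot>\<^bsub>a + r\<^esub> emb a r r (?A r)) I J"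
        using antisymmetrizer_right_factor[of a r] by blast
      have 0: "(\<Sum>J\<in>words r. ?A m I (K @ J) * d J) = 0" if K: "length K = a" for K
      proof -
        have "(\<Sum>J\<in>words r. ?A m I (K @ J) * d J) = (\<Sum>J\<in>words r. \<Sum>L\<in>words m. Z I L * (emb a r r (?A r) L (K @ J) * d J))"
          using I K m by (intro sum.cong refl) (simp add: Z tmul_def sum_distrib_right mult.assoc)
        also have "\<dots> = (\<Sum>L\<in>words m. Z I L * (\<Sum>J\<in>words r. emb a r r (?A r) L (K @ J) * d J))"
          by (subst sum.swap) (simp only: sum_distrib_left)
        also have "\<dots> = 0"
        proof (intro sum.neutral ballI)
          fix L :: "'n list" assume "L \<in> words m"
          then have "emb a r r (?A r) L (K @ J) = (if take a L = K then ?A r (drop a L) J else 0)" if "length J = r" for J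
            using K m that by (simp add: emb_def)
          then have "(\<Sum>J\<in>words r. emb a r r (?A r) L (K @ J) * d J) = (if take a L = K then \<Sum>J\<in>words r. ?A r (drop a L) J * d J else 0)"
            by simp
          then show "Z I L * (\<Sum>J\<in>words r. emb a r r (?A r) L (K @ J) * d J) = 0"
            using d[of "drop a L"] \<open>L \<in> words m\<close> m by simp
        qed
        finally show ?thesis .
      qed
      have "(\<Sum>L\<in>words m. ?A m I L * act Bi x v (rev L)) = (\<Sum>K\<in>words a. \<Sum>J\<in>words r. ?A m I (K @ J) * (d J * v (rev K)))"
        unfolding m sum_words_append
      proof (intro sum.cong refl)
        fix K J :: "'n list" assume "K \<in> words a" "J \<in> words r"
        then have "act Bi x v (rev (K @ J)) = (\<Sum>J'\<in>words r. if J' = J then d J' * v (rev K) else 0)"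
          unfolding actx by (intro sum.cong refl) (auto simp: act_omg_word simp del: rev_append)
        also have "\<dots> = d J * v (rev K)" using \<open>J \<in> words r\<close> by (subst sum_words_delta) auto
        finally show "?A (a + r) I (K @ J) * act Bi x v (rev (K @ J)) = ?A (a + r) I (K @ J) * (d J * v (rev K))" by simp
      qed
      also have "\<dots> = (\<Sum>K\<in>words a. (\<Sum>J\<in>words r. ?A m I (K @ J) * d J) * v (rev K))"
        by (simp add: sum_distrib_right mult.assoc)
      finally show ?thesis using 0 by simp
    qed
  qed
  then show "x \<in> fock_ideal" by (simp add: fock_ideal_def null_vecs_def)
qed

lemma gam_rels_fock: "gam_rels \<sigma> \<subseteq> fock_ideal"
proof
  fix x assume "x \<in> gam_rels \<sigma>"
  then obtain r f where x: "x = (\<Sum>J\<in>words r. scalar (f J) * gam_word J)"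
    and f: "\<And>L. length L = r \<Longrightarrow> (\<Sum>J\<in>words r. f J * antisymmetrizer \<sigma> r J L) = 0"
    by (auto simp: gam_rels_def)
  have "act Bi x v = (\<lambda>u. 0)" for v
    unfolding x by (rule ext) (simp only: act_sum_gam_word act_gam_rel[OF f])
  then show "x \<in> fock_ideal" by (simp add: fock_ideal_def null_vecs_zero)
qed

lemma fock_wedge: "wedge_ideal fock_ideal \<sigma>" and fock_gam_omg: "gam_omg_ideal fock_ideal \<sigma>"
proof -
  interpret two_sided_ideal fock_ideal by (rule fock_ideal_two_sided)
  show "wedge_ideal fock_ideal \<sigma>" by unfold_locales (rule gam_rels_fock omg_rels_fock)+
  show "gam_omg_ideal fock_ideal \<sigma>"
  proof
    have "exact_ideal Bi \<subseteq> fock_ideal"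
    proof
      fix x assume "x \<in> exact_ideal Bi"
      then have "act Bi x v = (\<lambda>u. 0)" for v by (auto simp: exact_ideal_def)
      then show "x \<in> fock_ideal" by (simp add: fock_ideal_def null_vecs_zero)
    qed
    then show "gam_omg_rels \<sigma> \<subseteq> fock_ideal" using ex.gam_omg_mem by blast
  qed
qed

subsection \<open>Faithfulness on normally ordered elements\<close>

lemma act_zero_fun: "act Bi x (\<lambda>u. 0) = (\<lambda>u. 0)"
  by (rule ext) (rule act_zero_vec)

lemma act_omg_word_snoc: "act Bi (omg_word (K @ [k])) v = om k (act Bi (omg_word K) v)"
  by (simp add: omg_word_simps act_mult act_gen)

text \<open>Each \<Omega> can absorb only one \<gamma>, and a surplus \<gamma> reaches the vacuum.
  This makes the action of normally ordered elements triangular in the number of \<gamma>.\<close>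

lemma act_gam_word_overflow: "length K < length J \<Longrightarrow> act Bi (gam_word J) (act Bi (omg_word K) vac) u = 0"
proof (induction K arbitrary: J u rule: rev_induct)
  case Nil
  then show ?case by (simp add: omg_word_simps act_gen act_gam_word_vac)
next
  case (snoc k K)
  have 1: "act Bi (gam_word S) (act Bi (omg_word K) vac) = (\<lambda>u. 0)" if "length S = length J" for S
    using snoc.IH[of S] snoc.prems that by auto
  have 2: "act Bi (gam_word S) (act Bi (omg_word K) vac) u = 0" if "length S = length J - 1" for S u
    using snoc.IH[of S] snoc.prems that by auto
  show ?case
    unfolding act_omg_word_snoc act_gam_word_omg using 1 2 by (simp add: act_zero_vec)
qed

definition pairing :: "'n list \<Rightarrow> 'n list \<Rightarrow> complex" where
  "pairing J K = act Bi (gam_word J) (act Bi (omg_word K) vac) []"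

lemma act_gam_word_omg_word_snoc:
  assumes "length J = Suc (length K)"
  shows "act Bi (gam_word J) (act Bi (omg_word (K @ [k])) vac) u =
    (\<Sum>S\<in>words (length K). kap Bi (length J) J (S @ [k]) * act Bi (gam_word S) (act Bi (omg_word K) vac) u)"
proof -
  have "act Bi (gam_word S) (act Bi (omg_word K) vac) = (\<lambda>u. 0)" if "length S = length J" for S
    using act_gam_word_overflow[of K S] assms that by auto
  then show ?thesis
    unfolding act_omg_word_snoc act_gam_word_omg using assms by (simp add: act_zero_vec)
qed

lemma act_gam_word_omg_word:
  "length J = length K \<Longrightarrow> act Bi (gam_word J) (act Bi (omg_word K) vac) u = pairing J K * vac u"
proof (induction K arbitrary: J u rule: rev_induct)
  case Nil
  then show ?case by (simp add: pairing_def omg_word_simps gam_word_simps act_gen vac_def)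
next
  case (snoc k K)
  have e: "act Bi (gam_word J) (act Bi (omg_word (K @ [k])) vac) u =
      (\<Sum>S\<in>words (length K). kap Bi (length J) J (S @ [k]) * (pairing S K * vac u))" for u
    using snoc act_gam_word_omg_word_snoc[of J K k u] by simp
  show ?case unfolding pairing_def[of J] e by (simp add: vac_def sum_distrib_right)
qed

lemma pairing_snoc:
  "length J = Suc (length K) \<Longrightarrow> pairing J (K @ [k]) = (\<Sum>S\<in>words (length K). kap Bi (length J) J (S @ [k]) * pairing S K)"
  unfolding pairing_def by (rule act_gam_word_omg_word_snoc)

text \<open>In substance the pairing is the antisymmetrizer up to invertible braid factors. Peeling
  off one \<Omega> brings in \<open>kap\<close>, and \<open>kap\<close> times the smaller
  antisymmetrizer is, up to sign, the larger one times an inverse cycle.\<close>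

lemma pairing_nondegenerate:
  assumes "\<And>K. length K = t \<Longrightarrow> (\<Sum>J\<in>words t. y J * pairing J K) = 0" "length L = t"
  shows "(\<Sum>J\<in>words t. y J * antisymmetrizer \<sigma> t J L) = 0"
  using assms
proof (induction t arbitrary: y L)
  case 0
  have "pairing [] [] = 1" by (simp add: pairing_def omg_word_simps gam_word_simps act_gen vac_def)
  then show ?case using 0(1)[of "[]"] by simp
next
  case (Suc t)
  let ?A = "antisymmetrizer \<sigma>"
  have 1: "(\<Sum>S\<in>words t. (\<Sum>J\<in>words (Suc t). y J * kap Bi (Suc t) J (S @ [k])) * pairing S K) = 0" if "length K = t" for k K
  proof -
    have "(\<Sum>S\<in>words t. (\<Sum>J\<in>words (Suc t). y J * kap Bi (Suc t) J (S @ [k])) * pairing S K) =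
        (\<Sum>J\<in>words (Suc t). y J * (\<Sum>S\<in>words t. kap Bi (Suc t) J (S @ [k]) * pairing S K))"
      unfolding sum_distrib_left sum_distrib_right mult.assoc by (rule sum.swap)
    also have "\<dots> = (\<Sum>J\<in>words (Suc t). y J * pairing J (K @ [k]))"
      using that by (intro sum.cong refl) (simp add: pairing_snoc del: kap.simps)
    finally show ?thesis using Suc.prems(1)[of "K @ [k]"] that by simp
  qed
  have 2: "(\<Sum>J\<in>words (Suc t). y J * (?A (Suc t) \<odot>\<^bsub>Suc t\<^esub> invt Bi t) J M) = 0" if M: "length M = Suc t" for M
  proof -
    obtain k M' where M': "M = M' @ [k]" "length M' = t" using M by (cases M rule: rev_cases) auto
    have "0 = (\<Sum>S\<in>words t. (\<Sum>J\<in>words (Suc t). y J * kap Bi (Suc t) J (S @ [k])) * ?A t S M')"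
      using Suc.IH[OF 1 M'(2)] by simp
    also have "\<dots> = (\<Sum>J\<in>words (Suc t). y J * (\<Sum>S\<in>words t. kap Bi (Suc t) J (S @ [k]) * ?A t S M'))"
      unfolding sum_distrib_left sum_distrib_right mult.assoc by (rule sum.swap)
    also have "\<dots> = (\<Sum>J\<in>words (Suc t). y J * ((-1) ^ t * (?A (Suc t) \<odot>\<^bsub>Suc t\<^esub> invt Bi t) J (M' @ [k])))"
      using M' by (intro sum.cong refl) (simp add: kap_alt_exchange del: kap.simps antisymmetrizer.simps)
    finally have "0 = (-1) ^ t * (\<Sum>J\<in>words (Suc t). y J * (?A (Suc t) \<odot>\<^bsub>Suc t\<^esub> invt Bi t) J M)"
      unfolding M' by (simp only: sum_distrib_left mult.left_commute)
    then show ?thesis by simp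
  qed
  \<comment> \<open>\<open>tau\<close> inverts the cycle \<open>invt\<close> and so frees the
    antisymmetrizer.\<close>
  have "op 0 (Suc t) (Suc t) (?A (Suc t) \<odot>\<^bsub>Suc t\<^esub> invt Bi t \<odot>\<^bsub>Suc t\<^esub> tau \<sigma> t) = op 0 (Suc t) (Suc t) (?A (Suc t))"
    by (simp only: op_mult[symmetric] op_invt op_tau mult.assoc up_dn_inverse' mult_1_right)
  from op_inject[OF this, of _ L]
  have e: "?A (Suc t) J L = (\<Sum>M\<in>words (Suc t). (?A (Suc t) \<odot>\<^bsub>Suc t\<^esub> invt Bi t) J M * tau \<sigma> t M L)" if "length J = Suc t" for J
    unfolding tmul_def[of "_ \<odot>\<^bsub>_\<^esub> _"] using that Suc.prems(2) by metis
  have "(\<Sum>J\<in>words (Suc t). y J * ?A (Suc t) J L) =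
      (\<Sum>J\<in>words (Suc t). \<Sum>M\<in>words (Suc t). y J * (?A (Suc t) \<odot>\<^bsub>Suc t\<^esub> invt Bi t) J M * tau \<sigma> t M L)"
    by (intro sum.cong refl) (simp add: e sum_distrib_left mult.assoc del: antisymmetrizer.simps)
  also have "\<dots> = (\<Sum>M\<in>words (Suc t). (\<Sum>J\<in>words (Suc t). y J * (?A (Suc t) \<odot>\<^bsub>Suc t\<^esub> invt Bi t) J M) * tau \<sigma> t M L)"
    unfolding sum_distrib_right by (rule sum.swap)
  also have "\<dots> = 0" by (intro sum.neutral ballI) (simp add: 2 del: antisymmetrizer.simps)
  finally show ?case .
qed

lemma act_omg_word_vac: "act Bi (omg_word I) vac (rev L) = (if L = I then 1 else 0)"
  by (auto simp: act_omg_word vac_def)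

definition nbs :: "nat \<Rightarrow> 'n tensor \<Rightarrow> 'n generator free_alg" where
  "nbs M T = (\<Sum>p<M. \<Sum>t<M. nb p t T 1)"

lemma act_nb: "act Bi (nb p t T 1) v u = (\<Sum>I\<in>words p. \<Sum>J\<in>words t. T I J * act Bi (omg_word I) (act Bi (gam_word J) v) u)"
  by (simp add: nb_def act_sum act_mult scalar_central act_gen)

lemma act_scale: "act B x (\<lambda>u. a * v u) u = a * act B x v u"
  using act_linear[of B x "\<lambda>_. a" "\<lambda>_. v" "{()}" u] by simp

text \<open>The element is tested on words of t letters \<Omega>. Terms with more than t factors
  \<gamma> vanish by overflow, those with fewer vanish modulo \<open>null_vecs\<close> by induction,
  and what remains in each degree p is the coefficient tensor applied to the pairing.\<close>

lemma nbs_faithful: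
  assumes "\<And>K. act Bi (nbs M T) (act Bi (omg_word K) vac) \<in> null_vecs"
    and "p < M" "t < M" "length I = p" "length L = t"
  shows "(antisymmetrizer \<sigma> p \<odot>\<^bsub>p\<^esub> T \<odot>\<^bsub>t\<^esub> antisymmetrizer \<sigma> t) I L = 0"
  using assms(2-)
proof (induction t arbitrary: p I L rule: less_induct)
  case (less t)
  let ?A = "antisymmetrizer \<sigma>"
  interpret fw: wedge_ideal fock_ideal \<sigma> by (rule fock_wedge)
  have "(\<Sum>J\<in>words t. (?A p \<odot>\<^bsub>p\<^esub> T) I J * pairing J K) = 0" if K: "length K = t" for K
  proof -
    let ?v = "act Bi (omg_word K) vac"
    let ?f = "\<lambda>t u. \<Sum>p<M. act Bi (nb p t T 1) ?v u"
    \<comment> \<open>By the induction hypothesis these tensors vanish between antisymmetrizers, so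
      the wedge relations put the corresponding terms into \<open>fock_ideal\<close>.\<close>
    have low: "?f t' \<in> null_vecs" if "t' < t" for t'
    proof -
      have "act Bi (nb q t' T 1) ?v \<in> null_vecs" if "q < M" for q
      proof -
        have "nb q t' T 1 \<in> fock_ideal"
          using fw.nb_eqv_0[of q t' T 1] less.IH[of t' q] \<open>t' < t\<close> less.prems(2) that by (simp add: fw.eqv_zero_iff)
        then show ?thesis by (simp add: fock_ideal_def)
      qed
      then show ?thesis using null_vecs_sum[of "{..<M}" "\<lambda>q. act Bi (nb q t' T 1) ?v" "\<lambda>_. 1"] by simp
    qed
    have high: "?f t' u = 0" if "t < t'" for t' u
    proof -
      have "act Bi (gam_word J) ?v = (\<lambda>u. 0)" if "length J = t'" for J
        using act_gam_word_overflow[of K J] that \<open>t < t'\<close> K by auto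
      then show ?thesis by (simp add: act_nb act_zero_vec)
    qed
    have "act Bi (nbs M T) ?v u = (\<Sum>t'<t. ?f t' u) + ?f t u" for u
    proof -
      have "act Bi (nbs M T) ?v u = (\<Sum>t'<M. ?f t' u)"
        unfolding nbs_def act_sum by (rule sum.swap)
      also have "\<dots> = (\<Sum>t'<Suc t. ?f t' u)"
        by (rule sum.mono_neutral_right) (use less.prems(2) high in auto)
      finally show ?thesis by simp
    qed
    then have eq: "?f t = (\<lambda>u. act Bi (nbs M T) ?v u - (\<Sum>t'<t. 1 * ?f t' u))" by simp
    have "?f t \<in> null_vecs"
      unfolding eq by (intro null_vecs_diff assms(1) null_vecs_sum low) simp
    then have "(\<Sum>L\<in>words p. ?A p I L * ?f t (rev L)) = 0" using less.prems(3) by (rule null_vecsD)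
    also have "?f t (rev L) = (\<Sum>J\<in>words t. T L J * pairing J K)" if "length L = p" for L
    proof -
      have "act Bi (gam_word J) ?v = (\<lambda>u. pairing J K * vac u)" if "length J = t" for J
        using act_gam_word_omg_word[of J K] that K by auto
      then have "?f t (rev L) = (\<Sum>q<M. \<Sum>I\<in>words q. if I = L then \<Sum>J\<in>words t. T I J * pairing J K else 0)"
        by (simp add: act_nb act_scale act_omg_word_vac if_distrib[of "\<lambda>x. _ * x"] sum_if_const eq_commute[of L] cong: if_cong)
      also have "\<dots> = (\<Sum>q<M. if q = p then \<Sum>J\<in>words t. T L J * pairing J K else 0)"
        using that by (intro sum.cong refl) (auto simp: sum.delta)
      finally show ?thesis using less.prems(1) by simp
    qed
    then have "(\<Sum>L\<in>words p. ?A p I L * ?f t (rev L)) = (\<Sum>L\<in>words p. \<Sum>J\<in>words t. ?A p I L * T L J * pairing J K)"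
      by (intro sum.cong refl) (simp add: sum_distrib_left mult.assoc)
    also have "\<dots> = (\<Sum>J\<in>words t. (?A p \<odot>\<^bsub>p\<^esub> T) I J * pairing J K)"
      unfolding tmul_def sum_distrib_right by (rule sum.swap)
    finally show ?thesis by simp
  qed
  from pairing_nondegenerate[OF this less.prems(4)] show ?case by (simp only: tmul_def)
qed

subsection \<open>Existence of normal forms\<close>

inductive nspan :: "'n generator free_alg \<Rightarrow> bool" where
  nspan_zero: "nspan 0"
| nspan_term: "nspan (omg_word I * scalar a * gam_word J)"
| nspan_add: "nspan x \<Longrightarrow> nspan y \<Longrightarrow> nspan (x + y)"

text \<open>Quantifying over all ideals makes one normal form valid both in the algebra and on the
  Fock quotient, so that its coefficients can be computed in the latter and used in the
  former.\<close>

definition reduces :: "'n generator free_alg \<Rightarrow> 'n generator free_alg \<Rightarrow> bool" where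
  "reduces x y \<longleftrightarrow> (\<forall>\<I>. gam_omg_ideal \<I> \<sigma> \<longrightarrow> x - y \<in> \<I>)"

definition normal :: "'n generator free_alg \<Rightarrow> bool" where
  "normal x \<longleftrightarrow> (\<exists>y. nspan y \<and> reduces x y)"

lemma reducesI: "(\<And>\<I>. gam_omg_ideal \<I> \<sigma> \<Longrightarrow> two_sided_ideal.eqv \<I> x y) \<Longrightarrow> reduces x y"
  unfolding reduces_def by (metis gam_omg_ideal.axioms(1) two_sided_ideal.eqv_def)

lemma reducesD: "reduces x y \<Longrightarrow> gam_omg_ideal \<I> \<sigma> \<Longrightarrow> two_sided_ideal.eqv \<I> x y"
  unfolding reduces_def by (metis gam_omg_ideal.axioms(1) two_sided_ideal.eqv_def)

lemma normal_nspan: "nspan x \<Longrightarrow> normal x"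
proof -
  assume "nspan x"
  moreover have "reduces x x"
  proof (rule reducesI)
    fix \<I> assume "gam_omg_ideal \<I> \<sigma>"
    then interpret gam_omg_ideal \<I> \<sigma> .
    show "eqv x x" by simp
  qed
  ultimately show ?thesis by (auto simp: normal_def)
qed

lemma normal_reduces: "reduces x y \<Longrightarrow> normal y \<Longrightarrow> normal x"
proof -
  assume xy: "reduces x y" and "normal y"
  then obtain z where z: "nspan z" "reduces y z" by (auto simp: normal_def)
  have "reduces x z"
  proof (rule reducesI)
    fix \<I> assume I: "gam_omg_ideal \<I> \<sigma>"
    then interpret gam_omg_ideal \<I> \<sigma> .
    show "eqv x z" using reducesD[OF xy I] reducesD[OF z(2) I] by (rule eqv_trans)
  qed
  then show ?thesis using z by (auto simp: normal_def)
qed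

lemma normal_add: "normal x \<Longrightarrow> normal y \<Longrightarrow> normal (x + y)"
proof -
  assume "normal x" "normal y"
  then obtain x' y' where z: "nspan x'" "nspan y'" "reduces x x'" "reduces y y'" by (auto simp: normal_def)
  have "reduces (x + y) (x' + y')"
  proof (rule reducesI)
    fix \<I> assume I: "gam_omg_ideal \<I> \<sigma>"
    then interpret gam_omg_ideal \<I> \<sigma> .
    show "eqv (x + y) (x' + y')" using reducesD[OF z(3) I] reducesD[OF z(4) I] by (rule eqv_add)
  qed
  then show ?thesis using z nspan_add by (auto simp: normal_def)
qed

lemma normal_sum: "(\<And>i. i \<in> A \<Longrightarrow> normal (f i)) \<Longrightarrow> normal (\<Sum>i\<in>A. f i)"
  by (induction A rule: infinite_finite_induct) (auto intro: normal_add normal_nspan nspan_zero)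

lemma reduces_left: "reduces x y \<Longrightarrow> reduces (z * x) (z * y)"
proof (rule reducesI)
  fix \<I> assume xy: "reduces x y" and I: "gam_omg_ideal \<I> \<sigma>"
  then interpret gam_omg_ideal \<I> \<sigma> by simp
  show "eqv (z * x) (z * y)" using reducesD[OF xy I] by (rule eqv_left)
qed

lemma normal_left:
  assumes "\<And>I a J. normal (z * (omg_word I * scalar a * gam_word J))" "normal x"
  shows "normal (z * x)"
proof -
  obtain y where y: "nspan y" "reduces x y" using assms(2) by (auto simp: normal_def)
  from y(1) have "normal (z * y)"
    by induction (auto simp: distrib_left intro: assms(1) normal_add normal_nspan nspan_zero)
  then show ?thesis using reduces_left[OF y(2)] normal_reduces by blast
qed

lemma normal_scalar: "normal x \<Longrightarrow> normal (scalar b * x)"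
proof (rule normal_left)
  fix I J :: "'n list" and a
  have "scalar b * (omg_word I * scalar a * gam_word J) = omg_word I * scalar (b * a) * gam_word J"
    by (simp add: scalar_simps mult.assoc flip: scalar_left_commute[of "omg_word I"])
  then show "normal (scalar b * (omg_word I * scalar a * gam_word J))"
    by (simp add: normal_nspan nspan_term)
qed

lemma normal_omg: "normal x \<Longrightarrow> normal (omg k * x)"
proof (rule normal_left)
  fix I J :: "'n list" and a
  have "omg k * (omg_word I * scalar a * gam_word J) = omg_word (I @ [k]) * scalar a * gam_word J"
    by (simp add: omg_word_simps mult.assoc)
  then show "normal (omg k * (omg_word I * scalar a * gam_word J))"
    by (simp only: normal_nspan nspan_term)
qed

lemma normal_minus: "normal x \<Longrightarrow> normal (- x)"
  using normal_scalar[of x "-1"] by (simp add: scalar_simps)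

lemma normal_gam: "normal x \<Longrightarrow> normal (gam j * x)"
proof (rule normal_left)
  fix I J :: "'n list" and a
  show "normal (gam j * (omg_word I * scalar a * gam_word J))"
  proof (induction I arbitrary: j rule: rev_induct)
    case Nil
    have "gam j * (omg_word [] * scalar a * gam_word J) = omg_word [] * scalar a * gam_word (j # J)"
      by (simp add: omg_word_simps gam_word_simps scalar_left_commute[of "gam j"] mult.assoc)
    then show ?case by (simp only: normal_nspan nspan_term)
  next
    case (snoc k I)
    let ?w = "omg_word I * scalar a * gam_word J"
    let ?y = "- (\<Sum>p\<in>UNIV. \<Sum>x\<in>UNIV. omg p * (scalar (Bi $ (p, j) $ (x, k)) * (gam x * ?w))) + scalar (delta k j) * ?w"
    have "reduces (gam j * (omg_word (I @ [k]) * scalar a * gam_word J)) ?y"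
    proof (rule reducesI)
      fix \<I> assume "gam_omg_ideal \<I> \<sigma>"
      then interpret gam_omg_ideal \<I> \<sigma> .
      have "gam j * (omg_word (I @ [k]) * scalar a * gam_word J) = gam j * omg k * ?w"
        by (simp add: omg_word_simps mult.assoc)
      also have "eqv \<dots> ((- (\<Sum>p\<in>UNIV. \<Sum>x\<in>UNIV. omg p * scalar (Bi $ (p, j) $ (x, k)) * gam x) + scalar (delta k j)) * ?w)"
        by (intro eqv_right gam_omg)
      also have "(- (\<Sum>p\<in>UNIV. \<Sum>x\<in>UNIV. omg p * scalar (Bi $ (p, j) $ (x, k)) * gam x) + scalar (delta k j)) * ?w = ?y"
        by (simp add: distrib_right left_diff_distrib sum_distrib_right mult.assoc)
      finally show "eqv (gam j * (omg_word (I @ [k]) * scalar a * gam_word J)) ?y" .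
    qed
    moreover have "normal ?y"
      by (intro normal_add normal_minus normal_sum normal_omg normal_scalar snoc) (rule normal_nspan[OF nspan_term])
    ultimately show ?case by (rule normal_reduces)
  qed
qed

lemma normal_nb: "normal x \<Longrightarrow> normal (nb p t T 1 * x)"
proof -
  assume x: "normal x"
  have g: "normal (gam_word J * x)" for J
    using x by (induction J) (simp_all add: gam_word_simps mult.assoc normal_gam)
  have o: "normal y \<Longrightarrow> normal (omg_word I * y)" for I y
    by (induction I arbitrary: y) (simp_all add: omg_word_simps mult.assoc normal_omg)
  show ?thesis
    unfolding nb_def sum_distrib_right mult.assoc mult_1_left by (intro normal_sum o normal_scalar g)
qed

lemma nbs_extend: "M \<le> N \<Longrightarrow> nbs N (\<lambda>I J. if length I < M \<and> length J < M then T I J else 0) = nbs M T"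
proof -
  assume MN: "M \<le> N"
  let ?T = "\<lambda>I J. if length I < M \<and> length J < M then T I J else 0"
  have "nb p t ?T 1 = (if p < M \<and> t < M then nb p t T 1 else 0)" for p t
    by (auto simp: nb_def scalar_simps)
  then have "nbs N ?T = (\<Sum>p<N. if p < M then \<Sum>t<N. if t < M then nb p t T 1 else 0 else 0)"
    unfolding nbs_def by (intro sum.cong refl) auto
  also have "\<dots> = (\<Sum>p<M. if p < M then \<Sum>t<N. if t < M then nb p t T 1 else 0 else 0)"
    by (rule sum.mono_neutral_right) (use MN in auto)
  also have "\<dots> = (\<Sum>p<M. \<Sum>t<M. nb p t T 1)"
  proof (intro sum.cong refl)
    fix p assume "p \<in> {..<M}"
    have "(\<Sum>t<N. if t < M then nb p t T 1 else 0) = (\<Sum>t<M. if t < M then nb p t T 1 else 0)"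
      by (rule sum.mono_neutral_right) (use MN in auto)
    then show "(if p < M then \<Sum>t<N. if t < M then nb p t T 1 else 0 else 0) = (\<Sum>t<M. nb p t T 1)"
      using \<open>p \<in> {..<M}\<close> by simp
  qed
  finally show ?thesis by (simp add: nbs_def)
qed

lemma nbs_add: "nbs M (\<lambda>I J. T I J + S I J) = nbs M T + nbs M S"
  by (simp add: nbs_def nb_add sum.distrib)

lemma nspan_nbs: "nspan x \<Longrightarrow> \<exists>M T. x = nbs M T"
proof (induction rule: nspan.induct)
  case nspan_zero
  show ?case by (rule exI[of _ 0]) (simp add: nbs_def)
next
  case (nspan_term I a J)
  let ?M = "Suc (max (length I) (length J))" and ?T = "\<lambda>I' J'. if I' = I then if J' = J then a else 0 else 0"
  have "nb p t ?T 1 = (if p = length I then if t = length J then omg_word I * scalar a * gam_word J else 0 else 0)" for p t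
  proof -
    have "nb p t ?T 1 = (\<Sum>I'\<in>words p. \<Sum>J'\<in>words t. if I' = I then if J' = J then omg_word I * scalar a * gam_word J else 0 else 0)"
      unfolding nb_def by (intro sum.cong refl) (auto simp: scalar_simps)
    then show ?thesis by (auto simp: sum_if_const)
  qed
  then have "nbs ?M ?T = (\<Sum>p<?M. if p = length I then \<Sum>t<?M. if t = length J then omg_word I * scalar a * gam_word J else 0 else 0)"
    unfolding nbs_def by (intro sum.cong refl) auto
  also have "\<dots> = omg_word I * scalar a * gam_word J" by simp
  finally show ?case by metis
next
  case (nspan_add x y)
  then obtain M T N S where "x = nbs M T" "y = nbs N S" by blast
  then have "x + y = nbs (max M N) (\<lambda>I J. (if length I < M \<and> length J < M then T I J else 0) + (if length I < N \<and> length J < N then S I J else 0))"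
    by (simp add: nbs_add nbs_extend)
  then show ?case by blast
qed

section \<open>The square of the BRST operator\<close>

lemma act_Qg_vac: "act Bi (brst_ideal.Qg Y M) vac u = 0" if "brst_ideal \<sigma> C \<I> Y M"
proof -
  have "act Bi (nb (Suc r) r (Y r) 1) vac u = 0" if "1 \<le> r" for r
  proof -
    have "act Bi (gam_word J) vac = (\<lambda>u. 0)" if "length J = r" for J
      using that \<open>1 \<le> r\<close> by (intro ext act_gam_word_vac) auto
    then show ?thesis by (simp add: act_nb act_zero_vec)
  qed
  then show ?thesis unfolding brst_ideal.Qg_def[OF that] act_sum by simp
qed

end

lemma (in brst_ideal) Qg_square: "Qg * Qg \<doteq> 0"
proof -
  interpret fw: wedge_ideal fock_ideal \<sigma> by (rule fock_wedge)
  interpret fg: gam_omg_ideal fock_ideal \<sigma> by (rule fock_gam_omg)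
  \<comment> \<open>\<open>Qg\<close> is the same element of the free algebra as before; only the
    ideal of the congruence is exchanged.\<close>
  interpret fi: brst_ideal \<sigma> C fock_ideal Y M
    by unfold_locales (rule Y_w, rule Y_zero)
  have "normal (Qg * (Qg * 1))"
    unfolding Qg_def sum_distrib_right
    by (intro normal_sum normal_nb) (use normal_nspan[OF nspan_term[of "[]" 1 "[]"]] in \<open>simp add: omg_word_simps gam_word_simps scalar_simps\<close>)
  then obtain N T where red: "reduces (Qg * Qg) (nbs N T)"
    using nspan_nbs unfolding normal_def by (metis mult_1_right)
  have "(antisymmetrizer \<sigma> p \<odot>\<^bsub>p\<^esub> T \<odot>\<^bsub>t\<^esub> antisymmetrizer \<sigma> t) I J = 0"
    if "p < N" "t < N" "length I = p" "length J = t" for p t I J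
    using _ that
  proof (rule nbs_faithful)
    fix K
    have "act Bi Qg vac = (\<lambda>u. 0)"
      using act_Qg_vac[OF brst_ideal_axioms] by auto
    then have 0: "act Bi (omg_word K * (Qg * Qg)) vac = (\<lambda>u. 0)"
      by (simp only: act_mult act_zero_fun)
    \<comment> \<open>On the vacuum the second product gives zero, so the normal form sends every
      vector created by \<Omega> into \<open>null_vecs\<close>, as \<open>nbs_faithful\<close>
      requires.\<close>
    have "nbs N T * omg_word K - omg_word K * (Qg * Qg) \<in> fock_ideal"
    proof -
      have "fw.eqv (nbs N T * omg_word K) (Qg * Qg * omg_word K)"
        by (rule fw.eqv_right[OF fw.eqv_sym[OF reducesD[OF red fock_gam_omg]]])
      from fw.eqv_trans[OF this fi.Qg_square_omg_word] show ?thesis by (simp add: fw.eqv_def)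
    qed
    then have "act Bi (nbs N T * omg_word K - omg_word K * (Qg * Qg)) vac \<in> null_vecs" by (simp add: fock_ideal_def)
    moreover have "act Bi (nbs N T * omg_word K - omg_word K * (Qg * Qg)) vac = act Bi (nbs N T) (act Bi (omg_word K) vac)"
      by (rule ext) (simp add: act_diff 0 act_mult[of _ "nbs N T"])
    ultimately show "act Bi (nbs N T) (act Bi (omg_word K) vac) \<in> null_vecs" by simp
  qed
  then have "nbs N T \<doteq> (\<Sum>p<N. \<Sum>t<N. 0)"
    unfolding nbs_def by (intro eqv_sum nb_eqv_0) auto
  then show ?thesis
    using eqv_trans[OF reducesD[OF red gam_omg_ideal_axioms]] by simp
qed

section \<open>Passage to the quotient ring\<close>

lemma ring_free_ring: "ring free_ring"
  by (rule ringI; (rule abelian_groupI)?; (rule monoidI)?)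
    (auto simp: free_ring_def algebra_simps intro: exI[of _ "- x" for x])

context quantum_lie
begin

lemma Gamma_two_sided: "two_sided_ideal (Gamma_ideal \<sigma> C)"
  and Gamma_ideal: "ideal (Gamma_ideal \<sigma> C) free_ring"
  and Gamma_rels: "chi_rels \<sigma> C \<union> gam_rels \<sigma> \<union> omg_rels \<sigma> \<union> gam_chi_rels \<sigma> C \<union> gam_omg_rels \<sigma> \<union> chi_omg_rels \<sigma> C
    \<subseteq> Gamma_ideal \<sigma> C"
proof -
  interpret R: ring "free_ring :: 'n generator free_alg ring" by (rule ring_free_ring)
  have car: "A \<subseteq> carrier free_ring" for A :: "'n generator free_alg set" by (simp add: free_ring_def)
  show I: "ideal (Gamma_ideal \<sigma> C) free_ring"
    unfolding Gamma_ideal_def by (rule R.genideal_ideal[OF car])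
  show "chi_rels \<sigma> C \<union> gam_rels \<sigma> \<union> omg_rels \<sigma> \<union> gam_chi_rels \<sigma> C \<union> gam_omg_rels \<sigma> \<union> chi_omg_rels \<sigma> C
    \<subseteq> Gamma_ideal \<sigma> C"
    unfolding Gamma_ideal_def by (rule R.genideal_self[OF car])
  interpret I: ideal "Gamma_ideal \<sigma> C" free_ring by (rule I)
  show "two_sided_ideal (Gamma_ideal \<sigma> C)"
  proof
    show "0 \<in> Gamma_ideal \<sigma> C" using I.zero_closed by (simp add: free_ring_def)
    show "x + y \<in> Gamma_ideal \<sigma> C" if "x \<in> Gamma_ideal \<sigma> C" "y \<in> Gamma_ideal \<sigma> C" for x y
      using I.a_closed[OF that] by (simp add: free_ring_def)
    show "a * x \<in> Gamma_ideal \<sigma> C" if "x \<in> Gamma_ideal \<sigma> C" for a x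
      using I.I_l_closed[OF that, of a] by (simp add: free_ring_def)
    show "x * a \<in> Gamma_ideal \<sigma> C" if "x \<in> Gamma_ideal \<sigma> C" for a x
      using I.I_r_closed[OF that, of a] by (simp add: free_ring_def)
  qed
qed

lemma brst_square:
  assumes "brst_tensors \<sigma> C h X" "is_height \<sigma> h"
  shows "brst_rep h X * brst_rep h X \<in> Gamma_ideal \<sigma> C"
proof -
  define Y where "Y r = (if r < h then X r else (\<lambda>I J. 0))" for r
  interpret two_sided_ideal "Gamma_ideal \<sigma> C" by (rule Gamma_two_sided)
  interpret brst_full_ideal \<sigma> C "Gamma_ideal \<sigma> C" Y "h - 1"
  proof unfold_locales
    show "alt s a (Suc (Suc r)) * op a (Suc (Suc r)) (Suc r) (Y (Suc r)) * alt s a (Suc r) = w a (Suc r)" for a r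
      using brst_tensors_w[OF assms] by (simp only: Y_def)
    show "Y r I J = 0" if "h - 1 < r" for r I J using that by (simp add: Y_def)
  qed (use Gamma_rels in blast)+
  have "brst_rep h X = Q0 + Qg"
    unfolding brst_rep_def Q0_def Qg_def nb_def
    by (intro arg_cong2[of _ _ _ _ plus] sum.cong refl) (auto simp: Y_def)
  then show ?thesis
    using eqv_trans[OF square_eqv Qg_square] by (simp add: eqv_zero_iff)
qed

end

theorem mainTheorem1:
  fixes \<sigma> :: "'n::finite braiding" and C :: "'n struct_consts" and h :: nat
  assumes "quantum_lie \<sigma> C"
    and "is_height \<sigma> h"
  shows "(\<exists>X. brst_tensors \<sigma> C h X) \<and>
    (\<forall>X. brst_tensors \<sigma> C h X \<longrightarrow>
       brst \<sigma> C h X \<in> carrier (Gamma_wedge_Omega \<sigma> C) \<and>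
       brst \<sigma> C h X \<otimes>\<^bsub>Gamma_wedge_Omega \<sigma> C\<^esub> brst \<sigma> C h X = \<zero>\<^bsub>Gamma_wedge_Omega \<sigma> C\<^esub>)"
proof -
  interpret quantum_lie \<sigma> C by (rule assms(1))
  interpret I: ideal "Gamma_ideal \<sigma> C" free_ring by (rule Gamma_ideal)
  have car: "x \<in> carrier free_ring" for x :: "'n generator free_alg" by (simp add: free_ring_def)
  have "brst \<sigma> C h X \<in> carrier (Gamma_wedge_Omega \<sigma> C)" for X
    unfolding brst_def Gamma_wedge_Omega_def FactRing_def A_RCOSETS_def'
    using car[of "brst_rep h X"] by auto
  moreover have "brst \<sigma> C h X \<otimes>\<^bsub>Gamma_wedge_Omega \<sigma> C\<^esub> brst \<sigma> C h X = \<zero>\<^bsub>Gamma_wedge_Omega \<sigma> C\<^esub>"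
    if "brst_tensors \<sigma> C h X" for X
  proof -
    let ?q = "brst_rep h X"
    have "brst \<sigma> C h X \<otimes>\<^bsub>Gamma_wedge_Omega \<sigma> C\<^esub> brst \<sigma> C h X = Gamma_ideal \<sigma> C +>\<^bsub>free_ring\<^esub> (?q \<otimes>\<^bsub>free_ring\<^esub> ?q)"
      unfolding brst_def Gamma_wedge_Omega_def FactRing_def by (simp add: I.rcoset_mult_add[OF car car])
    also have "?q \<otimes>\<^bsub>free_ring\<^esub> ?q = ?q * ?q" by (simp add: free_ring_def)
    also have "Gamma_ideal \<sigma> C +>\<^bsub>free_ring\<^esub> (?q * ?q) = Gamma_ideal \<sigma> C"
      by (rule I.a_rcos_const[OF brst_square[OF that assms(2)]])
    finally show ?thesis by (simp add: Gamma_wedge_Omega_def FactRing_def)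
  qed
  ultimately show ?thesis using brst_tensors_exist by blast
qed

end
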